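(* Let $X=\{0,1\}^{\mathbb{N}}$ and let $f:X\to\mathbb{R}$ be Lipschitz with $f>0$ such that $M_{max}(f)=\{\mu_\infty\}$ is a singleton. If $c(1-s)\to0$ fast enough, then for every cylinder $k$ one has $\frac1c\log\mu_{c,s}(k)\to-\inf_{x\in k}I_{BLT}(x)$. Precisely: there exists a function $c\mapsto s_c\in(0,1)$ with $c(1-s_c)\to0$ as $c\to\infty$ such that for every cylinder $k\subset X$, $$\lim_{c\to\infty,\ s_c<s<1}\frac1c\log\mu_{c,s}(k)=\lim_{c\to\infty}\frac1c\log\mu_{cf}(k)=-\inf_{x\in k}I_{BLT}(x),$$ where the first limit means the limit along any pairs $(c,s)$ with $c\to\infty$ and $s_c<s<1$.
   Context: $\sigma$ is the shift on $X$, with metric $d(x,y)=\theta^{N}$, where $N$ is the first index with $x_N\ne y_N$ (and $d(x,x)=0$), $0<\theta<1$ fixed; Lipschitz is with respect to this metric. A cylinder is a set $\{x\in X: x_1=a_1,\dots,x_m=a_m\}$. $g^n(x)=\sum_{i=0}^{n-1}g(\sigma^i x)$; $\mathrm{Fix}_n=\{x:\sigma^n(x)=x\}$; $P(\cdot)$ is topological pressure. $\mathcal{M}$ is the set of $\sigma$-invariant Borel probabilities, $\beta(f)=\sup_{\nu\in\mathcal{M}}\int f\,d\nu$, $M_{max}(f)=\{\nu\in\mathcal{M}:\int f\,d\nu=\beta(f)\}$. For $c>0$, $s\in(0,1)$, $\mu_{c,s}\in\mathcal{M}$ is given by $$\int g\,d\mu_{c,s}=\frac{\sum_{n=1}^{\infty}\sum_{x\in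 \mathrm{Fix}_{n}}e^{c s f^{n}(x)-nP(cf)}\frac{g^{n}(x)}{n}}{\sum_{n=1}^{\infty}\sum_{x\in \mathrm{Fix}_{n}}e^{c s f^{n}(x)-nP(cf)}}$$ for continuous $g$ (the series converge since $P(csf-P(cf))<0$). $\mu_{cf}$ denotes the ($\sigma$-invariant) equilibrium state of $cf$. $I_{BLT}:X\to[0,\infty]$ is the non-negative lower semi-continuous deviation function of Baraviera, Lopes and Thieullen for the family $\mu_{cf}$, $c\to\infty$: by their theorem, when $M_{max}(f)$ is a singleton it exists, and it is the (necessarily unique) lower semi-continuous function such that $\lim_{c\to\infty}\frac1c\log\mu_{cf}(k)=-\inf_{x\in k}I_{BLT}(x)$ for every cylinder $k$. This known large deviation principle for $\mu_{cf}$ may be taken as given. *)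

theory Defs
  imports "HOL-Probability.Probability"
begin

text \<open>
  The space \<open>{0,1}\<^sup>\<nat>\<close> is the function type below with the library's product topology and its
  Borel sigma-algebra. Coordinates are counted from 0, so the coordinate written \<open>x\<^sub>1\<close> in
  the usual notation is \<open>x 0\<close>.
\<close>

type_synonym seq = "nat \<Rightarrow> bool"

definition shift :: "seq \<Rightarrow> seq" where
  "shift x = (\<lambda>i. x (Suc i))"

text \<open>The exponent is a successor because the first coordinate has number 1 in the usual notation.\<close>

definition seq_dist :: "real \<Rightarrow> seq \<Rightarrow> seq \<Rightarrow> real" where
  "seq_dist \<theta> x y = (if x = y then 0 else \<theta> ^ Suc (LEAST i. x i \<noteq> y i))"

definition seq_lipschitz :: "real \<Rightarrow> (seq \<Rightarrow> real) \<Rightarrow> bool" where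
  "seq_lipschitz \<theta> f \<longleftrightarrow> (\<exists>L. \<forall>x y. \<bar>f x - f y\<bar> \<le> L * seq_dist \<theta> x y)"

definition cylinder :: "seq set \<Rightarrow> bool" where
  "cylinder k \<longleftrightarrow> (\<exists>m\<ge>1. \<exists>a :: seq. k = {x. \<forall>i<m. x i = a i})"

definition birkhoff_sum :: "(seq \<Rightarrow> real) \<Rightarrow> nat \<Rightarrow> seq \<Rightarrow> real" where
  "birkhoff_sum g n x = (\<Sum>i<n. g ((shift ^^ i) x))"

definition Fix :: "nat \<Rightarrow> seq set" where
  "Fix n = {x. (shift ^^ n) x = x}"

definition invariant_probs :: "seq measure set" where
  "invariant_probs =
     {\<nu>. prob_space \<nu> \<and> sets \<nu> = sets borel \<and> distr \<nu> \<nu> shift = \<nu>}"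

definition max_mean :: "(seq \<Rightarrow> real) \<Rightarrow> real" where
  "max_mean f = (SUP \<nu>\<in>invariant_probs. integral\<^sup>L \<nu> f)"

definition maximizing_probs :: "(seq \<Rightarrow> real) \<Rightarrow> seq measure set" where
  "maximizing_probs f = {\<nu> \<in> invariant_probs. integral\<^sup>L \<nu> f = max_mean f}"

text \<open>
  Topological pressure by separated sets, with respect to the metric \<open>seq_dist \<theta>\<close>.
  Separated sets are finite by compactness; finiteness is written out only because \<open>sum\<close>
  is 0 on infinite sets. The limit for \<open>\<epsilon> \<rightarrow> 0\<close> is monotone, hence the
  supremum over \<open>\<epsilon>\<close>.
\<close>

definition separated :: "real \<Rightarrow> nat \<Rightarrow> real \<Rightarrow> seq set \<Rightarrow> bool" where
  "separated \<theta> n \<epsilon> E \<longleftrightarrow> finite E \<and>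
     (\<forall>x\<in>E. \<forall>y\<in>E. x \<noteq> y \<longrightarrow> (\<exists>i<n. seq_dist \<theta> ((shift ^^ i) x) ((shift ^^ i) y) > \<epsilon>))"

definition partition_sum :: "real \<Rightarrow> (seq \<Rightarrow> real) \<Rightarrow> nat \<Rightarrow> real \<Rightarrow> real" where
  "partition_sum \<theta> \<phi> n \<epsilon> =
     (SUP E\<in>{E. separated \<theta> n \<epsilon> E}. \<Sum>x\<in>E. exp (birkhoff_sum \<phi> n x))"

definition pressure :: "real \<Rightarrow> (seq \<Rightarrow> real) \<Rightarrow> ereal" where
  "pressure \<theta> \<phi> =
     (SUP \<epsilon>\<in>{0<..}. limsup (\<lambda>n. ereal (ln (partition_sum \<theta> \<phi> n \<epsilon>) / real n)))"

text \<open>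
  Kolmogorov--Sinai entropy of the shift. The \<open>limsup\<close> is a limit for invariant
  \<open>\<nu>\<close>, by subadditivity.
\<close>

definition refinement :: "seq set set \<Rightarrow> nat \<Rightarrow> seq set set" where
  "refinement Q n = {\<Inter>i<n. (shift ^^ i) -` A i | A. \<forall>i<n. A i \<in> Q} - {{}}"

definition partition_entropy :: "seq measure \<Rightarrow> seq set set \<Rightarrow> real" where
  "partition_entropy \<nu> Q = - (\<Sum>A\<in>Q. measure \<nu> A * ln (measure \<nu> A))"

definition ks_entropy :: "seq measure \<Rightarrow> ereal" where
  "ks_entropy \<nu> =
     (SUP Q\<in>{Q. finite Q \<and> Q \<subseteq> sets borel \<and> partition_on UNIV Q}.
        limsup (\<lambda>n. ereal (partition_entropy \<nu> (refinement Q n) / real n)))"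

definition equilibrium_state :: "real \<Rightarrow> (seq \<Rightarrow> real) \<Rightarrow> seq measure \<Rightarrow> bool" where
  "equilibrium_state \<theta> \<phi> \<nu> \<longleftrightarrow>
     \<nu> \<in> invariant_probs \<and> ks_entropy \<nu> + ereal (integral\<^sup>L \<nu> \<phi>) = pressure \<theta> \<phi>"

definition zeta_weight :: "real \<Rightarrow> (seq \<Rightarrow> real) \<Rightarrow> real \<Rightarrow> real \<Rightarrow> nat \<Rightarrow> seq \<Rightarrow> real" where
  "zeta_weight \<theta> f c s n x =
     exp (c * s * birkhoff_sum f n x
          - real n * real_of_ereal (pressure \<theta> (\<lambda>y. c * f y)))"

definition zeta_probability ::
  "real \<Rightarrow> (seq \<Rightarrow> real) \<Rightarrow> real \<Rightarrow> real \<Rightarrow> seq measure \<Rightarrow> bool" where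
  "zeta_probability \<theta> f c s \<nu> \<longleftrightarrow>
     \<nu> \<in> invariant_probs \<and>
     (\<forall>g. continuous_on UNIV g \<longrightarrow>
        integral\<^sup>L \<nu> g =
          (\<Sum>n. \<Sum>x\<in>Fix (Suc n).
              zeta_weight \<theta> f c s (Suc n) x * (birkhoff_sum g (Suc n) x / real (Suc n)))
          / (\<Sum>n. \<Sum>x\<in>Fix (Suc n). zeta_weight \<theta> f c s (Suc n) x))"

text \<open>The library has \<open>ln 0 = 0\<close>; here the logarithm of 0 is \<open>-\<infinity>\<close>.\<close>

definition log_measure :: "'a measure \<Rightarrow> 'a set \<Rightarrow> ereal" where
  "log_measure \<nu> A = (if measure \<nu> A = 0 then -\<infinity> else ereal (ln (measure \<nu> A)))"

definition lower_semicontinuous :: "('a::topological_space \<Rightarrow> 'b::linorder) \<Rightarrow> bool" where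
  "lower_semicontinuous I \<longleftrightarrow> (\<forall>x. \<forall>a<I x. \<forall>\<^sub>F y in nhds x. a < I y)"

text \<open>
  For a family of equilibrium states of \<open>c f\<close> this property characterises the function
  \<open>I\<^sub>B\<^sub>L\<^sub>T\<close> of Baraviera, Lopes and Thieullen.
\<close>

definition deviation_function :: "(real \<Rightarrow> seq measure) \<Rightarrow> (seq \<Rightarrow> ennreal) \<Rightarrow> bool" where
  "deviation_function \<mu> I \<longleftrightarrow>
     lower_semicontinuous I \<and>
     (\<forall>k. cylinder k \<longrightarrow>
        ((\<lambda>c. ereal (1 / c) * log_measure (\<mu> c) k)
           \<longlongrightarrow> - enn2ereal (INF x\<in>k. I x)) at_top)"

end

theory Submission
  imports Defs
begin

text \<open>
  The potential \<open>g = c f\<close> has bounded distortion, so the sums over periodic words are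
  multiplicative up to constants and the pressure is their growth rate with a bounded error. For an
  indicator \<open>h\<close> of a cylinder, the convex function \<open>t \<mapsto> P(g + t h)\<close> is differentiable at
  \<open>0\<close>: at a kink with one-sided derivatives \<open>a < b\<close>, the averages of \<open>h\<close> along
  long words would be close to \<open>b\<close>, and also close to \<open>a\<close>, with probability bounded below;
  gluing \<open>j\<close> blocks of the first kind to \<open>M - j\<close> blocks of the second kind gives, for
  \<open>0 < j < M\<close>, disjoint events of probability bounded below independently of \<open>M\<close>,
  which is absurd for large \<open>M\<close>.

  By the variational inequality the measure of the cylinder under an equilibrium state of \<open>g\<close> is
  this derivative. The averages over periodic orbits of length \<open>n\<close> with weights given by
  \<open>s g\<close> are derivatives of convex functions close to the pressure for large \<open>n\<close> and
  \<open>s\<close> near \<open>1\<close>, so they tend to the same number. The zeta measure is a mixture of these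
  averages in which large \<open>n\<close> prevails as \<open>s \<rightarrow> 1\<close>. Hence, for fixed \<open>c\<close>,
  it converges on every cylinder to the equilibrium state, whose value there is positive; as there are
  countably many cylinders, a diagonal choice of \<open>s\<^sub>c\<close> makes the logarithms differ by at
  most \<open>1\<close>, which is negligible after division by \<open>c\<close>.
\<close>

section \<open>Periodic words and the growth of their partition sums\<close>

text \<open>An equilibrium state is given only by an equality between entropy, integral and
  pressure, so a cylinder is reached by convex duality: applied to g + t h, the inequality entropy +
  integral \<le> pressure makes its measure a subgradient of t \<mapsto> P(g + t h) at 0, and
  differentiability admits only one subgradient. The probabilities bounded below in the kink
  argument come from a bounded gluing cost: ln Z differs from n P by a bounded amount, not merely
  o(n), so tilts of size 1/n can be tested. Entropy is a supremum over all finite Borel partitions,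
  hence Borel sets must be approximated by sets of words before a word can predict an itinerary.
  Positivity of f enters through compactness: f \<ge> a > 0 makes the weights at s < 1 decay like
  exp(-(1-s) c a n), so the zeta series converge, while their sums still grow without bound as s
  tends to 1.\<close>

definition per :: "bool list \<Rightarrow> seq" where
  "per w = (\<lambda>i. w ! (i mod length w))"

definition words :: "nat \<Rightarrow> bool list set" where
  "words n = {w. length w = n}"

definition wsum :: "(seq \<Rightarrow> real) \<Rightarrow> bool list \<Rightarrow> real" where
  "wsum g w = birkhoff_sum g (length w) (per w)"

text \<open>For \<open>n > 0\<close> this is the sum over \<open>Fix n\<close> of exponentiated
  Birkhoff sums, indexed by words so that concatenation can act on it.\<close>

definition Z :: "(seq \<Rightarrow> real) \<Rightarrow> nat \<Rightarrow> real" where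
  "Z g n = (\<Sum>w\<in>words n. exp (wsum g w))"

text \<open>Bowen's condition, with \<open>D\<close> independent of \<open>n\<close>. Lipschitz
  potentials and indicators of cylinders share it, and it passes to linear combinations, hence to
  tilts.\<close>

definition bounded_distortion :: "real \<Rightarrow> (seq \<Rightarrow> real) \<Rightarrow> bool" where
  "bounded_distortion D g \<longleftrightarrow>
     (\<forall>n x y. (\<forall>i<n. x i = y i) \<longrightarrow> \<bar>birkhoff_sum g n x - birkhoff_sum g n y\<bar> \<le> D)"

lemma shift_funpow: "(shift ^^ n) x = (\<lambda>i. x (n + i))"
  by (induction n arbitrary: x) (simp_all add: shift_def)

lemma birkhoff_sum_add:
  "birkhoff_sum g (n + m) x = birkhoff_sum g n x + birkhoff_sum g m ((shift ^^ n) x)"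
  unfolding birkhoff_sum_def shift_funpow
  by (induction m) (auto simp: algebra_simps)

lemma birkhoff_sum_linear:
  "birkhoff_sum (\<lambda>x. a * g x + b * h x) n x = a * birkhoff_sum g n x + b * birkhoff_sum h n x"
  unfolding birkhoff_sum_def by (simp add: sum.distrib sum_distrib_left)

lemma wsum_linear: "wsum (\<lambda>x. a * g x + b * h x) w = a * wsum g w + b * wsum h w"
  unfolding wsum_def by (rule birkhoff_sum_linear)

lemma bounded_distortionD:
  "bounded_distortion D g \<Longrightarrow> (\<And>i. i < n \<Longrightarrow> x i = y i) \<Longrightarrow>
     \<bar>birkhoff_sum g n x - birkhoff_sum g n y\<bar> \<le> D"
  by (simp add: bounded_distortion_def)

lemma bounded_distortion_nonneg:
  assumes "bounded_distortion D g"
  shows "0 \<le> D"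
  using bounded_distortionD[OF assms, of 0] by (simp add: birkhoff_sum_def)

lemma bounded_distortion_mono:
  assumes "bounded_distortion D g" "D \<le> D'"
  shows "bounded_distortion D' g"
  unfolding bounded_distortion_def
proof (intro allI impI)
  fix n and x y :: seq
  assume "\<forall>i<n. x i = y i"
  then have "\<bar>birkhoff_sum g n x - birkhoff_sum g n y\<bar> \<le> D"
    using bounded_distortionD[OF assms(1)] by simp
  with assms(2) show "\<bar>birkhoff_sum g n x - birkhoff_sum g n y\<bar> \<le> D'" by simp
qed

lemma bounded_distortion_linear:
  assumes "bounded_distortion D g" "bounded_distortion E h"
  shows "bounded_distortion (\<bar>a\<bar> * D + \<bar>b\<bar> * E) (\<lambda>x. a * g x + b * h x)"
  unfolding bounded_distortion_def birkhoff_sum_linear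
proof (intro allI impI)
  fix n and x y :: seq
  assume "\<forall>i<n. x i = y i"
  then have 1: "\<bar>birkhoff_sum g n x - birkhoff_sum g n y\<bar> \<le> D"
    and 2: "\<bar>birkhoff_sum h n x - birkhoff_sum h n y\<bar> \<le> E"
    using assms by (simp_all add: bounded_distortion_def)
  have "a * birkhoff_sum g n x + b * birkhoff_sum h n x
          - (a * birkhoff_sum g n y + b * birkhoff_sum h n y)
      = a * (birkhoff_sum g n x - birkhoff_sum g n y) + b * (birkhoff_sum h n x - birkhoff_sum h n y)"
    by (simp add: algebra_simps)
  also have "\<bar>\<dots>\<bar> \<le> \<bar>a\<bar> * \<bar>birkhoff_sum g n x - birkhoff_sum g n y\<bar>
      + \<bar>b\<bar> * \<bar>birkhoff_sum h n x - birkhoff_sum h n y\<bar>"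
    by (rule order_trans[OF abs_triangle_ineq]) (simp add: abs_mult)
  also have "\<dots> \<le> \<bar>a\<bar> * D + \<bar>b\<bar> * E"
    using 1 2 by (intro add_mono mult_left_mono) auto
  finally show "\<bar>a * birkhoff_sum g n x + b * birkhoff_sum h n x
          - (a * birkhoff_sum g n y + b * birkhoff_sum h n y)\<bar> \<le> \<bar>a\<bar> * D + \<bar>b\<bar> * E" .
qed

section \<open>Concatenation of words and almost multiplicative partition sums\<close>

lemma finite_words [simp]: "finite (words n)"
  using finite_lists_length_eq[of "UNIV :: bool set" n] by (simp add: words_def)

lemma words_nonempty [simp]: "words n \<noteq> {}"
  unfolding words_def using Ex_list_of_length by auto

lemma sum_words_add:
  fixes F :: "bool list \<Rightarrow> real"
  shows "(\<Sum>w\<in>words (n + m). F w) = (\<Sum>u\<in>words n. \<Sum>v\<in>words m. F (u @ v))"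
proof -
  have "(\<Sum>u\<in>words n. \<Sum>v\<in>words m. F (u @ v)) = (\<Sum>(u, v)\<in>words n \<times> words m. F (u @ v))"
    by (simp add: sum.cartesian_product)
  also have "\<dots> = (\<Sum>w\<in>words (n + m). F w)"
    by (rule sum.reindex_bij_witness[where i = "\<lambda>w. (take n w, drop n w)" and j = "\<lambda>(u, v). u @ v"])
      (auto simp: words_def)
  finally show ?thesis by simp
qed

text \<open>The Birkhoff sum is cut after \<open>length u\<close> steps. On each piece the point
  agrees with \<open>per u\<close> or \<open>per v\<close> as long as the piece lasts, at a cost of
  \<open>D\<close> each.\<close>

lemma wsum_append:
  assumes "bounded_distortion D g"
  shows "\<bar>wsum g (u @ v) - (wsum g u + wsum g v)\<bar> \<le> 2 * D"
proof -
  have 1: "\<bar>birkhoff_sum g (length u) (per (u @ v)) - birkhoff_sum g (length u) (per u)\<bar> \<le> D"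
    by (rule bounded_distortionD[OF assms]) (auto simp: per_def nth_append)
  have 2: "\<bar>birkhoff_sum g (length v) ((shift ^^ length u) (per (u @ v)))
       - birkhoff_sum g (length v) (per v)\<bar> \<le> D"
    by (rule bounded_distortionD[OF assms]) (auto simp: per_def nth_append shift_funpow)
  show ?thesis
    using 1 2 unfolding wsum_def by (simp add: birkhoff_sum_add)
qed

lemma Z_pos: "0 < Z g n"
  unfolding Z_def by (rule sum_pos) auto

text \<open>Subsets \<open>U\<close> and \<open>V\<close> are allowed because the kink argument
  glues selected blocks only.\<close>

lemma sum_exp_wsum_append:
  assumes "bounded_distortion D g" "U \<subseteq> words n" "V \<subseteq> words m"
  shows "exp (- 2 * D) * ((\<Sum>u\<in>U. exp (wsum g u)) * (\<Sum>v\<in>V. exp (wsum g v)))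
           \<le> (\<Sum>u\<in>U. \<Sum>v\<in>V. exp (wsum g (u @ v)))"
    and "(\<Sum>u\<in>U. \<Sum>v\<in>V. exp (wsum g (u @ v)))
           \<le> exp (2 * D) * ((\<Sum>u\<in>U. exp (wsum g u)) * (\<Sum>v\<in>V. exp (wsum g v)))"
proof -
  have "exp (- 2 * D) * ((\<Sum>u\<in>U. exp (wsum g u)) * (\<Sum>v\<in>V. exp (wsum g v)))
      = (\<Sum>u\<in>U. \<Sum>v\<in>V. exp (- 2 * D + (wsum g u + wsum g v)))"
    by (simp only: sum_product exp_add) (simp only: sum_distrib_left)
  also have "\<dots> \<le> (\<Sum>u\<in>U. \<Sum>v\<in>V. exp (wsum g (u @ v)))"
    using wsum_append[OF assms(1)] by (intro sum_mono) (auto simp: abs_le_iff algebra_simps)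
  finally show "exp (- 2 * D) * ((\<Sum>u\<in>U. exp (wsum g u)) * (\<Sum>v\<in>V. exp (wsum g v)))
           \<le> (\<Sum>u\<in>U. \<Sum>v\<in>V. exp (wsum g (u @ v)))" .
  have "(\<Sum>u\<in>U. \<Sum>v\<in>V. exp (wsum g (u @ v)))
      \<le> (\<Sum>u\<in>U. \<Sum>v\<in>V. exp (2 * D + (wsum g u + wsum g v)))"
    using wsum_append[OF assms(1)] by (intro sum_mono) (auto simp: abs_le_iff algebra_simps)
  also have "\<dots> = exp (2 * D) * ((\<Sum>u\<in>U. exp (wsum g u)) * (\<Sum>v\<in>V. exp (wsum g v)))"
    by (simp only: sum_product exp_add) (simp only: sum_distrib_left)
  finally show "(\<Sum>u\<in>U. \<Sum>v\<in>V. exp (wsum g (u @ v)))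
           \<le> exp (2 * D) * ((\<Sum>u\<in>U. exp (wsum g u)) * (\<Sum>v\<in>V. exp (wsum g v)))" .
qed

lemma ln_Z_add:
  assumes "bounded_distortion D g"
  shows "\<bar>ln (Z g (n + m)) - (ln (Z g n) + ln (Z g m))\<bar> \<le> 2 * D"
proof -
  have "exp (- 2 * D) * (Z g n * Z g m) \<le> Z g (n + m)" "Z g (n + m) \<le> exp (2 * D) * (Z g n * Z g m)"
    using sum_exp_wsum_append[OF assms, of "words n" n "words m" m]
    by (auto simp: Z_def sum_words_add)
  then have "ln (exp (- 2 * D) * (Z g n * Z g m)) \<le> ln (Z g (n + m))"
    "ln (Z g (n + m)) \<le> ln (exp (2 * D) * (Z g n * Z g m))"
    using Z_pos[of g] by (auto simp: Z_pos)
  then show ?thesis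
    using Z_pos[of g] by (simp add: ln_mult less_imp_neq[symmetric])
qed

text \<open>Splitting \<open>n * m\<close> into blocks of length \<open>n\<close> or of length
  \<open>m\<close> gives two estimates of the same term, so \<open>a n / n\<close> and
  \<open>a m / m\<close> differ by at most \<open>C / n + C / m\<close>. Letting \<open>m\<close>
  tend to infinity and multiplying by \<open>n\<close> leaves the error \<open>C\<close>.\<close>

lemma almost_additive_limit:
  fixes a :: "nat \<Rightarrow> real"
  assumes "\<And>n m. \<bar>a (n + m) - (a n + a m)\<bar> \<le> C"
  shows "\<exists>p. \<forall>n. \<bar>a n - real n * p\<bar> \<le> C"
proof -
  have C: "0 \<le> C" using assms[of 0 0] by linarith
  have mult: "\<bar>a (k * n) - real k * a n\<bar> \<le> real k * C" if "k > 0" for k n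
    using that
  proof (induction k)
    case (Suc k)
    show ?case
    proof (cases "k = 0")
      case False
      with Suc have "\<bar>a (k * n) - real k * a n\<bar> \<le> real k * C" by simp
      with assms[of n "k * n"] show ?thesis by (simp add: algebra_simps abs_le_iff)
    qed (use C in simp)
  qed simp
  have diff: "\<bar>a n / real n - a m / real m\<bar> \<le> C / real n + C / real m" if "n > 0" "m > 0" for n m
  proof -
    have "\<bar>real m * a n - real n * a m\<bar> \<le> real m * C + real n * C"
      using mult[of m n] mult[of n m] that by (simp add: mult.commute abs_le_iff)
    then have "\<bar>real m * a n - real n * a m\<bar> / (real n * real m)
        \<le> (real m * C + real n * C) / (real n * real m)"
      by (intro divide_right_mono) auto
    moreover have "\<bar>real m * a n - real n * a m\<bar> / (real n * real m)
       = \<bar>(real m * a n - real n * a m) / (real n * real m)\<bar>" by (simp add: abs_mult)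
    moreover have "(real m * a n - real n * a m) / (real n * real m) = a n / real n - a m / real m"
      using that by (simp add: field_simps)
    moreover have "(real m * C + real n * C) / (real n * real m) = C / real n + C / real m"
      using that by (simp add: field_simps)
    ultimately show ?thesis by simp
  qed
  have lim0: "(\<lambda>n. C / real n) \<longlonglongrightarrow> 0" by (rule lim_const_over_n)
  have "Cauchy (\<lambda>n. a n / real n)"
  proof (rule metric_CauchyI)
    fix e :: real assume "e > 0"
    then have "\<forall>\<^sub>F n in sequentially. C / real n < e / 2"
      by (intro order_tendstoD(2)[OF lim0]) simp
    then obtain N where N: "\<And>n. n \<ge> N \<Longrightarrow> C / real n < e / 2"
      by (auto simp: eventually_sequentially)
    show "\<exists>M. \<forall>m\<ge>M. \<forall>n\<ge>M. dist (a m / real m) (a n / real n) < e"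
    proof (intro exI[of _ "Suc N"] allI impI)
      fix m n assume "Suc N \<le> m" "Suc N \<le> n"
      then have "\<bar>a m / real m - a n / real n\<bar> \<le> C / real m + C / real n"
        "C / real m < e / 2" "C / real n < e / 2"
        using diff[of m n] N[of m] N[of n] by auto
      then show "dist (a m / real m) (a n / real n) < e"
        unfolding dist_real_def by linarith
    qed
  qed
  then obtain p where p: "(\<lambda>n. a n / real n) \<longlonglongrightarrow> p"
    by (auto simp: Cauchy_convergent_iff convergent_def)
  have "\<bar>a n - real n * p\<bar> \<le> C" for n
  proof (cases "n = 0")
    case True
    with assms[of 0 0] show ?thesis by (simp add: abs_le_iff)
  next
    case False
    have "\<bar>a n / real n - p\<bar> \<le> C / real n + 0"
    proof (rule LIMSEQ_le)
      show "(\<lambda>m. \<bar>a n / real n - a m / real m\<bar>) \<longlonglongrightarrow> \<bar>a n / real n - p\<bar>"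
        by (intro tendsto_intros p)
      show "(\<lambda>m. C / real n + C / real m) \<longlonglongrightarrow> C / real n + 0"
        by (intro tendsto_intros lim0)
      show "\<exists>N. \<forall>m\<ge>N. \<bar>a n / real n - a m / real m\<bar> \<le> C / real n + C / real m"
        using diff False by (intro exI[of _ 1]) auto
    qed
    then have "real n * \<bar>a n / real n - p\<bar> \<le> C"
      using False by (simp add: field_simps)
    moreover have "real n * \<bar>a n / real n - p\<bar> = \<bar>real n * (a n / real n - p)\<bar>"
      by (simp add: abs_mult)
    moreover have "real n * (a n / real n - p) = a n - real n * p"
      using False by (simp add: field_simps)
    ultimately show ?thesis by simp
  qed
  then show ?thesis by blast
qed

text \<open>A real-valued form of the pressure, read off periodic words. \<open>lim\<close> is
  meaningful only where convergence is known, which bounded distortion provides.\<close>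

definition pres :: "(seq \<Rightarrow> real) \<Rightarrow> real" where
  "pres g = lim (\<lambda>n. ln (Z g n) / real n)"

lemma bounded_error_limit:
  fixes a :: "nat \<Rightarrow> real"
  assumes "\<And>n. \<bar>a n - real n * p\<bar> \<le> C"
  shows "(\<lambda>n. a n / real n) \<longlonglongrightarrow> p"
proof -
  have "(\<lambda>n. a n / real n - p) \<longlonglongrightarrow> 0"
  proof (rule tendsto_0_le[where K = 1])
    show "(\<lambda>n. C / real n) \<longlonglongrightarrow> 0" by (rule lim_const_over_n)
    show "\<forall>\<^sub>F n in sequentially. norm (a n / real n - p) \<le> norm (C / real n) * 1"
    proof (rule eventually_sequentiallyI[of 1])
      fix n :: nat assume "1 \<le> n"
      then have "a n / real n - p = (a n - real n * p) / real n"
        by (simp add: field_simps)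
      moreover have "\<bar>a n - real n * p\<bar> \<le> \<bar>C\<bar>" using assms[of n] by linarith
      ultimately show "norm (a n / real n - p) \<le> norm (C / real n) * 1"
        by (simp add: divide_right_mono)
    qed
  qed
  then show ?thesis
    by (simp add: LIM_zero_iff)
qed

text \<open>Almost additivity leaves an error that does not grow with \<open>n\<close>; an o(n)
  error would swamp tilts of size 1/n.\<close>

lemma ln_Z_pres:
  assumes "bounded_distortion D g"
  shows "\<bar>ln (Z g n) - real n * pres g\<bar> \<le> 2 * D"
proof -
  obtain p where p: "\<And>n. \<bar>ln (Z g n) - real n * p\<bar> \<le> 2 * D"
    using almost_additive_limit[of "\<lambda>n. ln (Z g n)", OF ln_Z_add[OF assms]] by auto
  have "pres g = p"
    unfolding pres_def by (rule limI) (rule bounded_error_limit[OF p])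
  with p show ?thesis by simp
qed

lemma Z_bounds:
  assumes "bounded_distortion D g"
  shows "exp (real n * pres g - 2 * D) \<le> Z g n" and "Z g n \<le> exp (real n * pres g + 2 * D)"
proof -
  have "ln (Z g n) \<le> real n * pres g + 2 * D" "real n * pres g - 2 * D \<le> ln (Z g n)"
    using ln_Z_pres[OF assms, of n] by linarith+
  then show "exp (real n * pres g - 2 * D) \<le> Z g n" "Z g n \<le> exp (real n * pres g + 2 * D)"
    using exp_le_cancel_iff[of _ "ln (Z g n)"] exp_le_cancel_iff[of "ln (Z g n)"] Z_pos[of g n]
    by (simp_all del: exp_le_cancel_iff)
qed

lemma pres_lim:
  assumes "bounded_distortion D g"
  shows "(\<lambda>n. ln (Z g n) / real n) \<longlonglongrightarrow> pres g"
  by (rule bounded_error_limit[OF ln_Z_pres[OF assms]])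

section \<open>Pressure\<close>

definition initial_word :: "nat \<Rightarrow> seq \<Rightarrow> bool list" where
  "initial_word n x = map x [0..<n]"

lemma length_initial_word [simp]: "length (initial_word n x) = n"
  by (simp add: initial_word_def)

lemma initial_word_in_words [simp]: "initial_word n x \<in> words n"
  by (simp add: words_def)

lemma nth_initial_word [simp]: "i < n \<Longrightarrow> initial_word n x ! i = x i"
  by (simp add: initial_word_def)

lemma initial_word_eq_iff: "initial_word n x = initial_word n y \<longleftrightarrow> (\<forall>i<n. x i = y i)"
  by (auto simp: list_eq_iff_nth_eq)

lemma take_initial_word: "take n (initial_word (n + m) x) = initial_word n x"
  by (auto simp: list_eq_iff_nth_eq)

lemma per_nth: "i < length w \<Longrightarrow> per w i = w ! i"
  by (simp add: per_def)

lemma wsum_initial_word: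
  assumes "bounded_distortion D g"
  shows "\<bar>birkhoff_sum g n x - wsum g (initial_word n x)\<bar> \<le> D"
  unfolding wsum_def length_initial_word
  by (rule bounded_distortionD[OF assms]) (simp add: per_nth)

lemma inj_on_per: "inj_on per (words n)"
proof (rule inj_onI)
  fix u v assume "u \<in> words n" "v \<in> words n" "per u = per v"
  then show "u = v"
    by (intro nth_equalityI) (auto simp: words_def simp flip: per_nth)
qed

lemma per_periodic: "per w (length w + i) = per w i"
  by (simp add: per_def)

text \<open>A point of period \<open>n\<close> is determined by its first \<open>n\<close>
  coordinates. Only positive periods qualify, since \<open>Fix 0\<close> is the whole space.\<close>

lemma Fix_eq_per_words: "Fix (Suc n) = per ` words (Suc n)"
proof
  show "per ` words (Suc n) \<subseteq> Fix (Suc n)"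
    using per_periodic by (fastforce simp: Fix_def shift_funpow words_def simp del: funpow.simps)
  show "Fix (Suc n) \<subseteq> per ` words (Suc n)"
  proof
    fix x assume "x \<in> Fix (Suc n)"
    then have "(\<lambda>i. x (Suc n + i)) = x"
      unfolding Fix_def shift_funpow by simp
    then have per: "x (Suc n + i) = x i" for i by metis
    have mult: "x (k * Suc n + j) = x j" for k j
    proof (induction k)
      case (Suc k)
      have "x (Suc k * Suc n + j) = x (Suc n + (k * Suc n + j))"
        by (simp add: algebra_simps)
      with Suc per show ?case by simp
    qed simp
    have "x i = per (initial_word (Suc n) x) i" for i
    proof -
      have "x i = x (i div Suc n * Suc n + i mod Suc n)" by (simp only: div_mult_mod_eq)
      also have "\<dots> = x (i mod Suc n)" by (rule mult)
      finally show ?thesis by (simp add: per_def)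
    qed
    then have "x = per (initial_word (Suc n) x)" by blast
    then show "x \<in> per ` words (Suc n)" by (metis imageI initial_word_in_words)
  qed
qed

section \<open>The metric, Lipschitz functions and bounded distortion\<close>

lemma seq_dist_le:
  assumes "0 < \<theta>" "\<theta> < 1" "\<forall>i<n. x i = y i"
  shows "seq_dist \<theta> x y \<le> \<theta> ^ n"
proof (cases "x = y")
  case False
  then obtain i where "x i \<noteq> y i" by blast
  then have "x (LEAST i. x i \<noteq> y i) \<noteq> y (LEAST i. x i \<noteq> y i)"
    by (rule LeastI)
  with assms(3) have "n \<le> (LEAST i. x i \<noteq> y i)" using not_le by blast
  with False assms show ?thesis
    by (simp add: seq_dist_def del: power_Suc)
qed (use assms in \<open>simp add: seq_dist_def\<close>)

lemma seq_dist_nonneg: "0 < \<theta> \<Longrightarrow> 0 \<le> seq_dist \<theta> x y"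
  by (simp add: seq_dist_def)

lemma seq_lipschitzE:
  assumes "seq_lipschitz \<theta> f" "0 < \<theta>"
  obtains L where "0 \<le> L" "\<And>x y. \<bar>f x - f y\<bar> \<le> L * seq_dist \<theta> x y"
proof -
  obtain L where L: "\<And>x y. \<bar>f x - f y\<bar> \<le> L * seq_dist \<theta> x y"
    using assms(1) unfolding seq_lipschitz_def by blast
  have "\<bar>f x - f y\<bar> \<le> \<bar>L\<bar> * seq_dist \<theta> x y" for x y
    using L[of x y] mult_right_mono[OF abs_ge_self[of L] seq_dist_nonneg[OF assms(2), of x y]]
    by linarith
  then show ?thesis using that[of "\<bar>L\<bar>"] by simp
qed

lemma seq_lipschitz_bounded_distortion:
  assumes "0 < \<theta>" "\<theta> < 1" "seq_lipschitz \<theta> f"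
  shows "\<exists>D. bounded_distortion D f"
proof -
  obtain L where L: "0 \<le> L" "\<And>x y. \<bar>f x - f y\<bar> \<le> L * seq_dist \<theta> x y"
    using seq_lipschitzE[OF assms(3,1)] by blast
  have "bounded_distortion (L * (1 / (1 - \<theta>))) f"
    unfolding bounded_distortion_def
  proof (intro allI impI)
    fix n and x y :: seq
    assume xy: "\<forall>i<n. x i = y i"
    have "\<bar>birkhoff_sum f n x - birkhoff_sum f n y\<bar>
        \<le> (\<Sum>i<n. \<bar>f ((shift ^^ i) x) - f ((shift ^^ i) y)\<bar>)"
      unfolding birkhoff_sum_def by (simp flip: sum_subtractf)
    \<comment> \<open>After \<open>i\<close> steps the points still agree on \<open>n - i\<close>
      coordinates; one power is given away so that reversing the sum yields
      \<open>\<Sum>i<n. \<theta> ^ i\<close>, which is bounded in \<open>n\<close>.\<close>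
    also have "\<dots> \<le> (\<Sum>i<n. L * \<theta> ^ (n - Suc i))"
    proof (rule sum_mono)
      fix i assume i: "i \<in> {..<n}"
      have "\<bar>f ((shift ^^ i) x) - f ((shift ^^ i) y)\<bar> \<le> L * seq_dist \<theta> ((shift ^^ i) x) ((shift ^^ i) y)"
        by (rule L)
      also have "\<dots> \<le> L * \<theta> ^ (n - Suc i)"
        using xy by (intro mult_left_mono seq_dist_le assms L) (auto simp: shift_funpow)
      finally show "\<bar>f ((shift ^^ i) x) - f ((shift ^^ i) y)\<bar> \<le> L * \<theta> ^ (n - Suc i)" .
    qed
    also have "\<dots> = L * (\<Sum>i<n. \<theta> ^ i)"
      using sum.nat_diff_reindex[of "\<lambda>i. \<theta> ^ i" n] by (simp add: sum_distrib_left[symmetric])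
    also have "(\<Sum>i<n. \<theta> ^ i) \<le> 1 / (1 - \<theta>)"
      using assms(1,2) by (simp add: sum_gp_strict divide_right_mono)
    finally show "\<bar>birkhoff_sum f n x - birkhoff_sum f n y\<bar> \<le> L * (1 / (1 - \<theta>))"
      using L(1) by (simp add: mult_left_mono)
  qed
  then show ?thesis by blast
qed

text \<open>Points agreeing on \<open>n + m\<close> coordinates stay within
  \<open>\<theta> ^ m\<close> during the first \<open>n\<close> steps, so a separated set injects
  into words of length \<open>n + m\<close>. The \<open>m\<close> extra letters cost a factor
  independent of \<open>n\<close>.\<close>

lemma separated_sum_le:
  assumes "bounded_distortion D g" "0 < \<theta>" "\<theta> < 1" "\<theta> ^ m \<le> \<epsilon>" "separated \<theta> n \<epsilon> E"
  shows "(\<Sum>x\<in>E. exp (birkhoff_sum g n x)) \<le> exp D * card (words m) * Z g n"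
proof -
  have inj: "inj_on (initial_word (n + m)) E"
  proof (rule inj_onI, rule ccontr)
    fix x y assume xy: "x \<in> E" "y \<in> E" "initial_word (n + m) x = initial_word (n + m) y" "x \<noteq> y"
    then obtain i where i: "i < n" "seq_dist \<theta> ((shift ^^ i) x) ((shift ^^ i) y) > \<epsilon>"
      using assms(5) unfolding separated_def by blast
    have "seq_dist \<theta> ((shift ^^ i) x) ((shift ^^ i) y) \<le> \<theta> ^ m"
      using xy(3) i(1) by (intro seq_dist_le assms) (auto simp: shift_funpow initial_word_eq_iff)
    with i(2) assms(4) show False by simp
  qed
  have fin: "finite E" using assms(5) by (simp add: separated_def)
  have "(\<Sum>x\<in>E. exp (birkhoff_sum g n x)) \<le> (\<Sum>x\<in>E. exp D * exp (wsum g (take n (initial_word (n + m) x))))"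
    unfolding take_initial_word exp_add[symmetric]
    using wsum_initial_word[OF assms(1), of n] by (intro sum_mono) (auto simp: abs_le_iff algebra_simps)
  also have "\<dots> = (\<Sum>w\<in>initial_word (n + m) ` E. exp D * exp (wsum g (take n w)))"
    using inj by (simp add: sum.reindex)
  also have "\<dots> \<le> (\<Sum>w\<in>words (n + m). exp D * exp (wsum g (take n w)))"
    by (rule sum_mono2) auto
  also have "\<dots> = (\<Sum>u\<in>words n. \<Sum>v\<in>words m. exp D * exp (wsum g u))"
    unfolding sum_words_add by (intro sum.cong refl) (simp add: words_def)
  also have "\<dots> = exp D * card (words m) * Z g n"
    by (simp add: Z_def sum_distrib_left mult_ac)
  finally show ?thesis .
qed

lemma sum_per_words: "(\<Sum>x\<in>per ` words n. F x) = (\<Sum>w\<in>words n. F (per w))"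
  using inj_on_per by (simp add: sum.reindex)

text \<open>Distinct words differ at some position; shifting it to coordinate 0 puts the points at
  distance exactly \<open>\<theta>\<close>.\<close>

lemma separated_per_words:
  assumes "\<epsilon> < \<theta>" "0 < \<theta>"
  shows "separated \<theta> n \<epsilon> (per ` words n)"
  unfolding separated_def
proof (intro conjI ballI impI)
  fix x y assume xy: "x \<in> per ` words n" "y \<in> per ` words n" "x \<noteq> y"
  then obtain u v where uv: "x = per u" "y = per v" "length u = n" "length v = n"
    by (auto simp: words_def)
  with xy(3) have "u \<noteq> v" by auto
  with uv obtain i where i: "i < n" "u ! i \<noteq> v ! i" by (auto simp: list_eq_iff_nth_eq)
  define x' y' where "x' = (shift ^^ i) x" and "y' = (shift ^^ i) y"
  have "x' 0 \<noteq> y' 0"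
    using i uv by (simp add: x'_def y'_def shift_funpow per_nth)
  moreover from this have "(LEAST j. x' j \<noteq> y' j) = 0" by (rule Least_eq_0)
  ultimately have "seq_dist \<theta> x' y' = \<theta>"
    by (auto simp: seq_dist_def)
  with assms i show "\<exists>i<n. seq_dist \<theta> ((shift ^^ i) x) ((shift ^^ i) y) > \<epsilon>"
    unfolding x'_def y'_def by auto
qed simp

text \<open>For fixed \<open>\<epsilon>\<close> the factor \<open>exp D * card (words m)\<close>
  disappears after taking logarithms and dividing by \<open>n\<close>. Conversely the scale
  \<open>\<theta> / 2\<close> suffices, because there the periodic points form a separated
  set.\<close>

lemma pressure_eq_pres:
  assumes "bounded_distortion D g" "0 < \<theta>" "\<theta> < 1"
  shows "pressure \<theta> g = ereal (pres g)"
proof (rule antisym)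
  have bdd: "bdd_above ((\<lambda>E. \<Sum>x\<in>E. exp (birkhoff_sum g n x)) ` {E. separated \<theta> n \<epsilon> E})"
    and upper: "partition_sum \<theta> g n \<epsilon> \<le> exp D * card (words m) * Z g n"
    if "\<theta> ^ m \<le> \<epsilon>" for n m \<epsilon>
  proof -
    show "bdd_above ((\<lambda>E. \<Sum>x\<in>E. exp (birkhoff_sum g n x)) ` {E. separated \<theta> n \<epsilon> E})"
      using separated_sum_le[OF assms that] by (intro bdd_aboveI2) auto
    have "{} \<in> {E. separated \<theta> n \<epsilon> E}" by (simp add: separated_def)
    then show "partition_sum \<theta> g n \<epsilon> \<le> exp D * card (words m) * Z g n"
      unfolding partition_sum_def using separated_sum_le[OF assms that]
      by (intro cSUP_least) auto
  qed
  have ex: "\<exists>m. \<theta> ^ m \<le> \<epsilon>" if "\<epsilon> > 0" for \<epsilon>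
    using real_arch_pow_inv[OF that assms(3)] by (auto intro: less_imp_le)
  have lower: "(\<Sum>x\<in>E. exp (birkhoff_sum g n x)) \<le> partition_sum \<theta> g n \<epsilon>"
    if "\<epsilon> > 0" "separated \<theta> n \<epsilon> E" for n \<epsilon> E
    using ex[OF that(1)] bdd that(2) unfolding partition_sum_def
    by (auto intro!: cSUP_upper)
  show "pressure \<theta> g \<le> ereal (pres g)"
    unfolding pressure_def
  proof (rule SUP_least)
    fix \<epsilon> :: real assume "\<epsilon> \<in> {0<..}"
    then have eps: "\<epsilon> > 0" by simp
    then obtain m where m: "\<theta> ^ m \<le> \<epsilon>" using ex by blast
    define K where "K = exp D * card (words m)"
    have "K > 0" by (simp add: K_def card_gt_0_iff)
    \<comment> \<open>A one-point set is separated and keeps the partition sum positive, so that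
      \<open>ln\<close> is monotone on it.\<close>
    have pos: "0 < partition_sum \<theta> g n \<epsilon>" for n
    proof -
      have "0 < exp (birkhoff_sum g n (\<lambda>_. True))" by simp
      also have "\<dots> \<le> partition_sum \<theta> g n \<epsilon>"
        using lower[OF eps, of n "{\<lambda>_. True}"] by (simp add: separated_def)
      finally show ?thesis .
    qed
    have "(\<lambda>n. ln K / real n + ln (Z g n) / real n) \<longlonglongrightarrow> 0 + pres g"
      by (intro tendsto_add lim_const_over_n pres_lim[OF assms(1)])
    then have "limsup (\<lambda>n. ereal (ln K / real n + ln (Z g n) / real n)) = ereal (pres g)"
      by (intro lim_imp_Limsup) auto
    moreover have "limsup (\<lambda>n. ereal (ln (partition_sum \<theta> g n \<epsilon>) / real n))
        \<le> limsup (\<lambda>n. ereal (ln K / real n + ln (Z g n) / real n))"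
    proof (intro Limsup_mono always_eventually allI)
      fix n
      have "ln (partition_sum \<theta> g n \<epsilon>) \<le> ln (K * Z g n)"
        using upper[OF m, of n] pos[of n] \<open>K > 0\<close> Z_pos[of g n] by (simp add: K_def)
      also have "\<dots> = ln K + ln (Z g n)"
        using \<open>K > 0\<close> Z_pos[of g n] by (intro ln_mult_pos)
      finally show "ereal (ln (partition_sum \<theta> g n \<epsilon>) / real n)
          \<le> ereal (ln K / real n + ln (Z g n) / real n)"
        by (simp add: divide_right_mono flip: add_divide_distrib)
    qed
    ultimately show "limsup (\<lambda>n. ereal (ln (partition_sum \<theta> g n \<epsilon>) / real n)) \<le> ereal (pres g)"
      by simp
  qed
  have "ereal (pres g) = limsup (\<lambda>n. ereal (ln (Z g n) / real n))"
    using pres_lim[OF assms(1)] by (intro lim_imp_Limsup[symmetric]) auto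
  also have "\<dots> \<le> limsup (\<lambda>n. ereal (ln (partition_sum \<theta> g n (\<theta> / 2)) / real n))"
  proof (intro Limsup_mono always_eventually allI)
    fix n
    have "(\<Sum>x\<in>per ` words n. exp (birkhoff_sum g n x)) \<le> partition_sum \<theta> g n (\<theta> / 2)"
      using assms by (intro lower separated_per_words) auto
    moreover have "(\<Sum>x\<in>per ` words n. exp (birkhoff_sum g n x)) = Z g n"
      unfolding sum_per_words Z_def by (intro sum.cong) (auto simp: wsum_def words_def)
    ultimately have "ln (Z g n) \<le> ln (partition_sum \<theta> g n (\<theta> / 2))"
      using Z_pos[of g n] by simp
    then show "ereal (ln (Z g n) / real n) \<le> ereal (ln (partition_sum \<theta> g n (\<theta> / 2)) / real n)"
      by (simp add: divide_right_mono)
  qed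
  also have "\<dots> \<le> pressure \<theta> g"
    unfolding pressure_def using assms(2) by (intro SUP_upper) simp
  finally show "ereal (pres g) \<le> pressure \<theta> g" .
qed

section \<open>Differentiability of the pressure\<close>

definition tilt :: "(seq \<Rightarrow> real) \<Rightarrow> (seq \<Rightarrow> real) \<Rightarrow> real \<Rightarrow> seq \<Rightarrow> real" where
  "tilt g h t = (\<lambda>x. g x + t * h x)"

lemma tilt_0 [simp]: "tilt g h 0 = g"
  by (simp add: tilt_def)

lemma tilt_uminus: "tilt g (\<lambda>x. - h x) t = tilt g h (- t)"
  by (simp add: tilt_def)

lemma wsum_tilt: "wsum (tilt g h t) w = wsum g w + t * wsum h w"
  unfolding tilt_def using wsum_linear[of 1 g t h w] by simp

lemma wsum_uminus: "wsum (\<lambda>x. - h x) w = - wsum h w"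
  using wsum_linear[of "-1" h 0 h w] by simp

lemma bounded_distortion_tilt:
  assumes "bounded_distortion D g" "bounded_distortion E h"
  shows "bounded_distortion (D + \<bar>t\<bar> * E) (tilt g h t)"
  using bounded_distortion_linear[OF assms, of 1 t] by (simp add: tilt_def)

lemma bounded_distortion_uminus:
  "bounded_distortion E h \<Longrightarrow> bounded_distortion E (\<lambda>x. - h x)"
  using bounded_distortion_linear[of E h E h "-1" 0] by simp

lemma Z_tilt: "Z (tilt g h t) n = (\<Sum>w\<in>words n. exp (wsum g w + t * wsum h w))"
  by (simp add: Z_def wsum_tilt)

text \<open>Hoelder's inequality: with \<open>ln Z\<close> subtracted in the exponents both families
  of weights sum to 1, and convexity of \<open>exp\<close> applies word by word.\<close>

lemma convex_ln_Z_tilt: "convex_on UNIV (\<lambda>t. ln (Z (tilt g h t) n))"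
proof (rule convex_onI)
  fix s t u :: real
  assume s: "0 < s" "s < 1"
  let ?A = "ln (Z (tilt g h t) n)" and ?B = "ln (Z (tilt g h u) n)"
  have *: "(\<Sum>w\<in>words n. exp (wsum g w + t * wsum h w - ln (Z (tilt g h t) n))) = 1" for t
    using Z_pos[of "tilt g h t" n]
    by (simp add: exp_diff sum_divide_distrib[symmetric] Z_tilt[symmetric])
  have "Z (tilt g h ((1 - s) * t + s * u)) n / exp ((1 - s) * ?A + s * ?B)
      = (\<Sum>w\<in>words n. exp ((1 - s) * (wsum g w + t * wsum h w - ?A) + s * (wsum g w + u * wsum h w - ?B)))"
    unfolding Z_tilt[of _ _ "(1 - s) * t + s * u"] sum_divide_distrib exp_diff[symmetric]
    by (intro sum.cong refl arg_cong[where f = exp]) (simp add: algebra_simps)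
  also have "\<dots> \<le> (\<Sum>w\<in>words n. (1 - s) * exp (wsum g w + t * wsum h w - ?A)
      + s * exp (wsum g w + u * wsum h w - ?B))"
  proof (rule sum_mono)
    fix w
    show "exp ((1 - s) * (wsum g w + t * wsum h w - ?A) + s * (wsum g w + u * wsum h w - ?B))
      \<le> (1 - s) * exp (wsum g w + t * wsum h w - ?A) + s * exp (wsum g w + u * wsum h w - ?B)"
      using convex_onD[OF exp_convex, of s "wsum g w + t * wsum h w - ?A" "wsum g w + u * wsum h w - ?B"] s
      by simp
  qed
  also have "\<dots> = 1"
    by (simp add: sum.distrib sum_distrib_left[symmetric] *)
  finally have "Z (tilt g h ((1 - s) * t + s * u)) n \<le> exp ((1 - s) * ?A + s * ?B)"
    by simp
  then have "ln (Z (tilt g h ((1 - s) * t + s * u)) n) \<le> (1 - s) * ?A + s * ?B"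
    using ln_le_cancel_iff[OF Z_pos exp_gt_zero] by (metis ln_exp)
  then show "ln (Z (tilt g h ((1 - s) *\<^sub>R t + s *\<^sub>R u)) n) \<le> (1 - s) * ?A + s * ?B"
    by simp
qed simp

lemma convex_pres_tilt:
  assumes "bounded_distortion D g" "bounded_distortion E h"
  shows "convex_on UNIV (\<lambda>t. pres (tilt g h t))"
proof (rule convex_onI)
  fix s t u :: real
  assume s: "0 < s" "s < 1"
  have lim: "(\<lambda>n. ln (Z (tilt g h t) n) / real n) \<longlonglongrightarrow> pres (tilt g h t)" for t
    by (rule pres_lim[OF bounded_distortion_tilt[OF assms]])
  have "pres (tilt g h ((1 - s) *\<^sub>R t + s *\<^sub>R u)) \<le> (1 - s) * pres (tilt g h t) + s * pres (tilt g h u)"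
  proof (rule LIMSEQ_le)
    show "(\<lambda>n. ln (Z (tilt g h ((1 - s) *\<^sub>R t + s *\<^sub>R u)) n) / real n)
        \<longlonglongrightarrow> pres (tilt g h ((1 - s) *\<^sub>R t + s *\<^sub>R u))" by (rule lim)
    show "(\<lambda>n. (1 - s) * (ln (Z (tilt g h t) n) / real n) + s * (ln (Z (tilt g h u) n) / real n))
        \<longlonglongrightarrow> (1 - s) * pres (tilt g h t) + s * pres (tilt g h u)"
      by (intro tendsto_intros lim)
    show "\<exists>N. \<forall>n\<ge>N. ln (Z (tilt g h ((1 - s) *\<^sub>R t + s *\<^sub>R u)) n) / real n
        \<le> (1 - s) * (ln (Z (tilt g h t) n) / real n) + s * (ln (Z (tilt g h u) n) / real n)"
    proof (intro exI[of _ 0] allI impI)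
      fix n
      have "ln (Z (tilt g h ((1 - s) *\<^sub>R t + s *\<^sub>R u)) n)
          \<le> (1 - s) * ln (Z (tilt g h t) n) + s * ln (Z (tilt g h u) n)"
        using convex_onD[OF convex_ln_Z_tilt[of g h n], of s t u] s by simp
      then have "ln (Z (tilt g h ((1 - s) *\<^sub>R t + s *\<^sub>R u)) n) / real n
          \<le> ((1 - s) * ln (Z (tilt g h t) n) + s * ln (Z (tilt g h u) n)) / real n"
        by (rule divide_right_mono) simp
      then show "ln (Z (tilt g h ((1 - s) *\<^sub>R t + s *\<^sub>R u)) n) / real n
        \<le> (1 - s) * (ln (Z (tilt g h t) n) / real n) + s * (ln (Z (tilt g h u) n) / real n)"
        by (simp only: add_divide_distrib times_divide_eq_right)
    qed
  qed
  then show "pres (tilt g h ((1 - s) *\<^sub>R t + s *\<^sub>R u)) \<le> (1 - s) * pres (tilt g h t) + s * pres (tilt g h u)" .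
qed simp

text \<open>\<open>b\<close> is the infimum of the difference quotients at positive
  \<open>t\<close>. The chord from -1 to \<open>t\<close>, evaluated at 0, bounds them below, and a
  quotient near the infimum at some \<open>\<delta>\<close> controls all smaller
  \<open>t\<close>.\<close>

lemma convex_right_derivative:
  fixes F :: "real \<Rightarrow> real"
  assumes "convex_on UNIV F"
  shows "\<exists>b. (\<forall>t\<ge>0. F 0 + b * t \<le> F t) \<and>
     (\<forall>\<eta>>0. \<exists>\<delta>>0. \<forall>t. 0 \<le> t \<longrightarrow> t \<le> \<delta> \<longrightarrow> F t \<le> F 0 + (b + \<eta>) * t)"
proof -
  define q where "q t = (F t - F 0) / t" for t
  define b where "b = (INF t\<in>{0<..}. q t)"
  have lower: "F 0 - F (- 1) \<le> q t" if "t > 0" for t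
  proof -
    have "F ((1 - 1 / (1 + t)) *\<^sub>R (- 1) + (1 / (1 + t)) *\<^sub>R t)
        \<le> (1 - 1 / (1 + t)) * F (- 1) + 1 / (1 + t) * F t"
      using that by (intro convex_onD[OF assms]) auto
    moreover have "(1 - 1 / (1 + t)) *\<^sub>R (- 1) + (1 / (1 + t)) *\<^sub>R t = 0"
      using that by (simp add: field_simps)
    moreover have "1 - 1 / (1 + t) = t / (1 + t)"
      using that by (simp add: field_simps)
    then have "(1 - 1 / (1 + t)) * F (- 1) + 1 / (1 + t) * F t = (t * F (- 1) + F t) / (1 + t)"
      by (simp add: add_divide_distrib)
    ultimately have "F 0 * (1 + t) \<le> t * F (- 1) + F t"
      using that by (simp add: pos_le_divide_eq)
    then show ?thesis using that by (simp add: q_def field_simps)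
  qed
  have bdd: "bdd_below (q ` {0<..})"
    using lower by (intro bdd_belowI2[of _ "F 0 - F (- 1)"]) simp
  have "F 0 + b * t \<le> F t" if "t \<ge> 0" for t
  proof (cases "t = 0")
    case False
    with that have "b \<le> q t" unfolding b_def by (intro cINF_lower bdd) simp
    with that False show ?thesis by (simp add: q_def field_simps)
  qed simp
  moreover have "\<exists>\<delta>>0. \<forall>t. 0 \<le> t \<longrightarrow> t \<le> \<delta> \<longrightarrow> F t \<le> F 0 + (b + \<eta>) * t" if "\<eta> > 0" for \<eta>
  proof -
    have "\<exists>\<delta>\<in>{0<..}. q \<delta> < b + \<eta>"
      using cINF_less_iff[OF _ bdd, of "b + \<eta>"] that by (auto simp: b_def)
    then obtain \<delta> where d: "\<delta> > 0" "q \<delta> < b + \<eta>" by auto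
    have "F t \<le> F 0 + (b + \<eta>) * t" if t: "0 \<le> t" "t \<le> \<delta>" for t
    proof -
      have "F ((1 - t / \<delta>) *\<^sub>R 0 + (t / \<delta>) *\<^sub>R \<delta>) \<le> (1 - t / \<delta>) * F 0 + t / \<delta> * F \<delta>"
        using t d by (intro convex_onD[OF assms]) auto
      also have "(1 - t / \<delta>) * F 0 + t / \<delta> * F \<delta> = F 0 + q \<delta> * t"
        using d by (simp add: q_def field_simps)
      also have "\<dots> \<le> F 0 + (b + \<eta>) * t"
        using d t by (intro add_left_mono mult_right_mono) auto
      finally show ?thesis using d by simp
    qed
    with d(1) show ?thesis by blast
  qed
  ultimately show ?thesis by blast
qed

text \<open>Restricting to \<open>\<bar>t\<bar> \<le> 1\<close> gives one error constant for all
  tilts.\<close>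

lemma Z_tilt_bounds:
  assumes "bounded_distortion D g" "bounded_distortion E h" "\<bar>t\<bar> \<le> 1"
  shows "exp (real n * pres (tilt g h t) - 2 * (D + E)) \<le> Z (tilt g h t) n"
    and "Z (tilt g h t) n \<le> exp (real n * pres (tilt g h t) + 2 * (D + E))"
proof -
  have "D + \<bar>t\<bar> * E \<le> D + E"
    using mult_right_mono[OF assms(3) bounded_distortion_nonneg[OF assms(2)]] by simp
  with bounded_distortion_tilt[OF assms(1,2)] have "bounded_distortion (D + E) (tilt g h t)"
    by (rule bounded_distortion_mono)
  then show "exp (real n * pres (tilt g h t) - 2 * (D + E)) \<le> Z (tilt g h t) n"
    "Z (tilt g h t) n \<le> exp (real n * pres (tilt g h t) + 2 * (D + E))"
    by (rule Z_bounds)+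
qed

text \<open>An exponential moment argument with tilt t = \<tau>/n. Below the window the tilting
  factor is at most exp(\<tau> b - K); above it the doubled tilt dominates. The supporting line
  bounds the tilted sum from below and the derivative bounds the doubled one from above, so the
  window must carry the rest. The proportion obtained depends neither on \<open>n\<close> nor on
  \<open>\<epsilon>\<close>, which affects only \<open>N\<close>.\<close>

lemma mass_near_right_derivative:
  assumes D: "bounded_distortion D g" and E: "bounded_distortion E h"
    and lo: "\<And>t. t \<ge> 0 \<Longrightarrow> pres g + b * t \<le> pres (tilt g h t)"
    and up: "\<And>\<eta>. \<eta> > 0 \<Longrightarrow>
        \<exists>\<delta>>0. \<forall>t. 0 \<le> t \<longrightarrow> t \<le> \<delta> \<longrightarrow> pres (tilt g h t) \<le> pres g + (b + \<eta>) * t"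
    and eps: "\<epsilon> > 0"
    and C: "C = 2 * (D + E)" and K: "K = 8 * C + 8"
  shows "\<exists>N. \<forall>n\<ge>N. exp (- K - 2 * C) / 2 * Z g n
     \<le> (\<Sum>w | w \<in> words n \<and> \<bar>wsum h w - real n * b\<bar> \<le> real n * \<epsilon>. exp (wsum g w))"
proof -
  have C0: "C \<ge> 0" using bounded_distortion_nonneg D E by (simp add: C)
  \<comment> \<open>Slack \<open>\<epsilon> / 4\<close> in the slope costs
    \<open>real n * (\<epsilon> / 4) * (2 * t) = K / 2\<close> at the doubled tilt, half of the gain
    \<open>K\<close> made above the window.\<close>
  obtain \<delta> where d: "\<delta> > 0"
    "\<And>t. 0 \<le> t \<Longrightarrow> t \<le> \<delta> \<Longrightarrow> pres (tilt g h t) \<le> pres g + (b + \<epsilon> / 4) * t"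
    using up[of "\<epsilon> / 4"] eps by auto
  define \<tau> where "\<tau> = K / \<epsilon>"
  have tau: "\<tau> > 0" "\<tau> * \<epsilon> = K" using C0 eps by (auto simp: \<tau>_def K)
  \<comment> \<open>Ensures \<open>2 * t \<le> min \<delta> 1\<close>, so that the derivative
    estimate and the uniform bounds on \<open>Z\<close> apply to the doubled tilt.\<close>
  define N where "N = Suc (nat \<lceil>2 * \<tau> / min \<delta> 1\<rceil>)"
  have main: "exp (- K - 2 * C) / 2 * Z g n
     \<le> (\<Sum>w | w \<in> words n \<and> \<bar>wsum h w - real n * b\<bar> \<le> real n * \<epsilon>. exp (wsum g w))"
    if n: "n \<ge> N" for n
  proof -
    define G where "G = {w. w \<in> words n \<and> \<bar>wsum h w - real n * b\<bar> \<le> real n * \<epsilon>}"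
    define A where "A = (\<Sum>w\<in>G. exp (wsum g w))"
    have n0: "real n > 0" using n by (simp add: N_def)
    define t where "t = \<tau> / real n"
    have t0: "t > 0" using tau n0 by (simp add: t_def)
    have nt: "real n * t = \<tau>" using n0 by (simp add: t_def)
    have "2 * \<tau> / min \<delta> 1 \<le> real n"
      using n unfolding N_def by linarith
    then have "2 * \<tau> \<le> real n * min \<delta> 1"
      using d(1) by (simp add: pos_divide_le_eq)
    then have "2 * \<tau> / real n \<le> min \<delta> 1"
      using n0 by (simp only: pos_divide_le_eq mult.commute)
    then have "2 * t \<le> min \<delta> 1"
      by (simp add: t_def)
    then have t1: "2 * t \<le> \<delta>" "2 * t \<le> 1" by auto
    have pointwise: "exp (t * s) \<le> (if \<bar>s - real n * b\<bar> \<le> real n * \<epsilon> then exp (\<tau> * b + K) else 0)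
        + exp (\<tau> * b - K) + exp (2 * t * s - \<tau> * b - K)" for s
    proof -
      have "t * (real n * b) = (real n * t) * b" "t * (real n * \<epsilon>) = (real n * t) * \<epsilon>"
        by simp_all
      then have eq: "t * (real n * b + real n * \<epsilon>) = \<tau> * b + K"
        "t * (real n * b - real n * \<epsilon>) = \<tau> * b - K"
        unfolding nt tau(2) by (simp_all only: distrib_left right_diff_distrib)
      consider "\<bar>s - real n * b\<bar> \<le> real n * \<epsilon>" | "s \<le> real n * b - real n * \<epsilon>"
        | "s \<ge> real n * b + real n * \<epsilon>" by linarith
      then show ?thesis
      proof cases
        case 1
        then have "t * s \<le> t * (real n * b + real n * \<epsilon>)" using t0 by (intro mult_left_mono) auto
        then have "exp (t * s) \<le> exp (\<tau> * b + K)" unfolding eq by simp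
        with 1 show ?thesis by (simp add: add_increasing2)
      next
        case 2
        then have "t * s \<le> t * (real n * b - real n * \<epsilon>)" using t0 by (intro mult_left_mono) auto
        then have "exp (t * s) \<le> exp (\<tau> * b - K)" unfolding eq by simp
        then show ?thesis by (simp add: add_increasing add_increasing2)
      next
        case 3
        then have "t * (real n * b + real n * \<epsilon>) \<le> t * s" using t0 by (intro mult_left_mono) auto
        \<comment> \<open>Here \<open>t * s \<ge> \<tau> * b + K\<close>, so adding
          \<open>t * s - (\<tau> * b + K)\<close> can only raise the exponent.\<close>
        then have "exp (t * s) \<le> exp (2 * t * s - \<tau> * b - K)"
          unfolding eq exp_le_cancel_iff by linarith
        then show ?thesis by (simp add: add_increasing)
      qed
    qed
    have "Z (tilt g h t) n \<le> (\<Sum>w\<in>words n. exp (wsum g w) *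
        ((if \<bar>wsum h w - real n * b\<bar> \<le> real n * \<epsilon> then exp (\<tau> * b + K) else 0)
        + exp (\<tau> * b - K) + exp (2 * t * wsum h w - \<tau> * b - K)))"
      unfolding Z_tilt exp_add[of "wsum g _"] by (intro sum_mono mult_left_mono pointwise) simp
    also have "\<dots> = exp (\<tau> * b + K) * A + exp (\<tau> * b - K) * Z g n
        + exp (- \<tau> * b - K) * Z (tilt g h (2 * t)) n"
    proof -
      have "(\<Sum>w\<in>words n. exp (wsum g w) *
          (if \<bar>wsum h w - real n * b\<bar> \<le> real n * \<epsilon> then exp (\<tau> * b + K) else 0))
          = (\<Sum>w\<in>words n. if \<bar>wsum h w - real n * b\<bar> \<le> real n * \<epsilon> then exp (\<tau> * b + K) * exp (wsum g w) else 0)"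
        by (intro sum.cong) auto
      also have "\<dots> = exp (\<tau> * b + K) * A"
        unfolding A_def G_def sum_distrib_left by (rule sum.inter_filter[symmetric]) simp
      finally have 1: "(\<Sum>w\<in>words n. exp (wsum g w) *
          (if \<bar>wsum h w - real n * b\<bar> \<le> real n * \<epsilon> then exp (\<tau> * b + K) else 0)) = exp (\<tau> * b + K) * A" .
      have 2: "(\<Sum>w\<in>words n. exp (wsum g w) * exp (\<tau> * b - K)) = exp (\<tau> * b - K) * Z g n"
        by (simp add: Z_def sum_distrib_left mult.commute)
      have 3: "(\<Sum>w\<in>words n. exp (wsum g w) * exp (2 * t * wsum h w - \<tau> * b - K))
          = exp (- \<tau> * b - K) * Z (tilt g h (2 * t)) n"
        unfolding Z_tilt sum_distrib_left
        by (intro sum.cong refl) (simp flip: exp_add add: algebra_simps)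
      show ?thesis by (simp only: distrib_left sum.distrib 1 2 3)
    qed
    finally have up1: "Z (tilt g h t) n \<le> exp (\<tau> * b + K) * A + exp (\<tau> * b - K) * Z g n
        + exp (- \<tau> * b - K) * Z (tilt g h (2 * t)) n" .
    have Zg: "Z g n \<le> exp (real n * pres g + C)" "exp (real n * pres g - C) \<le> Z g n"
      using Z_tilt_bounds[OF D E, of 0 n] by (simp_all add: C)
    have low: "exp (\<tau> * b - 2 * C) * Z g n \<le> Z (tilt g h t) n"
    proof -
      have "exp (\<tau> * b - 2 * C) * Z g n \<le> exp (\<tau> * b - 2 * C) * exp (real n * pres g + C)"
        using Zg by (intro mult_left_mono) auto
      also have "\<dots> = exp (real n * (pres g + b * t) - C)"
        using nt by (simp flip: exp_add add: algebra_simps)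
      also have "\<dots> \<le> exp (real n * pres (tilt g h t) - C)"
        using lo[of t] t0 n0 by simp
      also have "\<dots> \<le> Z (tilt g h t) n"
        using Z_tilt_bounds(1)[OF D E, of t n] t0 t1 by (simp add: C)
      finally show ?thesis .
    qed
    have high: "Z (tilt g h (2 * t)) n \<le> exp (2 * \<tau> * b + K / 2 + 2 * C) * Z g n"
    proof -
      have "Z (tilt g h (2 * t)) n \<le> exp (real n * pres (tilt g h (2 * t)) + C)"
        using Z_tilt_bounds(2)[OF D E, of "2 * t" n] t0 t1 by (simp add: C)
      also have "\<dots> \<le> exp (real n * (pres g + (b + \<epsilon> / 4) * (2 * t)) + C)"
        using d(2)[of "2 * t"] t0 t1 n0 by simp
      also have "real n * (pres g + (b + \<epsilon> / 4) * (2 * t)) + C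
          = real n * pres g + 2 * (real n * t) * b + (real n * t) * \<epsilon> / 2 + C"
        by (simp add: algebra_simps)
      also have "\<dots> = (2 * \<tau> * b + K / 2 + 2 * C) + (real n * pres g - C)"
        unfolding nt tau(2) by simp
      also have "exp \<dots> \<le> exp (2 * \<tau> * b + K / 2 + 2 * C) * Z g n"
        unfolding exp_add[of "2 * \<tau> * b + K / 2 + 2 * C"] using Zg by (intro mult_left_mono) auto
      finally show ?thesis .
    qed
    have "exp (\<tau> * b) * (exp (- 2 * C) * Z g n) = exp (\<tau> * b - 2 * C) * Z g n"
      by (simp flip: exp_add add: algebra_simps)
    also have "exp (\<tau> * b - 2 * C) * Z g n \<le> exp (\<tau> * b + K) * A + exp (\<tau> * b - K) * Z g n
        + exp (- \<tau> * b - K) * (exp (2 * \<tau> * b + K / 2 + 2 * C) * Z g n)"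
      using low up1 mult_left_mono[OF high exp_ge_zero, of "- \<tau> * b - K"] by linarith
    also have "\<dots> = exp (\<tau> * b) * (exp K * A + exp (- K) * Z g n + exp (2 * C - K / 2) * Z g n)"
    proof -
      have "exp (\<tau> * b + K) = exp (\<tau> * b) * exp K" "exp (\<tau> * b - K) = exp (\<tau> * b) * exp (- K)"
        "exp (- \<tau> * b - K) * exp (2 * \<tau> * b + K / 2 + 2 * C) = exp (\<tau> * b) * exp (2 * C - K / 2)"
        unfolding exp_add[symmetric] by (simp_all add: field_simps)
      then show ?thesis by (simp only: mult.assoc[symmetric] distrib_left)
    qed
    finally have "exp (- 2 * C) * Z g n \<le> exp K * A + exp (- K) * Z g n + exp (2 * C - K / 2) * Z g n"
      by simp
    \<comment> \<open>By \<open>K = 8 * C + 8\<close>, each error term is at most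
      \<open>exp (- 2 * C) / 4 * Z g n\<close>: note \<open>2 * C - K / 2 = - 2 * C - 4\<close>.
      Half of the left side survives.\<close>
    moreover have e4: "exp (- 4) \<le> (1 / 4 :: real)"
      using exp_ge_add_one_self[of "4::real"] by (simp add: exp_minus field_simps)
    moreover have "exp (- K) * Z g n \<le> exp (- 2 * C) / 4 * Z g n"
    proof (rule mult_right_mono)
      have "exp (- K) \<le> exp (- 2 * C + - 4)" using C0 by (simp add: K)
      also have "\<dots> = exp (- 2 * C) * exp (- 4)" by (rule exp_add)
      also have "\<dots> \<le> exp (- 2 * C) * (1 / 4)" using e4 by (intro mult_left_mono) auto
      finally show "exp (- K) \<le> exp (- 2 * C) / 4" by simp
    qed (use Z_pos[of g n] in simp)
    moreover have "exp (2 * C - K / 2) * Z g n \<le> exp (- 2 * C) / 4 * Z g n"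
    proof (rule mult_right_mono)
      have "exp (2 * C - K / 2) = exp (- 2 * C + - 4)" by (simp add: K field_simps)
      also have "\<dots> = exp (- 2 * C) * exp (- 4)" by (rule exp_add)
      also have "\<dots> \<le> exp (- 2 * C) * (1 / 4)" using e4 by (intro mult_left_mono) auto
      finally show "exp (2 * C - K / 2) \<le> exp (- 2 * C) / 4" by simp
    qed (use Z_pos[of g n] in simp)
    ultimately have "exp (- 2 * C) / 2 * Z g n \<le> exp K * A" by linarith
    then have le: "exp (- K) * (exp (- 2 * C) / 2 * Z g n) \<le> exp (- K) * (exp K * A)"
      by (intro mult_left_mono) auto
    have "exp (- K - 2 * C) = exp (- K) * exp (- 2 * C)"
      by (simp flip: exp_add)
    then have "exp (- K - 2 * C) / 2 * Z g n = exp (- K) * (exp (- 2 * C) / 2 * Z g n)"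
      by simp
    also note le
    also have "exp (- K) * (exp K * A) = A" by (simp add: exp_minus)
    finally show ?thesis unfolding A_def G_def .
  qed
  then show ?thesis by blast
qed

text \<open>For fixed block lengths concatenation is injective, so no word of \<open>W\<close> is
  counted twice.\<close>

lemma concat_mass:
  assumes "bounded_distortion D g" "U \<subseteq> words n" "V \<subseteq> words m" "finite W"
    and "\<And>u v. u \<in> U \<Longrightarrow> v \<in> V \<Longrightarrow> u @ v \<in> W"
  shows "exp (- 2 * D) * ((\<Sum>u\<in>U. exp (wsum g u)) * (\<Sum>v\<in>V. exp (wsum g v))) \<le> (\<Sum>w\<in>W. exp (wsum g w))"
proof -
  have inj: "inj_on (\<lambda>(u, v). u @ v) (U \<times> V)"
    using assms(2,3) by (fastforce simp: inj_on_def words_def subset_iff)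
  have "exp (- 2 * D) * ((\<Sum>u\<in>U. exp (wsum g u)) * (\<Sum>v\<in>V. exp (wsum g v)))
      \<le> (\<Sum>u\<in>U. \<Sum>v\<in>V. exp (wsum g (u @ v)))"
    by (rule sum_exp_wsum_append[OF assms(1-3)])
  also have "\<dots> = (\<Sum>(u, v)\<in>U \<times> V. exp (wsum g (u @ v)))"
    by (simp add: sum.cartesian_product)
  also have "\<dots> = (\<Sum>w\<in>(\<lambda>(u, v). u @ v) ` (U \<times> V). exp (wsum g w))"
    using inj by (simp add: sum.reindex case_prod_unfold)
  also have "\<dots> \<le> (\<Sum>w\<in>W. exp (wsum g w))"
    using assms(4,5) by (intro sum_mono2) auto
  finally show ?thesis .
qed

text \<open>\<open>b\<close> is the right derivative and \<open>- b'\<close> the left one, obtained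
  as a right derivative for \<open>- h\<close>; the substance is that the jump \<open>b + b'\<close>
  cannot be positive. An upper bound valid for both signs of \<open>t\<close> is the form against
  which other slopes are squeezed later.\<close>

lemma pres_tilt_differentiable:
  assumes D: "bounded_distortion D g" and E: "bounded_distortion E h"
  shows "\<exists>b. \<forall>\<epsilon>>0. \<exists>\<delta>>0. \<forall>t. \<bar>t\<bar> \<le> \<delta> \<longrightarrow> pres (tilt g h t) \<le> pres g + b * t + \<epsilon> * \<bar>t\<bar>"
proof -
  define h' where "h' = (\<lambda>x. - h x)"
  have E': "bounded_distortion E h'" unfolding h'_def by (rule bounded_distortion_uminus[OF E])
  obtain b where lo: "\<And>t. t \<ge> 0 \<Longrightarrow> pres g + b * t \<le> pres (tilt g h t)"
    and up: "\<And>\<eta>. \<eta> > 0 \<Longrightarrow>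
        \<exists>\<delta>>0. \<forall>t. 0 \<le> t \<longrightarrow> t \<le> \<delta> \<longrightarrow> pres (tilt g h t) \<le> pres g + (b + \<eta>) * t"
    using convex_right_derivative[OF convex_pres_tilt[OF D E]] by auto
  obtain b' where lo': "\<And>t. t \<ge> 0 \<Longrightarrow> pres g + b' * t \<le> pres (tilt g h' t)"
    and up': "\<And>\<eta>. \<eta> > 0 \<Longrightarrow>
        \<exists>\<delta>>0. \<forall>t. 0 \<le> t \<longrightarrow> t \<le> \<delta> \<longrightarrow> pres (tilt g h' t) \<le> pres g + (b' + \<eta>) * t"
    using convex_right_derivative[OF convex_pres_tilt[OF D E']] by auto
  have "b + b' \<le> 0"
  proof (rule ccontr)
    define \<gamma> where "\<gamma> = b + b'"
    assume "\<not> b + b' \<le> 0"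
    then have gam: "\<gamma> > 0" by (simp add: \<gamma>_def)
    have b': "b' = \<gamma> - b" by (simp add: \<gamma>_def)
    define C where "C = 2 * (D + E)"
    define K where "K = 8 * C + 8"
    define p where "p = exp (- K - 2 * C) / 2"
    \<comment> \<open>One factor \<open>p\<close> for each kind of block; splitting
      \<open>Z g (M * n)\<close> in two and gluing the blocks cost \<open>exp (- 2 * D)\<close>
      each.\<close>
    define q where "q = exp (- 4 * D) * p\<^sup>2"
    have p0: "p > 0" and q0: "q > 0" by (auto simp: p_def q_def)
    \<comment> \<open>\<open>M - 1\<close> disjoint events of proportion at least \<open>q\<close>
      would exceed total proportion 1.\<close>
    define M where "M = nat \<lceil>1 / q\<rceil> + 2"
    have M: "real (M - 1) * q > 1"
    proof -
      have "real (M - 1) > 1 / q" unfolding M_def by linarith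
      then have "1 / q * q < real (M - 1) * q" using q0 by (intro mult_strict_right_mono)
      moreover have "1 / q * q = 1" using q0 by simp
      ultimately show ?thesis by (simp only:)
    qed
    have M2: "M \<ge> 2" by (simp add: M_def)
    \<comment> \<open>The windows get half-width \<open>real n * \<gamma> / 4\<close> before the
      gluing error, while neighbouring centres are \<open>real n * \<gamma>\<close> apart.\<close>
    define \<epsilon> where "\<epsilon> = \<gamma> / (4 * real M)"
    have eps: "\<epsilon> > 0" using gam M2 by (simp add: \<epsilon>_def)
    obtain N where N: "\<And>n. n \<ge> N \<Longrightarrow> p * Z g n
        \<le> (\<Sum>w | w \<in> words n \<and> \<bar>wsum h w - real n * b\<bar> \<le> real n * \<epsilon>. exp (wsum g w))"
      using mass_near_right_derivative[OF D E lo up eps C_def K_def] unfolding p_def by blast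
    obtain N' where N': "\<And>n. n \<ge> N' \<Longrightarrow> p * Z g n
        \<le> (\<Sum>w | w \<in> words n \<and> \<bar>wsum h' w - real n * b'\<bar> \<le> real n * \<epsilon>. exp (wsum g w))"
      using mass_near_right_derivative[OF D E' lo' up' eps C_def K_def] unfolding p_def by blast
    \<comment> \<open>Large enough for both mass estimates and for the gluing error
      \<open>2 * E\<close> of \<open>h\<close> to leave the windows disjoint, which needs
      \<open>8 * E < real n * \<gamma>\<close>.\<close>
    define n where "n = N + N' + Suc (nat \<lceil>8 * E / \<gamma>\<rceil>)"
    have n: "n \<ge> N" "n \<ge> N'" "n > 0" by (auto simp: n_def)
    have "real n > 8 * E / \<gamma>" unfolding n_def by linarith
    then have nE: "real n * \<gamma> > 8 * E" using gam by (simp add: field_simps)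
    \<comment> \<open>Centre for \<open>j\<close> blocks with average of \<open>h\<close> near
      \<open>b\<close> and \<open>M - j\<close> blocks with average near \<open>- b'\<close>;
      raising \<open>j\<close> by one moves it by \<open>real n * \<gamma>\<close>.\<close>
    define ctr where "ctr j = real (j * n) * b - real ((M - j) * n) * b'" for j
    define W where "W j = {w \<in> words (M * n). \<bar>wsum h w - ctr j\<bar> \<le> real (M * n) * \<epsilon> + 2 * E}" for j
    have mass: "q * Z g (M * n) \<le> (\<Sum>w\<in>W j. exp (wsum g w))" if j: "j \<in> {1..<M}" for j
    proof -
      define U where "U = {w. w \<in> words (j * n) \<and> \<bar>wsum h w - real (j * n) * b\<bar> \<le> real (j * n) * \<epsilon>}"
      define V where "V = {w. w \<in> words ((M - j) * n) \<and>
          \<bar>wsum h' w - real ((M - j) * n) * b'\<bar> \<le> real ((M - j) * n) * \<epsilon>}"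
      have len: "j * n + (M - j) * n = M * n" using j by (simp flip: add_mult_distrib)
      have "j * n \<ge> n" "(M - j) * n \<ge> n" using j by auto
      then have large: "j * n \<ge> N" "(M - j) * n \<ge> N'" using n by linarith+
      have inW: "u @ v \<in> W j" if "u \<in> U" "v \<in> V" for u v
      proof -
        have "u @ v \<in> words (M * n)" using that len by (simp add: U_def V_def words_def)
        moreover have "\<bar>wsum h u - real (j * n) * b\<bar> \<le> real (j * n) * \<epsilon>"
          "\<bar>- wsum h v - real ((M - j) * n) * b'\<bar> \<le> real ((M - j) * n) * \<epsilon>"
          using that by (auto simp: U_def V_def h'_def wsum_uminus)
        moreover have "real (j * n) * \<epsilon> + real ((M - j) * n) * \<epsilon> = real (M * n) * \<epsilon>"
          unfolding len[symmetric] by (simp add: algebra_simps)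
        ultimately show ?thesis
          using wsum_append[OF E, of u v] unfolding W_def ctr_def by (simp add: abs_le_iff)
      qed
      have "q * Z g (M * n) \<le> q * (exp (2 * D) * (Z g (j * n) * Z g ((M - j) * n)))"
        using sum_exp_wsum_append(2)[OF D, of "words (j * n)" "j * n" "words ((M - j) * n)" "(M - j) * n"] q0
        by (intro mult_left_mono) (auto simp: Z_def len[symmetric] sum_words_add)
      also have "\<dots> = exp (- 2 * D) * ((p * Z g (j * n)) * (p * Z g ((M - j) * n)))"
        by (simp add: q_def power2_eq_square exp_minus field_simps flip: exp_add)
      also have "\<dots> \<le> exp (- 2 * D) * ((\<Sum>u\<in>U. exp (wsum g u)) * (\<Sum>v\<in>V. exp (wsum g v)))"
        using N[OF large(1)] N'[OF large(2)] p0 Z_pos[of g]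
        by (intro mult_left_mono mult_mono) (auto simp: U_def V_def less_imp_le intro: sum_nonneg)
      also have "\<dots> \<le> (\<Sum>w\<in>W j. exp (wsum g w))"
        by (rule concat_mass[OF D _ _ _ inW]) (auto simp: U_def V_def W_def)
      finally show ?thesis .
    qed
    have disj: "W i \<inter> W j = {}" if "i \<in> {1..<M}" "j \<in> {1..<M}" "i \<noteq> j" for i j
    proof -
      have ctr: "ctr i = real i * (real n * \<gamma>) - real (M * n) * b'" if "i \<in> {1..<M}" for i
        using that by (simp add: ctr_def b' of_nat_diff algebra_simps)
      have aux: "8 * E < 4 * x \<Longrightarrow> 4 * x \<le> y \<Longrightarrow> 2 * (x + 2 * E) < y" for x y by argo
      have quarter: "4 * (real (M * n) * \<epsilon>) = real n * \<gamma>"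
        using M2 by (simp add: \<epsilon>_def field_simps)
      have "\<bar>ctr i - ctr j\<bar> = \<bar>(real i - real j) * (real n * \<gamma>)\<bar>"
        using that by (simp add: ctr algebra_simps)
      also have "\<dots> = \<bar>real i - real j\<bar> * (real n * \<gamma>)"
        using gam n by (simp add: abs_mult)
      finally have "\<bar>ctr i - ctr j\<bar> \<ge> 1 * (real n * \<gamma>)"
        using \<open>i \<noteq> j\<close> gam n by (auto intro!: mult_right_mono)
      then have "real n * \<gamma> \<le> \<bar>ctr i - ctr j\<bar>" by simp
      with nE have "\<bar>ctr i - ctr j\<bar> > 2 * (real (M * n) * \<epsilon> + 2 * E)"
        by (intro aux) (simp_all only: quarter)
      then show ?thesis unfolding W_def by auto
    qed
    have "real (M - 1) * (q * Z g (M * n)) = (\<Sum>j\<in>{1..<M}. q * Z g (M * n))" by simp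
    also have "\<dots> \<le> (\<Sum>j\<in>{1..<M}. \<Sum>w\<in>W j. exp (wsum g w))"
      by (intro sum_mono mass)
    also have "\<dots> = (\<Sum>w\<in>(\<Union>j\<in>{1..<M}. W j). exp (wsum g w))"
      by (rule sum.UNION_disjoint[symmetric]) (use disj in \<open>auto simp: W_def\<close>)
    also have "\<dots> \<le> Z g (M * n)"
      unfolding Z_def by (rule sum_mono2) (auto simp: W_def)
    finally have "(real (M - 1) * q) * Z g (M * n) \<le> 1 * Z g (M * n)" by simp
    with mult_strict_right_mono[OF M Z_pos[of g "M * n"]] show False by linarith
  qed
  have "\<exists>\<delta>>0. \<forall>t. \<bar>t\<bar> \<le> \<delta> \<longrightarrow> pres (tilt g h t) \<le> pres g + b * t + \<epsilon> * \<bar>t\<bar>"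
    if eps: "\<epsilon> > 0" for \<epsilon>
  proof -
    obtain \<delta> where d: "\<delta> > 0"
      "\<And>t. 0 \<le> t \<Longrightarrow> t \<le> \<delta> \<Longrightarrow> pres (tilt g h t) \<le> pres g + (b + \<epsilon>) * t"
      using up[OF eps] by blast
    obtain \<delta>' where d': "\<delta>' > 0"
      "\<And>t. 0 \<le> t \<Longrightarrow> t \<le> \<delta>' \<Longrightarrow> pres (tilt g h' t) \<le> pres g + (b' + \<epsilon>) * t"
      using up'[OF eps] by blast
    have "pres (tilt g h t) \<le> pres g + b * t + \<epsilon> * \<bar>t\<bar>" if t: "\<bar>t\<bar> \<le> min \<delta> \<delta>'" for t
    proof (cases "t \<ge> 0")
      case True
      with d(2)[of t] t show ?thesis by (simp add: algebra_simps)
    next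
      case False
      with d'(2)[of "- t"] t have "pres (tilt g h t) \<le> pres g + (b' + \<epsilon>) * (- t)"
        by (simp add: h'_def tilt_uminus)
      also have "b' * (- t) \<le> b * t"
        using mult_right_mono[OF \<open>b + b' \<le> 0\<close>, of "- t"] False by (simp add: algebra_simps)
      then have "pres g + (b' + \<epsilon>) * (- t) \<le> pres g + b * t + \<epsilon> * \<bar>t\<bar>"
        using False by (simp add: algebra_simps)
      finally show ?thesis .
    qed
    with d(1) d'(1) show ?thesis by (intro exI[of _ "min \<delta> \<delta>'"]) simp
  qed
  then show ?thesis by blast
qed

section \<open>Approximation of Borel sets by words\<close>

lemma open_initial_word: "open {x. P (initial_word n x)}"
proof -
  have coord: "open ((\<lambda>x::seq. x i) -` {b})" for i b
    by (rule open_vimage[OF _ continuous_on_product_coordinates]) (rule Topological_Spaces.open_discrete)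
  have "open {x. initial_word n x = w}" if "length w = n" for w
  proof -
    have "{x. initial_word n x = w} = (\<Inter>i\<in>{..<n}. (\<lambda>x. x i) -` {w ! i})"
      using that by (auto simp: list_eq_iff_nth_eq)
    then show ?thesis using coord by (simp only:) (intro open_INT; simp)
  qed
  moreover have "{x. P (initial_word n x)} = (\<Union>w\<in>{w. length w = n \<and> P w}. {x. initial_word n x = w})"
    by auto
  ultimately show ?thesis by (simp only:) (intro open_UN; simp)
qed

lemma borel_initial_word [measurable]: "{x. P (initial_word n x)} \<in> sets borel"
  by (rule borel_open[OF open_initial_word])

lemma continuous_on_initial_word:
  fixes F :: "bool list \<Rightarrow> 'a::topological_space"
  shows "continuous_on UNIV (\<lambda>x. F (initial_word n x))"
  unfolding continuous_on_open_vimage[OF open_UNIV]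
  using open_initial_word[of "\<lambda>w. F w \<in> _" n] by (auto simp: vimage_def)

lemma open_contains_initial_word:
  assumes "open U" "x \<in> U"
  shows "\<exists>n. {y. initial_word n y = initial_word n x} \<subseteq> U"
proof -
  obtain X where X: "x \<in> (\<Pi>\<^sub>E i\<in>UNIV. X i)" "finite {i. X i \<noteq> UNIV}" "(\<Pi>\<^sub>E i\<in>UNIV. X i) \<subseteq> U"
    using product_topology_open_contains_basis[of "\<lambda>_. euclidean" UNIV U x] assms
    unfolding open_fun_def by auto
  obtain n where n: "{i. X i \<noteq> UNIV} \<subseteq> {..<n}"
    using finite_nat_bounded[OF X(2)] by blast
  have "y \<in> U" if y: "initial_word n y = initial_word n x" for y
  proof -
    have "y i \<in> X i" for i
    proof (cases "i < n")
      case True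
      with y have "y i = x i" by (simp add: initial_word_eq_iff)
      with X(1) show ?thesis by (simp add: PiE_iff)
    next
      case False
      with n have "X i = UNIV" by auto
      then show ?thesis by simp
    qed
    with X(3) show ?thesis by (auto simp: PiE_iff)
  qed
  then show ?thesis by blast
qed

section \<open>Invariance of integrals and approximation in measure\<close>

lemma shift_measurable [measurable]: "shift \<in> borel \<rightarrow>\<^sub>M borel"
  unfolding shift_def
  by (intro borel_measurable_continuous_onI continuous_on_coordinatewise_then_product
      continuous_on_product_coordinates)

lemma shift_funpow_measurable [measurable]: "shift ^^ n \<in> borel \<rightarrow>\<^sub>M borel"
  by (induction n) simp_all

lemma invariant_probsD:
  assumes "\<mu> \<in> invariant_probs"
  shows "prob_space \<mu>" "sets \<mu> = sets borel" "space \<mu> = UNIV" "distr \<mu> \<mu> shift = \<mu>"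
  using assms sets_eq_imp_space_eq[of \<mu> borel] by (auto simp: invariant_probs_def)

lemma integral_shift_funpow:
  fixes h :: "seq \<Rightarrow> real"
  assumes "\<mu> \<in> invariant_probs" "h \<in> borel_measurable borel"
  shows "(\<integral>x. h ((shift ^^ n) x) \<partial>\<mu>) = integral\<^sup>L \<mu> h"
  using assms(2)
proof (induction n arbitrary: h)
  case (Suc n)
  have sets: "sets \<mu> = sets borel" and inv: "distr \<mu> \<mu> shift = \<mu>"
    using invariant_probsD[OF assms(1)] by auto
  note [measurable] = Suc.prems
  have "(\<integral>x. h ((shift ^^ Suc n) x) \<partial>\<mu>) = (\<integral>x. h (shift x) \<partial>\<mu>)"
    using Suc.IH[of "\<lambda>x. h (shift x)"] by simp
  also have "\<dots> = integral\<^sup>L (distr \<mu> \<mu> shift) h"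
  proof (rule integral_distr[symmetric])
    show "shift \<in> measurable \<mu> \<mu>"
      using shift_measurable by (simp only: measurable_cong_sets[OF sets sets])
    show "h \<in> borel_measurable \<mu>"
      using Suc.prems by (simp only: measurable_cong_sets[OF sets refl])
  qed
  finally show ?case by (simp add: inv)
qed simp

lemma bounded_distortion_bounded:
  assumes "bounded_distortion D g"
  shows "\<exists>B. \<forall>x. \<bar>g x\<bar> \<le> B"
proof -
  have "\<bar>g x\<bar> \<le> D + (\<bar>g (per [True])\<bar> + \<bar>g (per [False])\<bar>)" for x
  proof -
    have "\<bar>birkhoff_sum g 1 x - wsum g (initial_word 1 x)\<bar> \<le> D"
      by (rule wsum_initial_word[OF assms])
    moreover have "initial_word 1 x = [x 0]" by (simp add: initial_word_def)
    ultimately have "\<bar>g x - g (per [x 0])\<bar> \<le> D"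
      by (simp add: wsum_def birkhoff_sum_def)
    then show ?thesis by (cases "x 0") simp_all
  qed
  then show ?thesis by blast
qed

lemma initial_word_lift:
  assumes "n \<le> m"
  shows "initial_word n x \<in> V \<longleftrightarrow> initial_word m x \<in> {w. take n w \<in> V}"
  using take_initial_word[of n "m - n" x] assms by simp

text \<open>Approximable sets include those decided by finitely many coordinates and are closed
  under complements, finite unions and increasing unions. Open sets are increasing unions of sets
  decided by words, so induction over the generated sigma-algebra applies; countable unions pass
  through finite partial unions, where continuity of the measure is available.\<close>

lemma approx_by_words:
  assumes "prob_space \<mu>" and sets: "sets \<mu> = sets borel" and "A \<in> sets borel" and "e > 0"
  shows "\<exists>n V. measure \<mu> {x. (x \<in> A) \<noteq> (initial_word n x \<in> V)} < e"
proof -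
  interpret prob_space \<mu> by fact
  have space: "space \<mu> = UNIV" using sets_eq_imp_space_eq[OF sets] by simp
  define ap where "ap A \<longleftrightarrow> (\<forall>e>0. \<exists>n V. measure \<mu> {x. (x \<in> A) \<noteq> (initial_word n x \<in> V)} < e)" for A
  have diff_meas: "{x. (x \<in> A) \<noteq> (initial_word n x \<in> V)} \<in> sets \<mu>" if "A \<in> sets borel" for A n V
  proof -
    have "{x. (x \<in> A) \<noteq> (initial_word n x \<in> V)}
        = (A - {x. initial_word n x \<in> V}) \<union> ({x. initial_word n x \<in> V} - A)" by auto
    then show ?thesis using that borel_initial_word unfolding sets by (auto intro!: sets.Un sets.Diff)
  qed
  have ap_Un: "ap (A \<union> B)"
    if AB: "ap A" "ap B" and ABs: "A \<in> sets borel" "B \<in> sets borel" for A B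
    unfolding ap_def
  proof (intro allI impI)
    fix e :: real assume "e > 0"
    then have "e / 2 > 0" by simp
    then obtain n V m W where V: "measure \<mu> {x. (x \<in> A) \<noteq> (initial_word n x \<in> V)} < e / 2"
      and W: "measure \<mu> {x. (x \<in> B) \<noteq> (initial_word m x \<in> W)} < e / 2"
      using AB unfolding ap_def by blast
    have "{x. (x \<in> A \<union> B) \<noteq> (initial_word (n + m) x \<in> {w. take n w \<in> V} \<union> {w. take m w \<in> W})}
        \<subseteq> {x. (x \<in> A) \<noteq> (initial_word n x \<in> V)} \<union> {x. (x \<in> B) \<noteq> (initial_word m x \<in> W)}"
      using initial_word_lift[of n "n + m" _ V] initial_word_lift[of m "n + m" _ W] by auto
    then have "measure \<mu> {x. (x \<in> A \<union> B) \<noteq> (initial_word (n + m) x \<in> {w. take n w \<in> V} \<union> {w. take m w \<in> W})}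
        \<le> measure \<mu> ({x. (x \<in> A) \<noteq> (initial_word n x \<in> V)} \<union> {x. (x \<in> B) \<noteq> (initial_word m x \<in> W)})"
      by (rule finite_measure_mono) (intro sets.Un diff_meas ABs)
    also have "\<dots> \<le> measure \<mu> {x. (x \<in> A) \<noteq> (initial_word n x \<in> V)}
        + measure \<mu> {x. (x \<in> B) \<noteq> (initial_word m x \<in> W)}"
      by (intro measure_Un_le diff_meas ABs)
    also have "\<dots> < e" using V W by simp
    finally show "\<exists>n V. measure \<mu> {x. (x \<in> A \<union> B) \<noteq> (initial_word n x \<in> V)} < e" by blast
  qed
  have ap_incseq: "ap (\<Union>i. U i)"
    if U: "incseq U" "\<And>i. ap (U i)" "\<And>i. U i \<in> sets borel" for U :: "nat \<Rightarrow> seq set"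
    unfolding ap_def
  proof (intro allI impI)
    fix e :: real assume e: "e > 0"
    have "(\<lambda>i. measure \<mu> (U i)) \<longlonglongrightarrow> measure \<mu> (\<Union>i. U i)"
      using U sets by (intro finite_Lim_measure_incseq) auto
    then have "\<forall>\<^sub>F i in sequentially. measure \<mu> (U i) > measure \<mu> (\<Union>i. U i) - e / 2"
      using e by (intro order_tendstoD(1)) auto
    then obtain i where i: "measure \<mu> (U i) > measure \<mu> (\<Union>i. U i) - e / 2"
      by (auto simp: eventually_sequentially)
    obtain n V where V: "measure \<mu> {x. (x \<in> U i) \<noteq> (initial_word n x \<in> V)} < e / 2"
      using U(2)[of i] half_gt_zero[OF e] unfolding ap_def by blast
    have Us: "(\<Union>i. U i) \<in> sets borel" using U(3) by blast
    have "measure \<mu> {x. (x \<in> (\<Union>i. U i)) \<noteq> (initial_word n x \<in> V)}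
        \<le> measure \<mu> ({x. (x \<in> U i) \<noteq> (initial_word n x \<in> V)} \<union> ((\<Union>i. U i) - U i))"
      using Us U(3) by (intro finite_measure_mono sets.Un sets.Diff diff_meas) (auto simp: sets)
    also have "\<dots> \<le> measure \<mu> {x. (x \<in> U i) \<noteq> (initial_word n x \<in> V)} + measure \<mu> ((\<Union>i. U i) - U i)"
      using Us U(3) by (intro measure_Un_le sets.Diff diff_meas) (auto simp: sets)
    also have "measure \<mu> ((\<Union>i. U i) - U i) = measure \<mu> (\<Union>i. U i) - measure \<mu> (U i)"
      using Us U(3) by (intro finite_measure_Diff) (auto simp: sets)
    finally show "\<exists>n V. measure \<mu> {x. (x \<in> (\<Union>i. U i)) \<noteq> (initial_word n x \<in> V)} < e"
      using i V by (intro exI[of _ n] exI[of _ V]) linarith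
  qed
  have ap_words: "ap {x. initial_word n x \<in> V}" for n V
    unfolding ap_def by (auto intro!: exI[of _ n] exI[of _ V])
  have "A \<in> sigma_sets UNIV {S. open S}"
    using assms(3) by (simp add: borel_def)
  then have "ap A \<and> A \<in> sets borel"
  proof (induction rule: sigma_sets.induct)
    case (Basic U)
    then have U: "open U" by simp
    define V where "V n = {w. {y. initial_word n y = w} \<subseteq> U}" for n
    have "(\<Union>n. {x. initial_word n x \<in> V n}) = U"
      using open_contains_initial_word[OF U] by (auto simp: V_def)
    moreover have "incseq (\<lambda>n. {x. initial_word n x \<in> V n})"
      by (rule incseq_SucI) (auto simp: V_def initial_word_eq_iff)
    ultimately show ?case
      using ap_incseq[of "\<lambda>n. {x. initial_word n x \<in> V n}"] ap_words borel_initial_word U by auto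
  next
    case Empty
    show ?case using ap_words[of 0 "{}"] by simp
  next
    case (Compl A)
    have "ap (UNIV - A)"
      unfolding ap_def
    proof (intro allI impI)
      fix e :: real assume "e > 0"
      then obtain n V where "measure \<mu> {x. (x \<in> A) \<noteq> (initial_word n x \<in> V)} < e"
        using Compl.IH unfolding ap_def by blast
      moreover have "{x. (x \<in> UNIV - A) \<noteq> (initial_word n x \<in> - V)}
          = {x. (x \<in> A) \<noteq> (initial_word n x \<in> V)}" by auto
      ultimately show "\<exists>n V. measure \<mu> {x. (x \<in> UNIV - A) \<noteq> (initial_word n x \<in> V)} < e"
        by (intro exI[of _ n] exI[of _ "- V"]) simp
    qed
    with Compl.IH show ?case by auto
  next
    case (Union A)
    define U where "U n = (\<Union>i<n. A i)" for n :: nat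
    have U: "ap (U n) \<and> U n \<in> sets borel" for n
    proof (induction n)
      case 0
      show ?case using ap_words[of 0 "{}"] by (simp add: U_def)
    next
      case (Suc n)
      have "U (Suc n) = U n \<union> A n" by (auto simp: U_def less_Suc_eq)
      with Suc Union.IH[of n] ap_Un show ?case by auto
    qed
    have "(\<Union>n. U n) = (\<Union>i. A i)" by (auto simp: U_def)
    moreover have "incseq U" unfolding U_def by (intro monoI UN_mono) auto
    ultimately show ?case using ap_incseq[of U] U Union.IH by auto
  qed
  with \<open>e > 0\<close> show ?thesis unfolding ap_def by blast
qed

text \<open>\<open>d\<close> decodes a word into a guess of the partition element. Outside the
  exceptional sets the word lies in \<open>V' A\<close> exactly for the element \<open>A\<close>
  containing the point, so the guess is right.\<close>

lemma approx_partition_by_words: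
  assumes "prob_space \<mu>" and sets: "sets \<mu> = sets borel"
    and Q: "finite Q" "Q \<subseteq> sets borel" "partition_on UNIV Q" and "e > 0"
  shows "\<exists>m d. (\<forall>w. d w \<in> Q) \<and> measure \<mu> {x. x \<notin> d (initial_word m x)} < e"
proof -
  interpret prob_space \<mu> by fact
  have Qne: "Q \<noteq> {}" using Q(3) by (auto simp: partition_on_def)
  then have cardQ: "card Q > 0" using Q(1) by (simp add: card_gt_0_iff)
  have "\<forall>A\<in>Q. \<exists>n V. measure \<mu> {x. (x \<in> A) \<noteq> (initial_word n x \<in> V)} < e / card Q"
    using approx_by_words[OF assms(1) sets] Q(2) \<open>e > 0\<close> cardQ by (auto intro!: divide_pos_pos)
  from bchoice[OF this] obtain n where
    "\<forall>A\<in>Q. \<exists>V. measure \<mu> {x. (x \<in> A) \<noteq> (initial_word (n A) x \<in> V)} < e / card Q" ..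
  from bchoice[OF this] obtain V where V:
    "\<And>A. A \<in> Q \<Longrightarrow> measure \<mu> {x. (x \<in> A) \<noteq> (initial_word (n A) x \<in> V A)} < e / card Q" by blast
  define m where "m = Max (n ` Q)"
  define V' where "V' A = {w. take (n A) w \<in> V A}" for A
  have V': "initial_word (n A) x \<in> V A \<longleftrightarrow> initial_word m x \<in> V' A" if "A \<in> Q" for A x
    unfolding V'_def using that Q(1) by (intro initial_word_lift) (simp add: m_def)
  \<comment> \<open>The approximating word sets may overlap or miss words: any matching element is
    chosen, or any element at all if none matches.\<close>
  define d where "d w = (SOME A. A \<in> Q \<and> ((\<exists>B\<in>Q. w \<in> V' B) \<longrightarrow> w \<in> V' A))" for w
  have d: "d w \<in> Q \<and> ((\<exists>B\<in>Q. w \<in> V' B) \<longrightarrow> w \<in> V' (d w))" for w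
    unfolding d_def by (rule someI_ex) (use Qne in blast)
  then have dQ: "d w \<in> Q" for w by blast
  have bad: "{x. x \<notin> d (initial_word m x)} \<subseteq> (\<Union>A\<in>Q. {x. (x \<in> A) \<noteq> (initial_word (n A) x \<in> V A)})"
  proof (rule subsetI, rule ccontr)
    fix x assume x: "x \<in> {x. x \<notin> d (initial_word m x)}"
      and "x \<notin> (\<Union>A\<in>Q. {x. (x \<in> A) \<noteq> (initial_word (n A) x \<in> V A)})"
    then have eq: "x \<in> A \<longleftrightarrow> initial_word m x \<in> V' A" if "A \<in> Q" for A using that V' by auto
    obtain A where "A \<in> Q" "x \<in> A" using Q(3) by (auto simp: partition_on_def)
    with eq d have "initial_word m x \<in> V' (d (initial_word m x))" by blast
    with eq dQ x show False by simp
  qed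
  have meas: "{x. (x \<in> A) \<noteq> (initial_word (n A) x \<in> V A)} \<in> sets \<mu>" if "A \<in> Q" for A
  proof -
    have "{x. (x \<in> A) \<noteq> (initial_word (n A) x \<in> V A)}
        = (A - {x. initial_word (n A) x \<in> V A}) \<union> ({x. initial_word (n A) x \<in> V A} - A)" by auto
    then show ?thesis using that Q(2) borel_initial_word unfolding sets by (auto intro!: sets.Un sets.Diff)
  qed
  have "measure \<mu> {x. x \<notin> d (initial_word m x)}
      \<le> measure \<mu> (\<Union>A\<in>Q. {x. (x \<in> A) \<noteq> (initial_word (n A) x \<in> V A)})"
    using bad meas Q(1) by (intro finite_measure_mono) auto
  also have "\<dots> \<le> (\<Sum>A\<in>Q. measure \<mu> {x. (x \<in> A) \<noteq> (initial_word (n A) x \<in> V A)})"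
    using meas Q(1) by (intro measure_UNION_le) auto
  also have "\<dots> < (\<Sum>A\<in>Q. e / card Q)"
    using V Q(1) Qne by (intro sum_strict_mono) auto
  also have "\<dots> = e" using cardQ by simp
  finally show ?thesis using dQ by blast
qed

section \<open>The variational inequality\<close>

definition atom :: "seq set set \<Rightarrow> seq \<Rightarrow> seq set" where
  "atom Q x = (THE A. A \<in> Q \<and> x \<in> A)"

text \<open>Restriction to \<open>{..<n}\<close> places itineraries in a finite product set, so that
  they can index finite sums.\<close>

definition itinerary :: "seq set set \<Rightarrow> nat \<Rightarrow> seq \<Rightarrow> nat \<Rightarrow> seq set" where
  "itinerary Q n x = (\<lambda>j\<in>{..<n}. atom Q ((shift ^^ j) x))"

lemma atom_unique:
  assumes "partition_on UNIV Q" "A \<in> Q" "x \<in> A"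
  shows "atom Q x = A"
  unfolding atom_def
proof (rule the_equality)
  fix B assume "B \<in> Q \<and> x \<in> B"
  with assms show "B = A" by (auto simp: partition_on_def disjoint_def)
qed (use assms in blast)

lemma atom_mem:
  assumes "partition_on UNIV Q"
  shows "atom Q x \<in> Q" "x \<in> atom Q x"
proof -
  obtain A where A: "A \<in> Q" "x \<in> A" using assms by (auto simp: partition_on_def)
  with atom_unique[OF assms] show "atom Q x \<in> Q" "x \<in> atom Q x" by auto
qed

lemma itinerary_in_PiE:
  "partition_on UNIV Q \<Longrightarrow> itinerary Q n x \<in> PiE {..<n} (\<lambda>_. Q)"
  by (auto simp: itinerary_def atom_mem)

lemma itinerary_eq_iff:
  "itinerary Q n y = itinerary Q n x \<longleftrightarrow> (\<forall>j<n. atom Q ((shift ^^ j) y) = atom Q ((shift ^^ j) x))"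
  by (auto simp: itinerary_def restrict_def fun_eq_iff split: if_splits)

text \<open>Since \<open>refinement\<close> discards empty intersections, its elements correspond to
  the itineraries that occur, and the entropy becomes a sum over itineraries.\<close>

lemma refinement_eq_itinerary_fibres:
  assumes Q: "partition_on UNIV Q"
  shows "refinement Q n = (\<lambda>w. {x. itinerary Q n x = w}) ` range (itinerary Q n)"
proof -
  have fibre: "(\<Inter>i<n. (shift ^^ i) -` A i) = {y. itinerary Q n y = itinerary Q n x}"
    if A: "\<forall>i<n. A i \<in> Q" and x: "x \<in> (\<Inter>i<n. (shift ^^ i) -` A i)" for A x
  proof -
    have "(shift ^^ i) z \<in> A i \<longleftrightarrow> atom Q ((shift ^^ i) z) = A i" if i: "i < n" for i z
    proof
      assume "(shift ^^ i) z \<in> A i"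
      with A i show "atom Q ((shift ^^ i) z) = A i" by (intro atom_unique[OF Q]) auto
    next
      assume "atom Q ((shift ^^ i) z) = A i"
      with atom_mem(2)[OF Q, of "(shift ^^ i) z"] show "(shift ^^ i) z \<in> A i" by simp
    qed
    then have iff: "z \<in> (\<Inter>i<n. (shift ^^ i) -` A i) \<longleftrightarrow> (\<forall>i<n. atom Q ((shift ^^ i) z) = A i)" for z
      by auto
    have "\<forall>i<n. atom Q ((shift ^^ i) x) = A i" using x iff by blast
    then show ?thesis
      unfolding set_eq_iff iff mem_Collect_eq itinerary_eq_iff by auto
  qed
  show ?thesis
  proof (intro set_eqI iffI)
    fix R assume "R \<in> refinement Q n"
    then have "\<exists>A. R = (\<Inter>i<n. (shift ^^ i) -` A i) \<and> (\<forall>i<n. A i \<in> Q)" and "R \<noteq> {}"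
      unfolding refinement_def by blast+
    then obtain A x where A: "\<forall>i<n. A i \<in> Q" and R: "R = (\<Inter>i<n. (shift ^^ i) -` A i)"
      and "x \<in> (\<Inter>i<n. (shift ^^ i) -` A i)" by (metis all_not_in_conv)
    from fibre[OF A this(3)] R
    show "R \<in> (\<lambda>w. {x. itinerary Q n x = w}) ` range (itinerary Q n)" by simp
  next
    fix R assume "R \<in> (\<lambda>w. {x. itinerary Q n x = w}) ` range (itinerary Q n)"
    then obtain x where R: "R = {y. itinerary Q n y = itinerary Q n x}" by blast
    define A where "A i = atom Q ((shift ^^ i) x)" for i
    have A: "\<forall>i<n. A i \<in> Q" using atom_mem(1)[OF Q] by (simp add: A_def)
    have "x \<in> (\<Inter>i<n. (shift ^^ i) -` A i)"
      using atom_mem(2)[OF Q] by (simp add: A_def)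
    from fibre[OF A this] have "R = (\<Inter>i<n. (shift ^^ i) -` A i)" by (simp add: R)
    moreover have "R \<noteq> {}" unfolding R by blast
    ultimately show "R \<in> refinement Q n"
      unfolding refinement_def using A by (intro DiffI CollectI exI[of _ A] conjI) simp_all
  qed
qed

text \<open>Sums \<open>ln y \<le> y - 1\<close> at \<open>y = q w / m w\<close>; terms with
  \<open>m w = 0\<close> vanish. The total of \<open>q\<close> may fall short of 1 because later
  only realised itineraries are summed.\<close>

lemma gibbs_inequality:
  fixes m q :: "'a \<Rightarrow> real"
  assumes "finite R" "\<And>w. w \<in> R \<Longrightarrow> 0 \<le> m w" "\<And>w. w \<in> R \<Longrightarrow> 0 < q w"
    "sum m R = 1" "sum q R \<le> 1"
  shows "- (\<Sum>w\<in>R. m w * ln (m w)) \<le> (\<Sum>w\<in>R. m w * - ln (q w))"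
proof -
  have "m w * - ln (m w) \<le> m w * - ln (q w) + (q w - m w)" if w: "w \<in> R" for w
  proof (cases "m w = 0")
    case False
    with assms(2)[OF w] have m: "m w > 0" by simp
    have "m w * ln (q w / m w) \<le> m w * (q w / m w - 1)"
      using m assms(3)[OF w] by (intro mult_left_mono ln_le_minus_one) auto
    also have "\<dots> = q w - m w" using m by (simp add: field_simps)
    finally show ?thesis using m assms(3)[OF w] by (simp add: ln_div algebra_simps)
  qed (use assms(3)[OF w] in simp)
  then have "(\<Sum>w\<in>R. m w * - ln (m w)) \<le> (\<Sum>w\<in>R. m w * - ln (q w) + (q w - m w))"
    by (rule sum_mono)
  also have "\<dots> = (\<Sum>w\<in>R. m w * - ln (q w)) + (sum q R - sum m R)"
    by (simp only: sum.distrib sum_subtractf)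
  also have "\<dots> \<le> (\<Sum>w\<in>R. m w * - ln (q w))" using assms(4,5) by simp
  finally show ?thesis by (simp add: sum_negf)
qed

lemma take_drop_initial_word:
  "j < n \<Longrightarrow> take m (drop j (initial_word (n + m) x)) = initial_word m ((shift ^^ j) x)"
  by (auto simp: list_eq_iff_nth_eq shift_funpow)

section \<open>Entropy of a partition decoded from words\<close>

context
  fixes \<mu> :: "seq measure" and Q :: "seq set set" and m :: nat and d :: "bool list \<Rightarrow> seq set"
    and \<delta> :: real
  assumes inv: "\<mu> \<in> invariant_probs"
    and Q: "finite Q" "Q \<subseteq> sets borel" "partition_on UNIV Q"
    and d: "\<And>w. d w \<in> Q"
    and \<delta>: "0 < \<delta>" "\<delta> < 1"
begin

interpretation prob_space \<mu> by (rule invariant_probsD(1)[OF inv])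

lemma sets_mu: "sets \<mu> = sets borel" and space_mu: "space \<mu> = UNIV"
  using invariant_probsD[OF inv] by auto

lemma measure_UNIV [simp]: "measure \<mu> UNIV = 1"
  using prob_space by (simp add: space_mu)

lemma borel_measurable_mu: "borel_measurable \<mu> = borel_measurable borel"
  by (rule measurable_cong_sets[OF sets_mu refl])

text \<open>Conditional law of the atom given a word of \<open>m\<close> letters: the decoded guess
  with weight \<open>1 - \<delta>\<close>, mixed with the uniform law on \<open>Q\<close>, which
  keeps logarithms finite when the guess fails.\<close>

definition kernel :: "seq set \<Rightarrow> bool list \<Rightarrow> real" where
  "kernel A w = (if A = d w then 1 - \<delta> else 0) + \<delta> / real (card Q)"

text \<open>A bound for the logarithmic cost of encoding the true atom by \<open>kernel\<close>,
  according to whether the guess is right or wrong.\<close>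

definition miss :: "seq \<Rightarrow> real" where
  "miss x = (if x \<in> d (initial_word m x) then - ln (1 - \<delta>) else ln (real (card Q) / \<delta>))"

lemma card_Q: "real (card Q) \<ge> 1"
proof -
  have "Q \<noteq> {}" using d by blast
  then show ?thesis using Q(1) by (simp add: Suc_le_eq card_gt_0_iff)
qed

lemma kernel_pos: "0 < kernel A w"
  using \<delta> card_Q by (auto simp: kernel_def intro: add_nonneg_pos)

lemma sum_kernel: "(\<Sum>A\<in>Q. kernel A w) = 1"
proof -
  have "Q \<noteq> {}" using d by blast
  then show ?thesis using Q(1) d by (simp add: kernel_def sum.distrib)
qed

lemma ln_kernel: "- ln (kernel (atom Q x) (initial_word m x)) \<le> miss x"
proof (cases "x \<in> d (initial_word m x)")
  case True
  then have "atom Q x = d (initial_word m x)" by (intro atom_unique Q d)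
  then have "1 - \<delta> \<le> kernel (atom Q x) (initial_word m x)"
    using \<delta> by (simp add: kernel_def)
  then show ?thesis using \<delta> True kernel_pos by (simp add: miss_def)
next
  case False
  have "\<delta> / real (card Q) \<le> kernel (atom Q x) (initial_word m x)"
    using \<delta> by (simp add: kernel_def)
  then have "ln (\<delta> / real (card Q)) \<le> ln (kernel (atom Q x) (initial_word m x))"
    using \<delta> card_Q by (intro ln_mono) auto
  then show ?thesis using False \<delta> card_Q by (simp add: miss_def ln_div)
qed

lemma good_borel: "{x. x \<in> d (initial_word m x)} \<in> sets borel"
proof -
  have "{x. x \<in> d (initial_word m x)} = (\<Union>w\<in>words m. {x. initial_word m x = w} \<inter> d w)"
    by auto
  moreover have "d w \<in> sets borel" for w using d Q(2) by blast
  ultimately show ?thesis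
    by (simp only:) (intro sets.finite_UN sets.Int borel_initial_word finite_words)
qed

lemma miss_measurable [measurable]: "miss \<in> borel_measurable borel"
  unfolding miss_def using good_borel by (intro measurable_If) simp_all

lemma miss_bounded: "\<bar>miss x\<bar> \<le> \<bar>ln (1 - \<delta>)\<bar> + \<bar>ln (real (card Q) / \<delta>)\<bar>"
  by (simp add: miss_def)

lemma integrable_miss: "integrable \<mu> (\<lambda>x. miss ((shift ^^ j) x))"
proof (rule integrable_const_bound)
  show "AE x in \<mu>. norm (miss ((shift ^^ j) x)) \<le> \<bar>ln (1 - \<delta>)\<bar> + \<bar>ln (real (card Q) / \<delta>)\<bar>"
    using miss_bounded by simp
  show "(\<lambda>x. miss ((shift ^^ j) x)) \<in> borel_measurable \<mu>"
    unfolding borel_measurable_mu by measurable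
qed

lemma integral_miss:
  "integral\<^sup>L \<mu> miss \<le> - ln (1 - \<delta>)
     + ln (real (card Q) / \<delta>) * measure \<mu> {x. x \<notin> d (initial_word m x)}"
proof -
  have bad: "{x. x \<notin> d (initial_word m x)} \<in> sets \<mu>"
    using sets.compl_sets[OF good_borel] by (simp add: sets_mu Compl_eq_Diff_UNIV[symmetric] Collect_neg_eq)
  have "integral\<^sup>L \<mu> miss \<le> (\<integral>x. - ln (1 - \<delta>)
      + ln (real (card Q) / \<delta>) * indicator {x. x \<notin> d (initial_word m x)} x \<partial>\<mu>)"
  proof (rule integral_mono)
    show "integrable \<mu> miss" using integrable_miss[of 0] by simp
    show "integrable \<mu> (\<lambda>x. - ln (1 - \<delta>)
      + ln (real (card Q) / \<delta>) * indicator {x. x \<notin> d (initial_word m x)} x)"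
      using bad by (intro Bochner_Integration.integrable_add integrable_mult_right) (auto simp: emeasure_eq_measure)
    show "miss x \<le> - ln (1 - \<delta>) + ln (real (card Q) / \<delta>) * indicator {x. x \<notin> d (initial_word m x)} x" for x
      using \<delta> by (simp add: miss_def)
  qed
  also have "\<dots> = - ln (1 - \<delta>)
      + ln (real (card Q) / \<delta>) * measure \<mu> {x. x \<notin> d (initial_word m x)}"
    using bad by (subst Bochner_Integration.integral_add)
      (auto simp: emeasure_eq_measure space_mu)
  finally show ?thesis .
qed

lemma sum_prod_kernel:
  "(\<Sum>w\<in>PiE {..<n::nat} (\<lambda>_. Q). \<Prod>j<n. kernel (w j) (c j)) = 1"
proof -
  have "(\<Prod>j<n. \<Sum>A\<in>Q. kernel A (c j)) = (\<Sum>w\<in>PiE {..<n} (\<lambda>_. Q). \<Prod>j<n. kernel (w j) (c j))"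
    by (rule prod_sum_PiE) (use Q(1) in auto)
  then show ?thesis by (simp add: sum_kernel)
qed

text \<open>
  Gibbs' inequality is applied to the distribution of the itinerary of a random point: its initial word
  of length \<open>n + m\<close> has the finite Gibbs distribution of \<open>\<psi>\<close>, and each
  atom is then drawn from \<^const>\<open>kernel\<close>.
\<close>

lemma partition_entropy_le:
  assumes D: "bounded_distortion D \<psi>" and meas: "\<psi> \<in> borel_measurable borel"
  shows "partition_entropy \<mu> (refinement Q n)
     \<le> real n * (pres \<psi> - integral\<^sup>L \<mu> \<psi> + integral\<^sup>L \<mu> miss)
        + (real m * (pres \<psi> - integral\<^sup>L \<mu> \<psi>) + 3 * D)"
proof -
  \<comment> \<open>Length \<open>n + m\<close> is needed because the window of a position
    \<open>j < n\<close> reads \<open>m\<close> letters from \<open>j\<close> on.\<close>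
  define q where "q w = (\<Sum>c\<in>words (n + m). exp (wsum \<psi> c) / Z \<psi> (n + m)
      * (\<Prod>j<n. kernel (w j) (take m (drop j c))))" for w
  define R where "R = range (itinerary Q n)"
  define F where "F w = {x. itinerary Q n x = w}" for w
  have fin_PiE: "finite (PiE {..<n} (\<lambda>_. Q))" using Q(1) by (intro finite_PiE) auto
  have R_sub: "R \<subseteq> PiE {..<n} (\<lambda>_. Q)"
    using itinerary_in_PiE[OF Q(3)] by (auto simp: R_def)
  then have finR: "finite R" using fin_PiE by (rule finite_subset)
  have q_pos: "0 < q w" for w
    unfolding q_def using kernel_pos Z_pos by (intro sum_pos mult_pos_pos divide_pos_pos prod_pos) auto
  have "sum q R \<le> sum q (PiE {..<n} (\<lambda>_. Q))"
    using R_sub fin_PiE q_pos by (intro sum_mono2) (auto intro: less_imp_le)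
  also have "\<dots> = (\<Sum>c\<in>words (n + m). exp (wsum \<psi> c) / Z \<psi> (n + m)
      * (\<Sum>w\<in>PiE {..<n} (\<lambda>_. Q). \<Prod>j<n. kernel (w j) (take m (drop j c))))"
    unfolding q_def by (subst sum.swap) (simp only: sum_distrib_left)
  also have "\<dots> = 1"
    unfolding sum_prod_kernel using Z_pos[of \<psi> "n + m"] by (simp add: Z_def flip: sum_divide_distrib)
  finally have q_sum: "sum q R \<le> 1" .
  have Fsets: "F w \<in> sets \<mu>" if wR: "w \<in> R" for w
  proof -
    obtain x where w: "w = itinerary Q n x" using wR by (auto simp: R_def)
    have wj: "w j = atom Q ((shift ^^ j) x)" "w j \<in> Q" if "j < n" for j
      using that atom_mem(1)[OF Q(3)] by (auto simp: w itinerary_def)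
    have "atom Q ((shift ^^ j) y) = w j \<longleftrightarrow> (shift ^^ j) y \<in> w j" if "j < n" for j y
      using atom_mem(2)[OF Q(3), of "(shift ^^ j) y"] atom_unique[OF Q(3) wj(2)[OF that]] by blast
    then have "F w = (\<Inter>j\<in>{..<n}. (shift ^^ j) -` w j)"
      using wj(1) unfolding F_def w itinerary_eq_iff by auto
    moreover have "(shift ^^ j) -` A \<in> sets borel" if "A \<in> Q" for j A
      using measurable_sets[OF shift_funpow_measurable, of A j] that Q(2) by auto
    ultimately show ?thesis unfolding sets_mu
      using wj(2) by (cases "n = 0") (auto intro!: sets.finite_INT)
  qed
  have disj: "disjoint_family_on F R" by (auto simp: disjoint_family_on_def F_def)
  have UnF: "(\<Union>w\<in>R. F w) = UNIV" by (auto simp: R_def F_def)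
  have "measure \<mu> (\<Union>w\<in>R. F w) = (\<Sum>w\<in>R. measure \<mu> (F w))"
    using finR Fsets disj by (intro finite_measure_finite_Union) auto
  then have m_sum: "(\<Sum>w\<in>R. measure \<mu> (F w)) = 1"
    unfolding UnF using prob_space by (simp add: space_mu)
  have inj: "inj_on F R" by (auto simp: inj_on_def F_def R_def)
  \<comment> \<open>A pointwise bound for \<open>- ln q\<close> made of Birkhoff sums of
    \<open>\<psi>\<close> and \<open>miss\<close>, so invariance computes its integral.\<close>
  define G where "G x = ln (Z \<psi> (n + m)) - birkhoff_sum \<psi> (n + m) x + D + (\<Sum>j<n. miss ((shift ^^ j) x))" for x
  have G: "- ln (q (itinerary Q n x)) \<le> G x" for x
  proof -
    define c where "c = initial_word (n + m) x"
    \<comment> \<open>Of the sum over words only the summand of the initial word of \<open>x\<close>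
      itself is kept.\<close>
    have "exp (wsum \<psi> c) / Z \<psi> (n + m) * (\<Prod>j<n. kernel (itinerary Q n x j) (take m (drop j c)))
        \<le> q (itinerary Q n x)"
      unfolding q_def
    proof (rule member_le_sum)
      show "c \<in> words (n + m)" by (simp add: c_def)
    qed (auto intro!: mult_nonneg_nonneg divide_nonneg_pos prod_nonneg less_imp_le[OF kernel_pos] Z_pos
        simp del: zero_le_divide_iff zero_le_mult_iff)
    also have "(\<Prod>j<n. kernel (itinerary Q n x j) (take m (drop j c)))
        = (\<Prod>j<n. kernel (atom Q ((shift ^^ j) x)) (initial_word m ((shift ^^ j) x)))"
      by (intro prod.cong refl) (simp add: itinerary_def c_def take_drop_initial_word)
    finally have "ln (exp (wsum \<psi> c) / Z \<psi> (n + m)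
        * (\<Prod>j<n. kernel (atom Q ((shift ^^ j) x)) (initial_word m ((shift ^^ j) x)))) \<le> ln (q (itinerary Q n x))"
      using Z_pos kernel_pos by (intro ln_mono) (auto intro!: mult_pos_pos prod_pos divide_pos_pos)
    moreover have "ln (exp (wsum \<psi> c) / Z \<psi> (n + m)
        * (\<Prod>j<n. kernel (atom Q ((shift ^^ j) x)) (initial_word m ((shift ^^ j) x))))
        = wsum \<psi> c - ln (Z \<psi> (n + m))
         + (\<Sum>j<n. ln (kernel (atom Q ((shift ^^ j) x)) (initial_word m ((shift ^^ j) x))))"
    proof -
      have "ln (\<Prod>j<n. kernel (atom Q ((shift ^^ j) x)) (initial_word m ((shift ^^ j) x)))
          = (\<Sum>j<n. ln (kernel (atom Q ((shift ^^ j) x)) (initial_word m ((shift ^^ j) x))))"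
        by (rule ln_prod) (auto simp: less_imp_neq[OF kernel_pos, symmetric])
      then show ?thesis
        using Z_pos[of \<psi> "n + m"] kernel_pos
        by (subst ln_mult_pos) (auto simp: ln_div intro!: prod_pos divide_pos_pos)
    qed
    moreover have "- (\<Sum>j<n. ln (kernel (atom Q ((shift ^^ j) x)) (initial_word m ((shift ^^ j) x))))
        \<le> (\<Sum>j<n. miss ((shift ^^ j) x))"
      unfolding sum_negf[symmetric] by (intro sum_mono ln_kernel)
    moreover have "\<bar>birkhoff_sum \<psi> (n + m) x - wsum \<psi> c\<bar> \<le> D"
      unfolding c_def by (rule wsum_initial_word[OF D])
    ultimately show ?thesis unfolding G_def by linarith
  qed
  obtain B where B: "\<And>x. \<bar>\<psi> x\<bar> \<le> B" using bounded_distortion_bounded[OF D] by blast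
  note [measurable] = meas
  have int_psi: "integrable \<mu> (\<lambda>x. \<psi> ((shift ^^ j) x))" for j
  proof (rule integrable_const_bound)
    show "AE x in \<mu>. norm (\<psi> ((shift ^^ j) x)) \<le> B" using B by simp
    show "(\<lambda>x. \<psi> ((shift ^^ j) x)) \<in> borel_measurable \<mu>"
      unfolding borel_measurable_mu by measurable
  qed
  note int_miss = integrable_miss
  have int_G: "integrable \<mu> G"
    unfolding G_def birkhoff_sum_def
    by (intro Bochner_Integration.integrable_add Bochner_Integration.integrable_diff
        Bochner_Integration.integrable_sum int_psi int_miss) simp_all
  have "(\<integral>x. birkhoff_sum \<psi> (n + m) x \<partial>\<mu>) = real (n + m) * integral\<^sup>L \<mu> \<psi>"
    unfolding birkhoff_sum_def using int_psi by (simp add: integral_shift_funpow[OF inv meas])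
  moreover have "(\<integral>x. (\<Sum>j<n. miss ((shift ^^ j) x)) \<partial>\<mu>) = real n * integral\<^sup>L \<mu> miss"
    using int_miss by (simp add: integral_shift_funpow[OF inv miss_measurable])
  ultimately have integral_G: "integral\<^sup>L \<mu> G = ln (Z \<psi> (n + m)) - real (n + m) * integral\<^sup>L \<mu> \<psi>
      + D + real n * integral\<^sup>L \<mu> miss"
    unfolding G_def using int_psi int_miss
    by (simp add: birkhoff_sum_def space_mu)
  have pointwise: "(\<Sum>w\<in>R. indicator (F w) x * - ln (q w)) = - ln (q (itinerary Q n x))" for x
  proof -
    have "(\<Sum>w\<in>R. indicator (F w) x * - ln (q w)) = (\<Sum>w\<in>{itinerary Q n x}. indicator (F w) x * - ln (q w))"
      using finR by (intro sum.mono_neutral_right) (auto simp: R_def F_def)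
    then show ?thesis by (simp add: F_def)
  qed
  have "partition_entropy \<mu> (refinement Q n) = - (\<Sum>w\<in>R. measure \<mu> (F w) * ln (measure \<mu> (F w)))"
    unfolding partition_entropy_def refinement_eq_itinerary_fibres[OF Q(3)] R_def[symmetric] F_def[symmetric]
    using inj by (simp add: sum.reindex)
  also have "\<dots> \<le> (\<Sum>w\<in>R. measure \<mu> (F w) * - ln (q w))"
    using finR q_pos m_sum q_sum by (intro gibbs_inequality) auto
  also have "\<dots> = (\<integral>x. (\<Sum>w\<in>R. indicator (F w) x * - ln (q w)) \<partial>\<mu>)"
    using Fsets finR by (subst Bochner_Integration.integral_sum) (auto simp: space_mu emeasure_eq_measure)
  also have "\<dots> \<le> integral\<^sup>L \<mu> G"
  proof (rule integral_mono)
    show "integrable \<mu> (\<lambda>x. \<Sum>w\<in>R. indicator (F w) x * - ln (q w))"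
      using Fsets by (intro Bochner_Integration.integrable_sum integrable_mult_left)
        (auto simp: emeasure_eq_measure)
    show "(\<Sum>w\<in>R. indicator (F w) x * - ln (q w)) \<le> G x" for x
      unfolding pointwise by (rule G)
  qed (rule int_G)
  \<comment> \<open>The constant \<open>3 * D\<close> is \<open>2 * D\<close> for comparing
    \<open>ln Z\<close> with the pressure plus \<open>D\<close> for comparing Birkhoff sums of
    points and words.\<close>
  also have "\<dots> \<le> (real (n + m) * pres \<psi> + 2 * D) - real (n + m) * integral\<^sup>L \<mu> \<psi>
      + D + real n * integral\<^sup>L \<mu> miss"
    using ln_Z_pres[OF D, of "n + m"] unfolding integral_G by simp
  also have "\<dots> = real n * (pres \<psi> - integral\<^sup>L \<mu> \<psi> + integral\<^sup>L \<mu> miss)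
        + (real m * (pres \<psi> - integral\<^sup>L \<mu> \<psi>) + 3 * D)"
    by (simp add: algebra_simps)
  finally show ?thesis .
qed

end

text \<open>The order of choices matters: \<open>\<delta>\<close> makes a right guess cost
  \<open>e / 2\<close>, which fixes the penalty \<open>L\<close> of a wrong one; only then is the
  decoder taken accurate enough to keep the expected penalty below \<open>e / 2\<close>. What
  depends on \<open>m\<close> vanishes after division by \<open>n\<close>.\<close>

lemma ks_entropy_le:
  assumes inv: "\<mu> \<in> invariant_probs"
    and D: "bounded_distortion D \<psi>" and meas: "\<psi> \<in> borel_measurable borel"
  shows "ks_entropy \<mu> \<le> ereal (pres \<psi> - integral\<^sup>L \<mu> \<psi>)"
  unfolding ks_entropy_def
proof (rule SUP_least)
  fix Q :: "seq set set" assume "Q \<in> {Q. finite Q \<and> Q \<subseteq> sets borel \<and> partition_on UNIV Q}"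
  then have Q: "finite Q" "Q \<subseteq> sets borel" "partition_on (UNIV :: seq set) Q" by auto
  show "limsup (\<lambda>n. ereal (partition_entropy \<mu> (refinement Q n) / real n))
      \<le> ereal (pres \<psi> - integral\<^sup>L \<mu> \<psi>)"
  proof (rule ereal_le_epsilon2)
    fix e :: real assume e: "0 < e"
    define \<delta> where "\<delta> = 1 - exp (- e / 2)"
    have \<delta>: "0 < \<delta>" "\<delta> < 1" "- ln (1 - \<delta>) = e / 2" using e by (auto simp: \<delta>_def)
    define L where "L = ln (real (card Q) / \<delta>)"
    define M where "M = \<bar>L\<bar> + 1"
    have M: "M > 0" "L \<le> M" by (auto simp: M_def)
    then have "e / (2 * M) > 0" using e by simp
    then obtain m d where d: "\<And>w. d w \<in> Q"
      and bad: "measure \<mu> {x. x \<notin> d (initial_word m x)} < e / (2 * M)"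
      using approx_partition_by_words[OF invariant_probsD(1,2)[OF inv] Q] by blast
    define K where "K = real m * (pres \<psi> - integral\<^sup>L \<mu> \<psi>) + 3 * D"
    define \<kappa> where "\<kappa> = integral\<^sup>L \<mu> (miss Q m d \<delta>)"
    have "\<kappa> \<le> e / 2 + L * measure \<mu> {x. x \<notin> d (initial_word m x)}"
      using integral_miss[OF inv Q d \<delta>(1,2)] \<delta>(3) by (simp add: \<kappa>_def L_def)
    also have "L * measure \<mu> {x. x \<notin> d (initial_word m x)} \<le> M * (e / (2 * M))"
      using bad M by (intro mult_mono) auto
    also have "\<dots> = e / 2" using M by simp
    finally have "\<kappa> \<le> e" by simp
    define p where "p = pres \<psi> - integral\<^sup>L \<mu> \<psi> + e"
    have "partition_entropy \<mu> (refinement Q n) / real n \<le> p + K / real n" if "n > 0" for n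
    proof -
      have "partition_entropy \<mu> (refinement Q n) \<le> real n * (pres \<psi> - integral\<^sup>L \<mu> \<psi> + \<kappa>) + K"
        unfolding K_def \<kappa>_def by (rule partition_entropy_le[OF inv Q d \<delta>(1,2) D meas])
      also have "\<dots> \<le> real n * p + K"
        using \<open>\<kappa> \<le> e\<close> by (simp add: p_def mult_left_mono)
      finally show ?thesis using that by (simp add: field_simps)
    qed
    then have "limsup (\<lambda>n. ereal (partition_entropy \<mu> (refinement Q n) / real n))
        \<le> limsup (\<lambda>n. ereal (p + K / real n))"
      by (intro Limsup_mono eventually_sequentiallyI[of 1]) simp
    also have "\<dots> = ereal p"
    proof (intro lim_imp_Limsup)
      have "(\<lambda>n. p + K / real n) \<longlonglongrightarrow> p + 0"
        by (intro tendsto_intros lim_const_over_n)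
      then show "(\<lambda>n. ereal (p + K / real n)) \<longlonglongrightarrow> ereal p" by simp
    qed simp
    finally show "limsup (\<lambda>n. ereal (partition_entropy \<mu> (refinement Q n) / real n))
        \<le> ereal (pres \<psi> - integral\<^sup>L \<mu> \<psi>) + ereal e"
      by (simp add: p_def)
  qed
qed

section \<open>Averages over periodic orbits\<close>

lemma seq_lipschitz_continuous:
  assumes "0 < \<theta>" "\<theta> < 1" "seq_lipschitz \<theta> f"
  shows "continuous_on UNIV f"
proof -
  obtain L where L: "0 \<le> L" "\<And>x y. \<bar>f x - f y\<bar> \<le> L * seq_dist \<theta> x y"
    using seq_lipschitzE[OF assms(3,1)] by blast
  have "(f \<longlongrightarrow> f x) (at x)" for x
  proof (rule tendstoI)
    fix e :: real assume e: "0 < e"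
    then have "0 < e / (L + 1)" using L(1) by simp
    then obtain n where n: "\<theta> ^ n < e / (L + 1)" using real_arch_pow_inv assms(2) by blast
    have "dist (f y) (f x) < e" if "initial_word n y = initial_word n x" for y
    proof -
      have "\<bar>f y - f x\<bar> \<le> L * seq_dist \<theta> y x" by (rule L)
      also have "\<dots> \<le> (L + 1) * \<theta> ^ n"
        using that L(1) assms by (intro mult_mono seq_dist_le) (auto simp: initial_word_eq_iff seq_dist_nonneg)
      also have "\<dots> < e" using n L(1) by (simp add: pos_less_divide_eq mult.commute)
      finally show ?thesis by (simp add: dist_real_def)
    qed
    then show "\<forall>\<^sub>F y in at x. dist (f y) (f x) < e"
      unfolding eventually_at_topological
      using open_initial_word[of "\<lambda>w. w = initial_word n x" n]
      by (intro exI[of _ "{y. initial_word n y = initial_word n x}"]) auto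
  qed
  then show ?thesis by (simp add: continuous_on_def)
qed

lemma compact_UNIV_seq: "compact (UNIV :: seq set)"
proof -
  have "compact_space (euclidean :: bool topology)"
    by (simp add: compact_space_def compactin_euclidean_iff finite_imp_compact)
  then have "compact_space (product_topology (\<lambda>i::nat. euclidean :: bool topology) UNIV)"
    by (simp add: compact_space_product_topology)
  then show ?thesis
    by (simp add: euclidean_product_topology compact_space_def compactin_euclidean_iff)
qed

text \<open>Compactness turns pointwise positivity into a uniform gap, the source of the geometric
  decay in the zeta series.\<close>

lemma positive_lower_bound:
  assumes "continuous_on UNIV f" "\<And>x::seq. f x > (0::real)"
  shows "\<exists>a>0. \<forall>x. a \<le> f x"
  using continuous_attains_inf[OF compact_UNIV_seq _ assms(1)] assms(2) by auto

text \<open>Indexing by finite words makes the family countable, as the diagonal choice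
  requires.\<close>

definition cyl :: "bool list \<Rightarrow> seq set" where
  "cyl w = {x. initial_word (length w) x = w}"

lemma cylinder_eq_cyl: "cylinder k \<Longrightarrow> \<exists>w. k = cyl w"
proof -
  assume "cylinder k"
  then obtain m a where "k = {x. \<forall>i<m. x i = a i}" unfolding cylinder_def by blast
  then have "k = cyl (initial_word m a)" by (simp add: cyl_def initial_word_eq_iff)
  then show ?thesis by blast
qed

lemma continuous_on_cyl: "continuous_on UNIV (\<lambda>x. indicator (cyl w) x :: real)"
proof -
  have "(\<lambda>x. indicator (cyl w) x :: real) = (\<lambda>x. if initial_word (length w) x = w then 1 else 0)"
    by (auto simp: cyl_def fun_eq_iff)
  then show ?thesis
    using continuous_on_initial_word[of "\<lambda>v. if v = w then 1 else 0 :: real" "length w"] by (simp only:)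
qed

lemma borel_cyl: "cyl w \<in> sets borel"
  unfolding cyl_def by (rule borel_initial_word)

lemma birkhoff_sum_indicator_bounds:
  "0 \<le> birkhoff_sum (\<lambda>x. indicator A x) n x" "birkhoff_sum (\<lambda>x. indicator A x) n x \<le> real n"
proof -
  show "0 \<le> birkhoff_sum (\<lambda>x. indicator A x) n x"
    unfolding birkhoff_sum_def by (intro sum_nonneg) simp
  have "birkhoff_sum (\<lambda>x. indicator A x) n x \<le> (\<Sum>i<n. 1 :: real)"
    unfolding birkhoff_sum_def by (intro sum_mono) (simp add: indicator_def)
  then show "birkhoff_sum (\<lambda>x. indicator A x) n x \<le> real n" by simp
qed

text \<open>Terms of index below \<open>n - length w\<close> read only coordinates below
  \<open>n\<close> and cancel; at most \<open>length w\<close> terms with values 0 or 1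
  remain.\<close>

lemma bounded_distortion_cyl: "bounded_distortion (real (length w)) (\<lambda>x. indicator (cyl w) x)"
  unfolding bounded_distortion_def
proof (intro allI impI)
  fix n and x y :: seq
  assume xy: "\<forall>i<n. x i = y i"
  let ?S = "birkhoff_sum (\<lambda>x. indicator (cyl w) x)"
  show "\<bar>?S n x - ?S n y\<bar> \<le> real (length w)"
  proof (cases "n \<le> length w")
    case True
    then show ?thesis
      using birkhoff_sum_indicator_bounds[of "cyl w" n x] birkhoff_sum_indicator_bounds[of "cyl w" n y]
      by linarith
  next
    case False
    define l where "l = n - length w"
    have n: "n = l + length w" using False by (simp add: l_def)
    have "(shift ^^ i) x \<in> cyl w \<longleftrightarrow> (shift ^^ i) y \<in> cyl w" if "i < l" for i
    proof -
      have "initial_word (length w) ((shift ^^ i) x) = initial_word (length w) ((shift ^^ i) y)"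
        using that xy n by (simp add: initial_word_eq_iff shift_funpow)
      then show ?thesis by (simp add: cyl_def)
    qed
    then have "?S l x = ?S l y"
      unfolding birkhoff_sum_def by (intro sum.cong refl) (simp add: indicator_def)
    then have "?S n x - ?S n y
        = ?S (length w) ((shift ^^ l) x) - ?S (length w) ((shift ^^ l) y)"
      unfolding n birkhoff_sum_add by simp
    then show ?thesis
      using birkhoff_sum_indicator_bounds[of "cyl w" "length w" "(shift ^^ l) x"]
        birkhoff_sum_indicator_bounds[of "cyl w" "length w" "(shift ^^ l) y"]
      by linarith
  qed
qed

text \<open>Jensen's inequality from the tangent of \<open>exp\<close> at the weighted mean:
  \<open>1 + y \<le> exp y\<close> is summed and the linear part cancels.\<close>

lemma weighted_jensen_exp:
  fixes a S :: "'a \<Rightarrow> real"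
  assumes "\<And>w. w \<in> A \<Longrightarrow> 0 \<le> a w" "sum a A > 0"
  shows "sum a A * exp (t * ((\<Sum>w\<in>A. a w * S w) / sum a A)) \<le> (\<Sum>w\<in>A. a w * exp (t * S w))"
proof -
  define M where "M = (\<Sum>w\<in>A. a w * S w) / sum a A"
  have M: "(\<Sum>w\<in>A. a w * S w) = M * sum a A" using assms(2) by (simp add: M_def)
  have "sum a A = (\<Sum>w\<in>A. a w + t * (a w * S w) - t * M * a w)"
    by (simp add: sum.distrib sum_subtractf sum_distrib_left[symmetric] M)
  also have "\<dots> = (\<Sum>w\<in>A. a w * (1 + t * (S w - M)))"
    by (simp add: algebra_simps)
  also have "\<dots> \<le> (\<Sum>w\<in>A. a w * exp (t * (S w - M)))"
    using assms(1) by (intro sum_mono mult_left_mono exp_ge_add_one_self) auto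
  also have "\<dots> = (\<Sum>w\<in>A. a w * exp (t * S w)) * exp (- (t * M))"
    unfolding sum_distrib_right mult.assoc exp_add[symmetric] by (simp add: algebra_simps)
  finally have "sum a A * exp (t * M) \<le> (\<Sum>w\<in>A. a w * exp (t * S w)) * exp (- (t * M)) * exp (t * M)"
    by (rule mult_right_mono) simp
  then show ?thesis by (simp add: M_def mult.assoc flip: exp_add)
qed

lemma abs_wsum_le:
  assumes "\<And>x. \<bar>g x\<bar> \<le> B"
  shows "\<bar>wsum g w\<bar> \<le> real (length w) * B"
proof -
  have "\<bar>wsum g w\<bar> \<le> (\<Sum>i<length w. \<bar>g ((shift ^^ i) (per w))\<bar>)"
    unfolding wsum_def birkhoff_sum_def by (rule sum_abs)
  also have "\<dots> \<le> (\<Sum>i<length w. B)" by (intro sum_mono assms)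
  finally show ?thesis by simp
qed

text \<open>Jensen bounds \<open>t\<close> times the mean of \<open>wsum h\<close> by the growth of
  a tilted sum, that is, \<open>n\<close> times a pressure difference up to a bounded error. The
  fixed tilts \<open>\<delta>\<close> and \<open>- \<delta>\<close> give the two inequalities;
  replacing \<open>g\<close> by \<open>s\<close> times \<open>g\<close> moves each exponent by at
  most \<open>(1 - s) * (real n * B)\<close>.\<close>

lemma orbit_averages_near_derivative:
  assumes D: "bounded_distortion D g" and E: "bounded_distortion E h"
    and b: "\<forall>\<epsilon>>0. \<exists>\<delta>>0. \<forall>t. \<bar>t\<bar> \<le> \<delta> \<longrightarrow> pres (tilt g h t) \<le> pres g + b * t + \<epsilon> * \<bar>t\<bar>"
    and e: "e > 0"
  shows "\<exists>N. \<exists>s0<1. \<forall>n\<ge>N. \<forall>s. s0 < s \<longrightarrow> s \<le> 1 \<longrightarrow>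
     \<bar>(\<Sum>w\<in>words n. exp (s * wsum g w) * (wsum h w / real n)) - b * (\<Sum>w\<in>words n. exp (s * wsum g w))\<bar>
       \<le> e * (\<Sum>w\<in>words n. exp (s * wsum g w))"
proof -
  obtain \<delta>0 where d0: "\<delta>0 > 0"
    "\<And>t. \<bar>t\<bar> \<le> \<delta>0 \<Longrightarrow> pres (tilt g h t) \<le> pres g + b * t + (e / 2) * \<bar>t\<bar>"
    using b[rule_format, of "e / 2"] e by auto
  define \<delta> where "\<delta> = min \<delta>0 1"
  have d: "\<delta> > 0" "\<delta> \<le> 1" "\<delta> \<le> \<delta>0" using d0(1) by (auto simp: \<delta>_def)
  obtain B0 where B0: "\<And>x. \<bar>g x\<bar> \<le> B0" using bounded_distortion_bounded[OF D] by blast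
  define B where "B = B0 + 1"
  have B: "\<bar>g x\<bar> \<le> B" for x using B0[of x] by (simp add: B_def)
  have Bpos: "B > 0" using B0[of undefined] by (simp add: B_def)
  define C where "C = 4 * (D + E)"
  have C: "C \<ge> 0" using bounded_distortion_nonneg D E by (simp add: C_def)
  \<comment> \<open>Of the error allowance \<open>\<delta> * e\<close> per step, half goes to
    differentiability, a quarter to the constant \<open>C\<close> through \<open>N\<close> and a
    quarter to \<open>s\<close> through \<open>s0\<close>.\<close>
  define N where "N = Suc (nat \<lceil>4 * C / (\<delta> * e)\<rceil>)"
  define s0 where "s0 = 1 - \<delta> * e / (8 * B)"
  have main: "\<bar>(\<Sum>w\<in>words n. exp (s * wsum g w) * (wsum h w / real n)) - b * (\<Sum>w\<in>words n. exp (s * wsum g w))\<bar>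
       \<le> e * (\<Sum>w\<in>words n. exp (s * wsum g w))" if n: "n \<ge> N" and s: "s0 < s" "s \<le> 1" for n s
  proof -
    have n0: "real n > 0" using n by (simp add: N_def)
    have nC: "C / real n \<le> \<delta> * e / 4"
    proof -
      have "4 * C / (\<delta> * e) \<le> real n" using n unfolding N_def by linarith
      then have "4 * C \<le> real n * (\<delta> * e)" using d e by (simp add: pos_divide_le_eq)
      then show ?thesis using n0 by (simp add: field_simps)
    qed
    have sB: "2 * (1 - s) * B \<le> \<delta> * e / 4"
    proof -
      have "1 - s \<le> \<delta> * e / (8 * B)" using s by (simp add: s0_def)
      then have "(1 - s) * (8 * B) \<le> \<delta> * e" using Bpos by (simp add: pos_le_divide_eq)
      moreover have "(1 - s) * (8 * B) = 4 * (2 * (1 - s) * B)" by simp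
      ultimately show ?thesis by linarith
    qed
    define a where "a w = exp (s * wsum g w)" for w
    define W where "W = sum a (words n)"
    have W: "W > 0" unfolding W_def a_def by (intro sum_pos) auto
    define M where "M = (\<Sum>w\<in>words n. a w * wsum h w) / W"
    have close: "\<bar>s * wsum g w - wsum g w\<bar> \<le> (1 - s) * (real n * B)" if "w \<in> words n" for w
    proof -
      have "\<bar>s * wsum g w - wsum g w\<bar> = \<bar>(1 - s) * wsum g w\<bar>"
        by (subst abs_minus_commute) (simp add: algebra_simps)
      also have "\<dots> = (1 - s) * \<bar>wsum g w\<bar>" using s by (simp add: abs_mult)
      also have "\<dots> \<le> (1 - s) * (real n * B)"
        using abs_wsum_le[of g B w, OF B] that s by (intro mult_left_mono) (auto simp: words_def)
      finally show ?thesis .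
    qed
    have key: "t * M \<le> real n * (b * t + (e / 2) * \<delta>) + real n * (\<delta> * e / 2)" if t: "\<bar>t\<bar> = \<delta>" for t
    proof -
      have "W * exp (t * M) \<le> (\<Sum>w\<in>words n. a w * exp (t * wsum h w))"
        unfolding W_def M_def using W by (intro weighted_jensen_exp) (auto simp: a_def W_def)
      also have "\<dots> \<le> (\<Sum>w\<in>words n. exp ((1 - s) * (real n * B)) * exp (wsum g w + t * wsum h w))"
      proof (rule sum_mono)
        fix w assume w: "w \<in> words n"
        show "a w * exp (t * wsum h w) \<le> exp ((1 - s) * (real n * B)) * exp (wsum g w + t * wsum h w)"
          unfolding a_def exp_add[symmetric] exp_le_cancel_iff using close[OF w] by linarith
      qed
      also have "\<dots> = exp ((1 - s) * (real n * B)) * Z (tilt g h t) n"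
        by (simp add: Z_tilt sum_distrib_left)
      also have "\<dots> \<le> exp ((1 - s) * (real n * B)) * exp (real n * pres (tilt g h t) + 2 * (D + E))"
        using t d by (intro mult_left_mono Z_tilt_bounds(2)[OF D E]) auto
      finally have 1: "W * exp (t * M) \<le> exp ((1 - s) * (real n * B) + (real n * pres (tilt g h t) + 2 * (D + E)))"
        by (simp add: exp_add)
      have "exp (- ((1 - s) * (real n * B))) * exp (real n * pres g - 2 * (D + E))
          \<le> exp (- ((1 - s) * (real n * B))) * Z g n"
        using Z_tilt_bounds(1)[OF D E, of 0 n] by (intro mult_left_mono) auto
      also have "\<dots> \<le> W"
        unfolding Z_def W_def sum_distrib_left
      proof (rule sum_mono)
        fix w assume w: "w \<in> words n"
        show "exp (- ((1 - s) * (real n * B))) * exp (wsum g w) \<le> a w"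
          unfolding a_def exp_add[symmetric] exp_le_cancel_iff using close[OF w] by linarith
      qed
      finally have 2: "exp (- ((1 - s) * (real n * B)) + (real n * pres g - 2 * (D + E))) \<le> W"
        by (simp only: exp_add)
      have "exp (- ((1 - s) * (real n * B)) + (real n * pres g - 2 * (D + E)) + t * M) \<le> W * exp (t * M)"
        unfolding exp_add[of _ "t * M"] using 2 by (intro mult_right_mono) auto
      from order_trans[OF this 1] have "- ((1 - s) * (real n * B)) + (real n * pres g - 2 * (D + E)) + t * M
          \<le> (1 - s) * (real n * B) + (real n * pres (tilt g h t) + 2 * (D + E))"
        by (simp only: exp_le_cancel_iff)
      then have "t * M \<le> real n * (pres (tilt g h t) - pres g) + real n * (2 * (1 - s) * B) + C"
        by (simp add: C_def algebra_simps)
      also have "\<dots> \<le> real n * (b * t + (e / 2) * \<delta>) + real n * (\<delta> * e / 4) + real n * (\<delta> * e / 4)"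
      proof (intro add_mono mult_left_mono sB)
        show "pres (tilt g h t) - pres g \<le> b * t + e / 2 * \<delta>" using d0(2)[of t] t d by simp
        show "C \<le> real n * (\<delta> * e / 4)" using nC n0 by (simp add: pos_divide_le_eq mult.commute)
      qed auto
      finally show ?thesis by (simp add: field_simps)
    qed
    have "\<delta> * M \<le> \<delta> * (real n * (b + e))" "\<delta> * (- M) \<le> \<delta> * (real n * (- b + e))"
      using key[of \<delta>] key[of "- \<delta>"] d(1) by (simp_all add: algebra_simps)
    then have "M \<le> real n * (b + e)" "- M \<le> real n * (- b + e)"
      using d(1) by (simp_all only: mult_le_cancel_left_pos)
    then have "\<bar>M / real n - b\<bar> \<le> e"
      using n0 by (simp add: abs_le_iff field_simps)
    then have "\<bar>M / real n - b\<bar> * W \<le> e * W" using W by (intro mult_right_mono) auto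
    moreover have "\<bar>M / real n - b\<bar> * W = \<bar>(M / real n - b) * W\<bar>" using W by (simp add: abs_mult)
    moreover have "(M / real n - b) * W = (\<Sum>w\<in>words n. a w * (wsum h w / real n)) - b * W"
      using W by (simp add: M_def left_diff_distrib sum_divide_distrib[symmetric])
    ultimately show ?thesis unfolding W_def a_def by simp
  qed
  have "s0 < 1" using d e Bpos by (simp add: s0_def)
  with main show ?thesis by blast
qed

section \<open>Rotations of words and positivity on cylinders\<close>

lemma per_rotate: "w \<noteq> [] \<Longrightarrow> per (rotate i w) = (shift ^^ i) (per w)"
  by (auto simp: per_def shift_funpow nth_rotate mod_add_right_eq)

lemma wsum_rotate:
  assumes "w \<noteq> []"
  shows "wsum g (rotate i w) = wsum g w"
proof -
  have per: "(shift ^^ length w) (per w) = per w"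
    using per_periodic by (simp add: shift_funpow)
  have "birkhoff_sum g i (per w) + birkhoff_sum g (length w) ((shift ^^ i) (per w))
      = birkhoff_sum g (length w) (per w) + birkhoff_sum g i ((shift ^^ length w) (per w))"
    by (simp only: birkhoff_sum_add[symmetric] add.commute)
  then show ?thesis using assms by (simp add: wsum_def per_rotate per)
qed

text \<open>Rotation permutes the words of length \<open>n\<close> and preserves weights, so every
  step of the orbit contributes the same weighted sum of \<open>h\<close> as its starting
  point.\<close>

lemma orbit_average_eq_point_average:
  assumes "n > 0"
  shows "(\<Sum>w\<in>words n. exp (wsum g w) * (wsum h w / real n)) = (\<Sum>w\<in>words n. exp (wsum g w) * h (per w))"
proof -
  have nonempty: "w \<noteq> []" if "w \<in> words n" for w using that assms by (auto simp: words_def)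
  have inj: "inj_on (rotate i) (words n)" for i
  proof (rule inj_on_inverseI[where g = "rotate (n - i mod n)"])
    fix w assume "w \<in> words n"
    \<comment> \<open>The total rotation is a multiple of the length, hence the identity.\<close>
    moreover have "n - i mod n + i = n * Suc (i div n)"
      using mult_div_mod_eq[of n i] mod_less_divisor[OF assms, of i] unfolding mult_Suc_right by linarith
    ultimately show "rotate (n - i mod n) (rotate i w) = w"
      by (simp add: rotate_rotate rotate_id words_def)
  qed
  have image: "rotate i ` words n = words n" for i
    by (rule endo_inj_surj[OF finite_words _ inj]) (auto simp: words_def)
  have "(\<Sum>w\<in>words n. exp (wsum g w) * wsum h w)
      = (\<Sum>w\<in>words n. \<Sum>i<n. exp (wsum g (rotate i w)) * h (per (rotate i w)))"
    unfolding wsum_def[of h] birkhoff_sum_def sum_distrib_left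
    by (intro sum.cong) (auto simp: wsum_rotate per_rotate nonempty words_def)
  also have "\<dots> = (\<Sum>i<n. \<Sum>w\<in>words n. exp (wsum g (rotate i w)) * h (per (rotate i w)))"
    by (rule sum.swap)
  also have "\<dots> = (\<Sum>i<n. \<Sum>w\<in>words n. exp (wsum g w) * h (per w))"
  proof (rule sum.cong)
    fix i
    show "(\<Sum>w\<in>words n. exp (wsum g (rotate i w)) * h (per (rotate i w))) = (\<Sum>w\<in>words n. exp (wsum g w) * h (per w))"
      using sum.reindex[OF inj, of "\<lambda>w. exp (wsum g w) * h (per w)" i] by (simp add: image)
  qed simp
  finally show ?thesis using assms by (simp add: sum_divide_distrib[symmetric])
qed

text \<open>All words starting with \<open>a\<close> contribute, and gluing compares their weight
  with the full sum; the proportion does not depend on \<open>n\<close>.\<close>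

lemma cylinder_point_average:
  assumes D: "bounded_distortion D g"
  shows "exp (- 4 * D) * exp (wsum g a) / Z g (length a) * Z g (length a + n)
     \<le> (\<Sum>w\<in>words (length a + n). exp (wsum g w) * indicator (cyl a) (per w))"
proof -
  let ?m = "length a"
  define W where "W = {w \<in> words (?m + n). per w \<in> cyl a}"
  have "a @ v \<in> W" if "v \<in> words n" for v
    using that by (auto simp: W_def words_def cyl_def list_eq_iff_nth_eq per_def nth_append)
  then have "exp (- 2 * D) * ((\<Sum>u\<in>{a}. exp (wsum g u)) * (\<Sum>v\<in>words n. exp (wsum g v))) \<le> (\<Sum>w\<in>W. exp (wsum g w))"
    by (intro concat_mass[OF D, where n = "length a" and m = n]) (auto simp: words_def[of "length a"] W_def)
  then have lower: "exp (- 2 * D) * (exp (wsum g a) * Z g n) \<le> (\<Sum>w\<in>W. exp (wsum g w))"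
    by (simp add: Z_def)
  have "Z g (?m + n) \<le> exp (2 * D) * (Z g ?m * Z g n)"
    using sum_exp_wsum_append(2)[OF D, of "words ?m" ?m "words n" n] by (simp add: Z_def sum_words_add)
  then have "exp (- 4 * D) * exp (wsum g a) / Z g ?m * Z g (?m + n)
      \<le> exp (- 4 * D) * exp (wsum g a) / Z g ?m * (exp (2 * D) * (Z g ?m * Z g n))"
    using Z_pos[of g ?m] by (intro mult_left_mono) auto
  also have "\<dots> = (exp (- 4 * D) * exp (2 * D)) * (exp (wsum g a) * Z g n)"
    using Z_pos[of g ?m] by simp
  also have "exp (- 4 * D) * exp (2 * D) = exp (- 2 * D)" by (simp flip: exp_add)
  also note lower
  also have "(\<Sum>w\<in>W. exp (wsum g w)) = (\<Sum>w\<in>words (?m + n). exp (wsum g w) * indicator (cyl a) (per w))"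
    unfolding W_def sum.inter_filter[OF finite_words] by (intro sum.cong) (simp_all add: indicator_def)
  finally show ?thesis .
qed

text \<open>At \<open>s = 1\<close> the orbit averages come close to \<open>b\<close>; rewritten as
  point averages they keep at least the proportion \<open>\<eta>\<close> of the weight.\<close>

lemma derivative_pos:
  assumes D: "bounded_distortion D g" 
    and b: "\<forall>\<epsilon>>0. \<exists>\<delta>>0. \<forall>t. \<bar>t\<bar> \<le> \<delta> \<longrightarrow>
      pres (tilt g (\<lambda>x. indicator (cyl a) x) t) \<le> pres g + b * t + \<epsilon> * \<bar>t\<bar>"
  shows "b > 0"
proof -
  define h where "h = (\<lambda>x. indicator (cyl a) x :: real)"
  define \<eta> where "\<eta> = exp (- 4 * D) * exp (wsum g a) / Z g (length a)"
  have eta: "\<eta> > 0" using Z_pos by (simp add: \<eta>_def)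
  obtain N s0 where N: "s0 < 1" "\<And>n s. n \<ge> N \<Longrightarrow> s0 < s \<Longrightarrow> s \<le> 1 \<Longrightarrow>
     \<bar>(\<Sum>w\<in>words n. exp (s * wsum g w) * (wsum h w / real n)) - b * (\<Sum>w\<in>words n. exp (s * wsum g w))\<bar>
       \<le> \<eta> / 2 * (\<Sum>w\<in>words n. exp (s * wsum g w))"
    using orbit_averages_near_derivative[OF D bounded_distortion_cyl b half_gt_zero[OF eta]]
    unfolding h_def by blast
  define n where "n = length a + Suc N"
  have "\<eta> * Z g n \<le> (\<Sum>w\<in>words n. exp (wsum g w) * h (per w))"
    unfolding \<eta>_def n_def h_def by (rule cylinder_point_average[OF D])
  also have "\<dots> = (\<Sum>w\<in>words n. exp (wsum g w) * (wsum h w / real n))"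
    by (rule orbit_average_eq_point_average[symmetric]) (simp add: n_def)
  finally have "\<eta> * Z g n \<le> (\<Sum>w\<in>words n. exp (wsum g w) * (wsum h w / real n))" .
  moreover have "\<bar>(\<Sum>w\<in>words n. exp (wsum g w) * (wsum h w / real n)) - b * Z g n\<bar> \<le> \<eta> / 2 * Z g n"
    using N(2)[of n 1] N(1) by (simp add: n_def Z_def)
  ultimately have "\<eta> * Z g n - \<eta> / 2 * Z g n \<le> b * Z g n" by linarith
  then have "\<eta> / 2 * Z g n \<le> b * Z g n" by simp
  then have "\<eta> / 2 \<le> b" using Z_pos[of g n] by simp
  with eta show ?thesis by simp
qed

text \<open>The entropy is fixed by equality at \<open>t = 0\<close> and bounded by
  \<open>ks_entropy_le\<close> at every tilt, so the measure of the cylinder is the slope of a line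
  below the pressure that touches it at 0. Testing at \<open>\<delta>\<close> and
  \<open>- \<delta>\<close> forces this slope to be \<open>b\<close>.\<close>

lemma equilibrium_state_derivative:
  assumes D: "bounded_distortion D g" and meas: "g \<in> borel_measurable borel"
    and \<theta>: "0 < \<theta>" "\<theta> < 1" and eq: "equilibrium_state \<theta> g \<mu>"
    and b: "\<forall>\<epsilon>>0. \<exists>\<delta>>0. \<forall>t. \<bar>t\<bar> \<le> \<delta> \<longrightarrow>
      pres (tilt g (\<lambda>x. indicator (cyl a) x) t) \<le> pres g + b * t + \<epsilon> * \<bar>t\<bar>"
  shows "measure \<mu> (cyl a) = b"
proof -
  define h where "h = (\<lambda>x. indicator (cyl a) x :: real)"
  have inv: "\<mu> \<in> invariant_probs" and ks: "ks_entropy \<mu> + ereal (integral\<^sup>L \<mu> g) = ereal (pres g)"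
    using eq pressure_eq_pres[OF D \<theta>] by (auto simp: equilibrium_state_def)
  interpret prob_space \<mu> by (rule invariant_probsD(1)[OF inv])
  have sets: "sets \<mu> = sets borel" and space: "space \<mu> = UNIV"
    using invariant_probsD[OF inv] by auto
  \<comment> \<open>Equality with a finite pressure excludes infinite entropy.\<close>
  have ks': "ks_entropy \<mu> = ereal (pres g - integral\<^sup>L \<mu> g)"
    using ks by (cases "ks_entropy \<mu>") auto
  obtain B where B: "\<And>x. \<bar>g x\<bar> \<le> B" using bounded_distortion_bounded[OF D] by blast
  have int_g: "integrable \<mu> g"
  proof (rule integrable_const_bound)
    show "AE x in \<mu>. norm (g x) \<le> B" using B by simp
    show "g \<in> borel_measurable \<mu>" using meas by (simp only: measurable_cong_sets[OF sets refl])
  qed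
  have int_h: "integrable \<mu> h"
    unfolding h_def using borel_cyl[of a] by (intro integrable_real_indicator) (simp_all add: sets emeasure_eq_measure)
  have integral_h: "integral\<^sup>L \<mu> h = measure \<mu> (cyl a)"
    unfolding h_def by (simp add: space)
  have h_meas: "h \<in> borel_measurable borel"
    unfolding h_def using borel_cyl by simp
  have sub: "pres g + t * measure \<mu> (cyl a) \<le> pres (tilt g h t)" for t
  proof -
    have "ereal (pres g - integral\<^sup>L \<mu> g) \<le> ereal (pres (tilt g h t) - integral\<^sup>L \<mu> (tilt g h t))"
      unfolding ks'[symmetric]
    proof (rule ks_entropy_le[OF inv])
      show "bounded_distortion (D + \<bar>t\<bar> * real (length a)) (tilt g h t)"
        unfolding h_def by (rule bounded_distortion_tilt[OF D bounded_distortion_cyl])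
      show "tilt g h t \<in> borel_measurable borel"
        unfolding tilt_def using meas h_meas by simp
    qed
    moreover have "integral\<^sup>L \<mu> (tilt g h t) = integral\<^sup>L \<mu> g + t * measure \<mu> (cyl a)"
      unfolding tilt_def using int_g int_h by (simp add: integral_h)
    ultimately show ?thesis by simp
  qed
  have "\<bar>measure \<mu> (cyl a) - b\<bar> \<le> e" if e: "e > 0" for e
  proof -
    obtain \<delta> where d: "\<delta> > 0" "\<And>t. \<bar>t\<bar> \<le> \<delta> \<Longrightarrow> pres (tilt g h t) \<le> pres g + b * t + e * \<bar>t\<bar>"
      using b[rule_format, OF e] unfolding h_def by auto
    have "\<delta> * measure \<mu> (cyl a) \<le> \<delta> * (b + e)" "\<delta> * (- measure \<mu> (cyl a)) \<le> \<delta> * (- b + e)"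
      using sub[of \<delta>] d(2)[of \<delta>] sub[of "- \<delta>"] d(2)[of "- \<delta>"] d(1)
      by (simp_all add: algebra_simps)
    then have "measure \<mu> (cyl a) \<le> b + e" "- measure \<mu> (cyl a) \<le> - b + e"
      using d(1) by (simp_all only: mult_le_cancel_left_pos)
    then show ?thesis by linarith
  qed
  then have "\<bar>measure \<mu> (cyl a) - b\<bar> \<le> 0" by (rule field_le_epsilon) simp
  then show ?thesis by simp
qed

section \<open>The zeta measures\<close>


text \<open>Late terms have ratio within \<open>e / 2\<close> of \<open>b\<close>. The early ones
  contribute an error of at most \<open>real N * C\<close> uniformly in \<open>s\<close>, and the
  denominator outgrows it as \<open>s\<close> tends to 1.\<close>

lemma zeta_ratio_limit:
  assumes D: "bounded_distortion D g" and a: "0 < a" "\<And>x. a \<le> g x"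
    and b: "\<forall>\<epsilon>>0. \<exists>\<delta>>0. \<forall>t. \<bar>t\<bar> \<le> \<delta> \<longrightarrow>
      pres (tilt g (\<lambda>x. indicator (cyl v) x) t) \<le> pres g + b * t + \<epsilon> * \<bar>t\<bar>"
    and e: "e > 0"
  shows "\<exists>s1<1. \<forall>s. s1 < s \<longrightarrow> s < 1 \<longrightarrow>
    \<bar>(\<Sum>n. \<Sum>w\<in>words (Suc n). exp (s * wsum g w - real (Suc n) * pres g)
          * (wsum (\<lambda>x. indicator (cyl v) x) w / real (Suc n)))
      / (\<Sum>n. \<Sum>w\<in>words (Suc n). exp (s * wsum g w - real (Suc n) * pres g)) - b\<bar> \<le> e"
proof -
  define h where "h = (\<lambda>x. indicator (cyl v) x :: real)"
  define W where "W s n = (\<Sum>w\<in>words n. exp (s * wsum g w - real n * pres g))" for s n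
  define A where "A s n = (\<Sum>w\<in>words n. exp (s * wsum g w - real n * pres g) * (wsum h w / real n))" for s n
  have W_eq: "W s n = exp (- (real n * pres g)) * (\<Sum>w\<in>words n. exp (s * wsum g w))" for s n
    unfolding W_def sum_distrib_left exp_add[symmetric] by simp
  have A_eq: "A s n = exp (- (real n * pres g)) * (\<Sum>w\<in>words n. exp (s * wsum g w) * (wsum h w / real n))" for s n
    unfolding A_def sum_distrib_left mult.assoc[symmetric] exp_add[symmetric] by simp
  obtain B0 where B0: "\<And>x. \<bar>g x\<bar> \<le> B0" using bounded_distortion_bounded[OF D] by blast
  define B where "B = B0 + 1"
  have B: "\<bar>g x\<bar> \<le> B" for x using B0[of x] by (simp add: B_def)
  have Bpos: "B > 0" using B0[of undefined] by (simp add: B_def)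
  have W_pos: "0 < W s n" for s n unfolding W_def by (intro sum_pos) auto
  \<comment> \<open>Since \<open>g \<ge> a\<close>, passing from 1 to \<open>s\<close> gains a
    factor \<open>exp (- ((1 - s) * a))\<close> per letter over the weights at \<open>s = 1\<close>,
    whose normalised sums are at most \<open>exp (2 * D)\<close>.\<close>
  have W_upper: "W s n \<le> exp (2 * D) * exp (- ((1 - s) * a)) ^ n" if "s < 1" for s n
  proof -
    have "(\<Sum>w\<in>words n. exp (s * wsum g w)) \<le> (\<Sum>w\<in>words n. exp (- ((1 - s) * (real n * a))) * exp (wsum g w))"
    proof (rule sum_mono)
      fix w assume w: "w \<in> words n"
      have "(\<Sum>i<length w. a) \<le> wsum g w"
        unfolding wsum_def birkhoff_sum_def by (intro sum_mono a)
      then have "(1 - s) * (real n * a) \<le> (1 - s) * wsum g w"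
        using w that by (intro mult_left_mono) (auto simp: words_def)
      then show "exp (s * wsum g w) \<le> exp (- ((1 - s) * (real n * a))) * exp (wsum g w)"
        unfolding exp_add[symmetric] by (simp add: left_diff_distrib)
    qed
    also have "\<dots> = exp (- ((1 - s) * (real n * a))) * Z g n" by (simp add: Z_def sum_distrib_left)
    also have "\<dots> \<le> exp (- ((1 - s) * (real n * a))) * exp (real n * pres g + 2 * D)"
      by (intro mult_left_mono Z_bounds[OF D]) simp
    finally have "W s n \<le> exp (- (real n * pres g)) * (exp (- ((1 - s) * (real n * a))) * exp (real n * pres g + 2 * D))"
      unfolding W_eq by (intro mult_left_mono) auto
    also have "\<dots> = exp (2 * D) * exp (real n * - ((1 - s) * a))"
      unfolding exp_add[symmetric] by (simp add: algebra_simps)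
    finally show ?thesis by (simp only: exp_of_nat_mult)
  qed
  have W_lower: "exp (- ((1 - s) * (real n * B)) - 2 * D) \<le> W s n" if "s < 1" for s n
  proof -
    have "exp (- ((1 - s) * (real n * B)) - 2 * D)
        = exp (- (real n * pres g)) * (exp (- ((1 - s) * (real n * B))) * exp (real n * pres g - 2 * D))"
      unfolding exp_add[symmetric] by (simp add: algebra_simps)
    also have "\<dots> \<le> exp (- (real n * pres g)) * (exp (- ((1 - s) * (real n * B))) * Z g n)"
      by (intro mult_left_mono Z_bounds[OF D]) simp_all
    also have "exp (- ((1 - s) * (real n * B))) * Z g n \<le> (\<Sum>w\<in>words n. exp (s * wsum g w))"
      unfolding Z_def sum_distrib_left
    proof (rule sum_mono)
      fix w assume w: "w \<in> words n"
      have "wsum g w \<le> real n * B" using abs_wsum_le[of g B w, OF B] w by (auto simp: words_def)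
      then have "(1 - s) * wsum g w \<le> (1 - s) * (real n * B)"
        using that by (intro mult_left_mono) auto
      then show "exp (- ((1 - s) * (real n * B))) * exp (wsum g w) \<le> exp (s * wsum g w)"
        unfolding exp_add[symmetric] by (simp add: left_diff_distrib)
    qed
    then have "exp (- (real n * pres g)) * (exp (- ((1 - s) * (real n * B))) * Z g n) \<le> W s n"
      unfolding W_eq by (intro mult_left_mono) auto
    finally show ?thesis .
  qed
  have h_bounds: "0 \<le> wsum h w" "wsum h w \<le> real (length w)" for w
    using birkhoff_sum_indicator_bounds[of "cyl v" "length w" "per w"] by (auto simp: wsum_def h_def)
  have A_bounds: "0 \<le> A s (Suc n)" "A s (Suc n) \<le> W s (Suc n)" for s n
  proof -
    show "0 \<le> A s (Suc n)"
      unfolding A_def using h_bounds(1) by (intro sum_nonneg mult_nonneg_nonneg divide_nonneg_nonneg) auto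
    show "A s (Suc n) \<le> W s (Suc n)"
      unfolding A_def W_def
    proof (rule sum_mono)
      fix w assume "w \<in> words (Suc n)"
      then have "wsum h w / real (Suc n) \<le> 1" using h_bounds(2)[of w] by (simp add: words_def)
      then show "exp (s * wsum g w - real (Suc n) * pres g) * (wsum h w / real (Suc n))
          \<le> exp (s * wsum g w - real (Suc n) * pres g)"
        by (intro mult_left_le) auto
    qed
  qed
  have summable_W: "summable (\<lambda>n. W s (Suc n))" if "s < 1" for s
  proof -
    have "summable (\<lambda>n. exp (2 * D) * exp (- ((1 - s) * a)) ^ n)"
      using that a(1) by (intro summable_mult summable_geometric) simp
    then have "summable (\<lambda>n. W s n)"
    proof (rule summable_comparison_test')
      show "norm (W s n) \<le> exp (2 * D) * exp (- ((1 - s) * a)) ^ n" if "n \<ge> 0" for n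
        using W_upper[OF \<open>s < 1\<close>, of n] W_pos[of s n] by simp
    qed
    then show ?thesis by (simp add: summable_Suc_iff)
  qed
  have summable_A: "summable (\<lambda>n. A s (Suc n))" if "s < 1" for s
    by (rule summable_comparison_test'[OF summable_W[OF that], of 0]) (use A_bounds in simp)
  obtain N s0 where s0: "s0 < 1" and N: "\<And>n s. n \<ge> N \<Longrightarrow> s0 < s \<Longrightarrow> s \<le> 1 \<Longrightarrow>
     \<bar>(\<Sum>w\<in>words n. exp (s * wsum g w) * (wsum h w / real n)) - b * (\<Sum>w\<in>words n. exp (s * wsum g w))\<bar>
       \<le> e / 2 * (\<Sum>w\<in>words n. exp (s * wsum g w))"
    using orbit_averages_near_derivative[OF D bounded_distortion_cyl b half_gt_zero[OF e]]
    unfolding h_def by blast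
  \<comment> \<open>Bounds each early discrepancy, as \<open>A\<close> is at most \<open>W\<close>
    and \<open>W\<close> at most \<open>exp (2 * D)\<close>.\<close>
  define C where "C = (1 + \<bar>b\<bar>) * exp (2 * D)"
  have C: "C \<ge> 0" by (simp add: C_def)
  \<comment> \<open>The first \<open>M\<close> terms of the denominator, each at least
    \<open>exp (- 1 - 2 * D)\<close>, already outweigh the early error.\<close>
  define M where "M = Suc (nat \<lceil>real N * C / (e / 2 * exp (- 1 - 2 * D))\<rceil>)"
  have M: "real N * C \<le> e / 2 * (real M * exp (- 1 - 2 * D))"
  proof -
    have "real N * C / (e / 2 * exp (- 1 - 2 * D)) \<le> real M" unfolding M_def by linarith
    then show ?thesis using e by (simp add: pos_divide_le_eq mult_ac)
  qed
  \<comment> \<open>Gives \<open>(1 - s) * (real (Suc n) * B) \<le> 1\<close> for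
    \<open>n < M\<close>, the origin of the 1 in \<open>exp (- 1 - 2 * D)\<close>.\<close>
  define s1 where "s1 = max s0 (1 - 1 / (real M * B))"
  have "\<bar>(\<Sum>n. A s (Suc n)) / (\<Sum>n. W s (Suc n)) - b\<bar> \<le> e" if s: "s1 < s" "s < 1" for s
  proof -
    have s': "s0 < s" "1 - s < 1 / (real M * B)" using s by (auto simp: s1_def)
    define T where "T = (\<Sum>n. W s (Suc n))"
    have "real M * exp (- 1 - 2 * D) = (\<Sum>n<M. exp (- 1 - 2 * D))" by simp
    also have "\<dots> \<le> (\<Sum>n<M. W s (Suc n))"
    proof (rule sum_mono)
      fix n assume "n \<in> {..<M}"
      then have "(1 - s) * (real (Suc n) * B) \<le> 1 / (real M * B) * (real M * B)"
        using s s' Bpos by (intro mult_mono) auto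
      also have "\<dots> = 1" using Bpos by (simp add: M_def)
      finally have "exp (- 1 - 2 * D) \<le> exp (- ((1 - s) * (real (Suc n) * B)) - 2 * D)" by simp
      also have "\<dots> \<le> W s (Suc n)" by (rule W_lower[OF s(2)])
      finally show "exp (- 1 - 2 * D) \<le> W s (Suc n)" .
    qed
    also have "\<dots> \<le> T"
      unfolding T_def using W_pos summable_W[OF s(2)] by (intro sum_le_suminf) (auto simp: less_imp_le)
    finally have T: "real M * exp (- 1 - 2 * D) \<le> T" .
    moreover have "0 < real M * exp (- 1 - 2 * D)"
      by (intro mult_pos_pos) (simp_all add: M_def)
    ultimately have T_pos: "T > 0" by linarith
    have summand: "\<bar>A s (Suc n) - b * W s (Suc n)\<bar> \<le> e / 2 * W s (Suc n) + (if n < N then C else 0)" for n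
    proof (cases "n < N")
      case True
      have "\<bar>A s (Suc n) - b * W s (Suc n)\<bar> \<le> \<bar>A s (Suc n)\<bar> + \<bar>b * W s (Suc n)\<bar>"
        by (rule abs_triangle_ineq4)
      also have "\<dots> \<le> (1 + \<bar>b\<bar>) * W s (Suc n)"
        using A_bounds[of s n] W_pos[of s "Suc n"] by (simp add: abs_mult algebra_simps)
      also have "\<dots> \<le> C"
        unfolding C_def
      proof (rule mult_left_mono)
        have "W s (Suc n) \<le> exp (2 * D) * exp (- ((1 - s) * a)) ^ Suc n" by (rule W_upper[OF s(2)])
        also have "\<dots> \<le> exp (2 * D) * 1"
          using s(2) a(1) by (intro mult_left_mono power_le_one) auto
        finally show "W s (Suc n) \<le> exp (2 * D)" by simp
      qed simp
      finally show ?thesis using True e W_pos[of s "Suc n"] by (simp add: add_increasing)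
    next
      case False
      then have "exp (- (real (Suc n) * pres g)) *
          \<bar>(\<Sum>w\<in>words (Suc n). exp (s * wsum g w) * (wsum h w / real (Suc n))) - b * (\<Sum>w\<in>words (Suc n). exp (s * wsum g w))\<bar>
          \<le> exp (- (real (Suc n) * pres g)) * (e / 2 * (\<Sum>w\<in>words (Suc n). exp (s * wsum g w)))"
        using s s' by (intro mult_left_mono N) auto
      moreover have "exp (- (real (Suc n) * pres g)) * \<bar>x\<bar> = \<bar>exp (- (real (Suc n) * pres g)) * x\<bar>" for x
        by (simp add: abs_mult)
      ultimately show ?thesis
        using False unfolding A_eq W_eq by (simp only: right_diff_distrib mult.left_commute if_False add_0_right)
    qed
    have fin: "summable (\<lambda>n. if n < N then C else 0)" "(\<Sum>n. if n < N then C else 0) = real N * C"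
    proof -
      have "(\<lambda>n. if n \<in> {..<N} then C else 0) sums (\<Sum>n<N. C)" by (rule sums_If_finite_set) simp
      then show "summable (\<lambda>n. if n < N then C else 0)" "(\<Sum>n. if n < N then C else 0) = real N * C"
        by (auto simp: sums_iff)
    qed
    have sum_bound: "summable (\<lambda>n. e / 2 * W s (Suc n) + (if n < N then C else 0))"
      by (intro summable_add summable_mult summable_W s fin)
    have sum_diff: "summable (\<lambda>n. A s (Suc n) - b * W s (Suc n))"
      by (intro summable_diff summable_A summable_mult summable_W s)
    have "\<bar>(\<Sum>n. A s (Suc n) - b * W s (Suc n))\<bar>
        \<le> (\<Sum>n. e / 2 * W s (Suc n) + (if n < N then C else 0))"
      unfolding real_norm_def[symmetric] by (rule norm_suminf_le[OF _ sum_bound]) (simp only: real_norm_def summand)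
    also have "\<dots> = e / 2 * T + real N * C"
      unfolding T_def fin(2)[symmetric]
      by (simp only: suminf_add[symmetric] suminf_mult summable_mult summable_W[OF s(2)] fin(1))
    also have "\<dots> \<le> e / 2 * T + e / 2 * T"
      using M T e by (intro add_left_mono order_trans[OF M] mult_left_mono) auto
    also have "(\<Sum>n. A s (Suc n) - b * W s (Suc n)) = (\<Sum>n. A s (Suc n)) - b * T"
      unfolding T_def
      by (simp only: suminf_diff[symmetric] suminf_mult summable_mult summable_W[OF s(2)] summable_A[OF s(2)])
    finally have "\<bar>(\<Sum>n. A s (Suc n)) - b * T\<bar> \<le> e * T" by (simp add: mult.commute)
    moreover have "(\<Sum>n. A s (Suc n)) - b * T = ((\<Sum>n. A s (Suc n)) / T - b) * T"
      using T_pos by (simp add: left_diff_distrib)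
    ultimately have "\<bar>(\<Sum>n. A s (Suc n)) / T - b\<bar> * T \<le> e * T"
      using T_pos by (simp add: abs_mult)
    then show ?thesis using T_pos by (simp add: T_def)
  qed
  moreover have "s1 < 1" using s0 Bpos by (simp add: s1_def M_def)
  ultimately show ?thesis unfolding A_def W_def h_def by blast
qed

text \<open>Cylinders are clopen, so their indicators are admissible test functions in
  \<open>zeta_probability\<close>.\<close>

lemma zeta_measure_cyl:
  assumes D: "bounded_distortion D (\<lambda>x. c * f x)" and \<theta>: "0 < \<theta>" "\<theta> < 1"
    and zeta: "zeta_probability \<theta> f c s \<nu>"
  shows "measure \<nu> (cyl v) =
    (\<Sum>n. \<Sum>w\<in>words (Suc n). exp (s * wsum (\<lambda>x. c * f x) w - real (Suc n) * pres (\<lambda>x. c * f x))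
          * (wsum (\<lambda>x. indicator (cyl v) x) w / real (Suc n)))
      / (\<Sum>n. \<Sum>w\<in>words (Suc n). exp (s * wsum (\<lambda>x. c * f x) w - real (Suc n) * pres (\<lambda>x. c * f x)))"
proof -
  have inv: "\<nu> \<in> invariant_probs" using zeta by (simp add: zeta_probability_def)
  have wsum_eq: "birkhoff_sum k (Suc n) (per w) = wsum k w" if "w \<in> words (Suc n)" for k n w
    using that by (simp add: wsum_def words_def)
  have scale: "wsum (\<lambda>x. c * f x) w = c * wsum f w" for w
    using wsum_linear[of c f 0 f w] by simp
  have weight: "zeta_weight \<theta> f c s (Suc n) (per w)
      = exp (s * wsum (\<lambda>x. c * f x) w - real (Suc n) * pres (\<lambda>x. c * f x))"
    if "w \<in> words (Suc n)" for n w
    unfolding zeta_weight_def wsum_eq[OF that] pressure_eq_pres[OF D \<theta>] scale by (simp add: mult_ac)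
  have "measure \<nu> (cyl v) = integral\<^sup>L \<nu> (\<lambda>x. indicator (cyl v) x)"
    using invariant_probsD[OF inv] by simp
  also have "\<dots> = (\<Sum>n. \<Sum>x\<in>Fix (Suc n). zeta_weight \<theta> f c s (Suc n) x
        * (birkhoff_sum (\<lambda>x. indicator (cyl v) x) (Suc n) x / real (Suc n)))
      / (\<Sum>n. \<Sum>x\<in>Fix (Suc n). zeta_weight \<theta> f c s (Suc n) x)"
    using zeta continuous_on_cyl[of v] unfolding zeta_probability_def by blast
  also have "\<dots> = (\<Sum>n. \<Sum>w\<in>words (Suc n). exp (s * wsum (\<lambda>x. c * f x) w - real (Suc n) * pres (\<lambda>x. c * f x))
          * (wsum (\<lambda>x. indicator (cyl v) x) w / real (Suc n)))
      / (\<Sum>n. \<Sum>w\<in>words (Suc n). exp (s * wsum (\<lambda>x. c * f x) w - real (Suc n) * pres (\<lambda>x. c * f x)))"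
    unfolding Fix_eq_per_words sum_per_words
    by (intro arg_cong2[where f = "(/)"] suminf_cong sum.cong refl) (simp_all only: weight wsum_eq)
  finally show ?thesis .
qed

text \<open>As the limit \<open>b\<close> is positive, the tolerance \<open>b / 2\<close> is
  allowed; it puts the measures within a factor 2 of each other, and \<open>2 \<le> exp 1\<close>
  bounds the difference of logarithms.\<close>

lemma zeta_measure_close_to_equilibrium:
  assumes \<theta>: "0 < \<theta>" "\<theta> < 1" and lip: "seq_lipschitz \<theta> f" and pos: "\<And>x. f x > 0" and c: "c > 0"
    and eq: "equilibrium_state \<theta> (\<lambda>x. c * f x) \<mu>"
    and zeta: "\<And>s. 0 < s \<Longrightarrow> s < 1 \<Longrightarrow> zeta_probability \<theta> f c s (\<nu> s)"
  shows "\<exists>s1<1. \<forall>s. s1 < s \<longrightarrow> 0 < s \<longrightarrow> s < 1 \<longrightarrow> measure \<mu> (cyl v) > 0 \<and> measure (\<nu> s) (cyl v) > 0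
     \<and> \<bar>ln (measure (\<nu> s) (cyl v)) - ln (measure \<mu> (cyl v))\<bar> \<le> 1"
proof -
  define g where "g = (\<lambda>x. c * f x)"
  obtain D0 where "bounded_distortion D0 f" using seq_lipschitz_bounded_distortion[OF \<theta> lip] by blast
  from bounded_distortion_linear[OF this this, of c 0]
  obtain D where D: "bounded_distortion D g" by (auto simp: g_def)
  have cont: "continuous_on UNIV f" by (rule seq_lipschitz_continuous[OF \<theta> lip])
  obtain a0 where "a0 > 0" "\<And>x. a0 \<le> f x" using positive_lower_bound[OF cont pos] by blast
  then have a: "0 < c * a0" "\<And>x. c * a0 \<le> g x" using c by (auto simp: g_def)
  have meas: "g \<in> borel_measurable borel"
    unfolding g_def by (intro borel_measurable_continuous_onI continuous_intros cont)
  obtain b where b: "\<forall>\<epsilon>>0. \<exists>\<delta>>0. \<forall>t. \<bar>t\<bar> \<le> \<delta> \<longrightarrow>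
      pres (tilt g (\<lambda>x. indicator (cyl v) x) t) \<le> pres g + b * t + \<epsilon> * \<bar>t\<bar>"
    using pres_tilt_differentiable[OF D bounded_distortion_cyl] by blast
  have b_pos: "b > 0" by (rule derivative_pos[OF D b])
  have mu: "measure \<mu> (cyl v) = b"
    using equilibrium_state_derivative[OF D meas \<theta> _ b] eq by (simp add: g_def)
  obtain s1 where s1: "s1 < 1" "\<And>s. s1 < s \<Longrightarrow> s < 1 \<Longrightarrow>
    \<bar>(\<Sum>n. \<Sum>w\<in>words (Suc n). exp (s * wsum g w - real (Suc n) * pres g)
          * (wsum (\<lambda>x. indicator (cyl v) x) w / real (Suc n)))
      / (\<Sum>n. \<Sum>w\<in>words (Suc n). exp (s * wsum g w - real (Suc n) * pres g)) - b\<bar> \<le> b / 2"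
    using zeta_ratio_limit[OF D a b half_gt_zero[OF b_pos]] by blast
  have "measure (\<nu> s) (cyl v) > 0 \<and> \<bar>ln (measure (\<nu> s) (cyl v)) - ln b\<bar> \<le> 1"
    if s: "s1 < s" "0 < s" "s < 1" for s
  proof -
    define p where "p = measure (\<nu> s) (cyl v)"
    have "\<bar>p - b\<bar> \<le> b / 2"
      unfolding p_def zeta_measure_cyl[OF D[unfolded g_def] \<theta> zeta[OF s(2,3)]]
      using s1(2)[OF s(1,3)] unfolding g_def .
    then have p: "b / 2 \<le> p" "p \<le> 2 * b" using b_pos by linarith+
    then have p_pos: "p > 0" using b_pos by linarith
    have e2: "exp 1 \<ge> (2 :: real)" using exp_ge_add_one_self[of "1 :: real"] by simp
    have "p \<le> exp 1 * b" using p(2) mult_right_mono[OF e2, of b] b_pos by linarith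
    moreover have "b \<le> exp 1 * p" using p(1) mult_right_mono[OF e2, of p] p_pos by linarith
    ultimately have "ln p \<le> ln (exp 1 * b)" "ln b \<le> ln (exp 1 * p)"
      using p_pos b_pos by (simp_all add: ln_le_cancel_iff)
    then have "ln p \<le> 1 + ln b" "ln b \<le> 1 + ln p"
      using p_pos b_pos by (simp_all add: ln_mult_pos)
    with p_pos show ?thesis unfolding p_def by (simp add: abs_le_iff)
  qed
  with s1(1) mu b_pos show ?thesis by auto
qed

section \<open>The diagonal choice of thresholds\<close>

theorem proposition17:
  fixes \<theta> :: real
    and f :: "seq \<Rightarrow> real"
    and \<mu>_inf :: "seq measure"
    and \<mu>_eq :: "real \<Rightarrow> seq measure"
    and \<mu>_zeta :: "real \<Rightarrow> real \<Rightarrow> seq measure"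
    and I_BLT :: "seq \<Rightarrow> ennreal"
  assumes "0 < \<theta>" and "\<theta> < 1"
    and "seq_lipschitz \<theta> f"
    and "\<And>x. f x > 0"
    and "maximizing_probs f = {\<mu>_inf}"
    and "\<And>c. c > 0 \<Longrightarrow> equilibrium_state \<theta> (\<lambda>x. c * f x) (\<mu>_eq c)"
    and "\<And>c s. c > 0 \<Longrightarrow> 0 < s \<Longrightarrow> s < 1 \<Longrightarrow> zeta_probability \<theta> f c s (\<mu>_zeta c s)"
    and "deviation_function \<mu>_eq I_BLT"
  shows "\<exists>S :: real \<Rightarrow> real.
      (\<forall>c>0. 0 < S c \<and> S c < 1) \<and>
      ((\<lambda>c. c * (1 - S c)) \<longlongrightarrow> 0) at_top \<and>
      (\<forall>k. cylinder k \<longrightarrow>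
         ((\<lambda>(c, s). ereal (1 / c) * log_measure (\<mu>_zeta c s) k)
            \<longlongrightarrow> - enn2ereal (INF x\<in>k. I_BLT x))
           (inf (filtercomap fst at_top) (principal {(c, s). S c < s \<and> s < 1})) \<and>
         ((\<lambda>c. ereal (1 / c) * log_measure (\<mu>_eq c) k)
            \<longlongrightarrow> - enn2ereal (INF x\<in>k. I_BLT x)) at_top)"
proof -
  \<comment> \<open>For \<open>c \<le> 0\<close> only \<open>s1 < 1\<close> is required, so a
    threshold can be selected for every \<open>c\<close>.\<close>
  define P where "P c v s1 \<longleftrightarrow> s1 < 1 \<and> (c > 0 \<longrightarrow> (\<forall>s. s1 < s \<longrightarrow> 0 < s \<longrightarrow> s < 1 \<longrightarrow>
      measure (\<mu>_eq c) (cyl v) > 0 \<and> measure (\<mu>_zeta c s) (cyl v) > 0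
     \<and> \<bar>ln (measure (\<mu>_zeta c s) (cyl v)) - ln (measure (\<mu>_eq c) (cyl v))\<bar> \<le> 1))" for c v s1
  have ex: "\<exists>s1. P c v s1" for c v
  proof (cases "c > 0")
    case True
    show ?thesis
      using zeta_measure_close_to_equilibrium[OF assms(1-4) True assms(6)[OF True] assms(7)[OF True], of v]
      unfolding P_def by blast
  next
    case False
    then show ?thesis unfolding P_def by (intro exI[of _ 0]) simp
  qed
  define s1 where "s1 c v = (SOME s. P c v s)" for c v
  have P: "P c v (s1 c v)" for c v
    unfolding s1_def by (rule someI_ex[OF ex])
  have s1: "s1 c v < 1" for c v
    using P[of c v] by (simp add: P_def)
  have close: "measure (\<mu>_eq c) (cyl v) > 0 \<and> measure (\<mu>_zeta c s) (cyl v) > 0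
     \<and> \<bar>ln (measure (\<mu>_zeta c s) (cyl v)) - ln (measure (\<mu>_eq c) (cyl v))\<bar> \<le> 1"
    if "c > 0" "s1 c v < s" "0 < s" "s < 1" for c v s
    using P[of c v] that by (simp add: P_def)
  \<comment> \<open>\<open>1 / 2\<close> keeps \<open>S\<close> positive and
    \<open>1 - 1 / (1 + c)\<^sup>2\<close> forces \<open>c * (1 - S c)\<close> to 0. Only the
    finitely many words with code at most \<open>c\<close> impose a threshold, and each word does so
    once \<open>c\<close> reaches its code.\<close>
  define X where "X c = {1 / 2, 1 - 1 / (1 + c)\<^sup>2} \<union> (\<lambda>i. s1 c (from_nat i)) ` {i. real i \<le> c}" for c :: real
  define S where "S c = Max (X c)" for c
  have fin: "finite (X c)" for c
  proof -
    have "{i. real i \<le> c} \<subseteq> {..nat \<lceil>c\<rceil>}" by (auto simp: le_nat_iff) linarith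
    then have "finite {i. real i \<le> c}" by (rule finite_subset) simp
    then show ?thesis by (simp add: X_def)
  qed
  have S_ge: "x \<le> S c" if "x \<in> X c" for x c
    unfolding S_def using that fin by (rule Max_ge[rotated])
  have S_bounds: "0 < S c \<and> S c < 1" if "c > 0" for c
  proof
    show "0 < S c" using S_ge[of "1 / 2" c] by (simp add: X_def)
    show "S c < 1" unfolding S_def using that fin s1
      by (subst Max_less_iff) (auto simp: X_def)
  qed
  have S_lim: "((\<lambda>c. c * (1 - S c)) \<longlongrightarrow> 0) at_top"
  proof (rule tendsto_sandwich)
    show "\<forall>\<^sub>F c in at_top. 0 \<le> c * (1 - S c)"
      using eventually_gt_at_top[of 0] by eventually_elim (use S_bounds in \<open>simp add: less_imp_le\<close>)
    show "\<forall>\<^sub>F c in at_top. c * (1 - S c) \<le> 1 / c"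
      using eventually_gt_at_top[of 0]
    proof eventually_elim
      case (elim c)
      have "1 - S c \<le> 1 / (1 + c)\<^sup>2" using S_ge[of "1 - 1 / (1 + c)\<^sup>2" c] by (simp add: X_def)
      also have "\<dots> \<le> 1 / c\<^sup>2" using elim by (intro divide_left_mono power_mono) auto
      finally have "c * (1 - S c) \<le> c * (1 / c\<^sup>2)" using elim by (intro mult_left_mono) auto
      also have "\<dots> = 1 / c" by (simp add: power2_eq_square)
      finally show ?case .
    qed
    show "((\<lambda>c::real. 1 / c) \<longlongrightarrow> 0) at_top"
      by (intro tendsto_divide_0[OF tendsto_const] filterlim_at_top_imp_at_infinity filterlim_ident)
  qed simp
  define F where "F = inf (filtercomap fst at_top) (principal {(c, s). S c < s \<and> s < 1})"
  have F_fst: "filterlim fst at_top F"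
    unfolding F_def by (rule filterlim_mono[OF filterlim_filtercomap order_refl inf_le1])
  have F_S: "\<forall>\<^sub>F p in F. S (fst p) < snd p \<and> snd p < 1"
    unfolding F_def eventually_inf_principal by (intro always_eventually) auto
  have "((\<lambda>(c, s). ereal (1 / c) * log_measure (\<mu>_zeta c s) k) \<longlongrightarrow> - enn2ereal (INF x\<in>k. I_BLT x)) F \<and>
         ((\<lambda>c. ereal (1 / c) * log_measure (\<mu>_eq c) k) \<longlongrightarrow> - enn2ereal (INF x\<in>k. I_BLT x)) at_top"
    if cyl: "cylinder k" for k
  proof
    obtain v where k: "k = cyl v" using cylinder_eq_cyl[OF cyl] by blast
    define i where "i = to_nat v"
    define l where "l = - enn2ereal (INF x\<in>k. I_BLT x)"
    show eq_lim: "((\<lambda>c. ereal (1 / c) * log_measure (\<mu>_eq c) k) \<longlongrightarrow> l) at_top"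
      using assms(8) cyl unfolding deviation_function_def l_def by blast
    \<comment> \<open>The difference of the two normalised logarithms, eventually at most
      \<open>1 / fst p\<close> in absolute value.\<close>
    define r where "r p = (ln (measure (\<mu>_zeta (fst p) (snd p)) k) - ln (measure (\<mu>_eq (fst p)) k)) / fst p" for p
    have large: "\<forall>\<^sub>F p in F. fst p > 0 \<and> fst p \<ge> real i"
      using F_fst eventually_conj[OF eventually_gt_at_top[of 0] eventually_ge_at_top[of "real i"]]
      unfolding filterlim_iff by blast
    have good: "\<forall>\<^sub>F p in F. measure (\<mu>_eq (fst p)) k > 0 \<and> measure (\<mu>_zeta (fst p) (snd p)) k > 0
       \<and> \<bar>r p\<bar> \<le> 1 / fst p \<and> fst p > 0"
      using large F_S
    proof eventually_elim
      case (elim p)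
      have "s1 (fst p) v \<in> X (fst p)"
        using elim unfolding X_def i_def by (auto intro!: image_eqI[of _ _ "to_nat v"])
      then have "s1 (fst p) v < snd p" using S_ge elim by (meson le_less_trans)
      moreover have "0 < snd p" using S_bounds[of "fst p"] elim by linarith
      ultimately show ?case
        using close[of "fst p" v "snd p"] elim unfolding r_def k by (auto simp: divide_right_mono)
    qed
    have r_lim: "(r \<longlongrightarrow> 0) F"
    proof (rule tendsto_rabs_zero_cancel, rule tendsto_sandwich[where f = "\<lambda>_. 0" and h = "\<lambda>p. 1 / fst p"])
      show "\<forall>\<^sub>F p in F. \<bar>r p\<bar> \<le> 1 / fst p" using good by eventually_elim simp
      show "((\<lambda>p. 1 / fst p) \<longlongrightarrow> 0) F"
        by (intro tendsto_divide_0[OF tendsto_const] filterlim_at_top_imp_at_infinity F_fst)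
    qed auto
    \<comment> \<open>The limit \<open>l\<close> may be \<open>-\<infinity>\<close>; addition stays
      continuous there because the second summand has the finite limit 0.\<close>
    have "((\<lambda>p. ereal (1 / fst p) * log_measure (\<mu>_eq (fst p)) k + ereal (r p)) \<longlongrightarrow> l + ereal 0) F"
      by (intro tendsto_add_ereal_general1 filterlim_compose[OF eq_lim F_fst])
         (use r_lim in simp_all)
    \<comment> \<open>Positivity of both measures rules out the \<open>-\<infinity>\<close> branch
      of \<open>log_measure\<close>.\<close>
    moreover have "\<forall>\<^sub>F p in F. ereal (1 / fst p) * log_measure (\<mu>_eq (fst p)) k + ereal (r p)
        = (case p of (c, s) \<Rightarrow> ereal (1 / c) * log_measure (\<mu>_zeta c s) k)"
      using good
    proof eventually_elim
      case (elim p)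
      then show ?case
        by (simp add: log_measure_def r_def case_prod_unfold field_simps)
    qed
    ultimately show "((\<lambda>(c, s). ereal (1 / c) * log_measure (\<mu>_zeta c s) k) \<longlongrightarrow> l) F"
      by (simp add: Lim_transform_eventually)
  qed
  with S_bounds S_lim show ?thesis unfolding F_def by (intro exI[of _ S]) blast
qed

end
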